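(* Let $k\geq 3$ and let $H$ be a $k$-graph. Then there exists an integer $n_0=n_0(H)$ such that for all $n\geq n_0$ with $n\equiv 0\pmod{k-1}$, $$R(C^{(k)}_{n,1},H)\leq (\chi(H)-1)(n-1)+4k\binom{\chi(H)-1}{2}+\tau(k-1,\sigma(H))+1.$$
   Context: A $k$-graph is a $k$-uniform hypergraph. $R(G,H)$ is the least $N$ such that every red/blue colouring of the edges of $K^{(k)}_N$ contains a red copy of $G$ or a blue copy of $H$. $\chi(H)$ is the least number of colours in a vertex colouring with no monochromatic edge; $\sigma(H)$ is the smallest possible size of a colour class in such a colouring using $\chi(H)$ colours. For $n=q(k-1)$, $q\ge1$, the loose cycle $C^{(k)}_{n,1}$ has vertices $v_1,\dots,v_n$ and edges $e_i=\{v_{(i-1)(k-1)+1},\dots,v_{i(k-1)+1}\}$ for $i\in[q]$, indices taken with $v_{n+1}=v_1$. For integers $j,\alpha\ge1$, $\tau(j,\alpha)$ is the largest $N$ such that some $j$-uniform hypergraph on $N$ vertices has independence number less than $\alpha$ and no two edges meeting in exactly one vertex. *)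

theory Defs
  imports Main
begin

definition kgraph :: "nat \<Rightarrow> 'a set \<Rightarrow> 'a set set \<Rightarrow> bool" where
  "kgraph k V E \<longleftrightarrow> finite V \<and> (\<forall>e\<in>E. e \<subseteq> V \<and> card e = k)"

definition proper_colouring :: "'a set \<Rightarrow> 'a set set \<Rightarrow> nat \<Rightarrow> ('a \<Rightarrow> nat) \<Rightarrow> bool" where
  "proper_colouring V E c f \<longleftrightarrow>
     (\<forall>v\<in>V. f v < c) \<and> (\<forall>e\<in>E. \<not> (\<exists>i. \<forall>v\<in>e. f v = i))"

definition chromatic_number :: "'a set \<Rightarrow> 'a set set \<Rightarrow> nat" where
  "chromatic_number V E = (LEAST c. \<exists>f. proper_colouring V E c f)"

definition sigma :: "'a set \<Rightarrow> 'a set set \<Rightarrow> nat" where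
  "sigma V E = (LEAST s. \<exists>f i. proper_colouring V E (chromatic_number V E) f
        \<and> i < chromatic_number V E \<and> s = card {v\<in>V. f v = i})"

definition indep_less :: "'a set \<Rightarrow> 'a set set \<Rightarrow> nat \<Rightarrow> bool" where
  "indep_less V E \<alpha> \<longleftrightarrow> (\<forall>S\<subseteq>V. (\<forall>e\<in>E. \<not> e \<subseteq> S) \<longrightarrow> card S < \<alpha>)"

definition tau :: "nat \<Rightarrow> nat \<Rightarrow> nat" where
  "tau j \<alpha> = (GREATEST N. \<exists>E::nat set set. kgraph j {..<N} E \<and> indep_less {..<N} E \<alpha>
        \<and> (\<forall>e1\<in>E. \<forall>e2\<in>E. card (e1 \<inter> e2) \<noteq> 1))"

text \<open>Loose cycle C^{(k)}_{n,1} on vertices 0..<n (vertex v_{m+1} of the paper is m),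
  edges e_i = {v_{i(k-1)}, ..., v_{i(k-1)+k-1}} (indices mod n), i < n div (k-1).\<close>
definition loose_cycle_edges :: "nat \<Rightarrow> nat \<Rightarrow> nat set set" where
  "loose_cycle_edges k n = (\<lambda>i. {(i * (k - 1) + j) mod n | j. j \<le> k - 1}) ` {..< n div (k - 1)}"

definition mono_copy :: "nat \<Rightarrow> (nat set \<Rightarrow> bool) \<Rightarrow> bool \<Rightarrow> 'a set \<Rightarrow> 'a set set \<Rightarrow> bool" where
  "mono_copy N c b V E \<longleftrightarrow>
     (\<exists>\<phi>. inj_on \<phi> V \<and> \<phi> ` V \<subseteq> {..<N} \<and> (\<forall>e\<in>E. c (\<phi> ` e) = b))"

text \<open>R(G,H) for k-graphs: colouring c, True = red, False = blue.\<close>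
definition ramsey_number :: "nat \<Rightarrow> 'a set \<Rightarrow> 'a set set \<Rightarrow> 'b set \<Rightarrow> 'b set set \<Rightarrow> nat" where
  "ramsey_number k VG EG VH EH = (LEAST N. \<forall>c :: nat set \<Rightarrow> bool.
      mono_copy N c True VG EG \<or> mono_copy N c False VH EH)"

end

theory Submission
  imports Defs "HOL-Library.Ramsey"
begin

text \<open>
  Suppose that a colouring has neither a red loose cycle on \<open>n\<close> vertices nor a blue copy of \<open>H\<close>,
  and put \<open>r = \<chi>(H) - 1\<close>. As there is no large blue clique, every large set contains a large red clique.

  Greedily choose \<open>r\<close> disjoint red cycles, each of the maximum length below \<open>n\<close> among the cycles in the
  remaining vertex set that run through many prescribed red cliques (marks). By maximality a mark of an
  earlier cycle cannot be joined to a disjoint red clique by two disjoint red edges, since the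
  clique could be inserted. So a red clique in the rest would, after deleting boundedly many vertices,
  yield a blue complete \<open>(r + 1)\<close>-partite hypergraph; hence only boundedly many vertices are left over.
  Inserting smaller red cliques, each at the cost of one mark per cycle, shrinks the set \<open>Z\<close> of
  leftover vertices until it is small compared with a single mark, and each cycle still has one.

  Two disjoint short red connections between the marks of two cycles would yield a cycle on exactly
  \<open>n\<close> vertices, so deleting at most \<open>2k\<close> vertices per pair destroys all connections. Finally absorb
  as many vertices of \<open>Z\<close> as possible by red detours of at most two edges from a mark to itself. At most
  \<open>\<tau>(k - 1, \<sigma>(H))\<close> vertices survive: otherwise their \<open>(k - 1)\<close>-sets that form a red edge with two
  vertices of a mark either leave \<open>\<sigma>(H)\<close> of the vertices independent, which gives a blue \<open>H\<close>, or
  contain two sets meeting in one vertex, which gives a detour or a connection. By counting, some cycle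
  with its detours has at least \<open>n\<close> vertices, and it can be shortened inside its mark to exactly \<open>n\<close>.
\<close>

section \<open>Ramsey's theorem and the numbers \<open>\<tau>(j, \<alpha>)\<close>\<close>

text \<open>The cycle needs exactly \<open>n\<close> vertices, so each construction must offer a
  whole range of lengths. Marks serve this purpose: inside a red clique a loose path between two
  given vertices may have any number of edges that fits. Cycles whose lengths run through
  consecutive multiples of \<open>k - 1\<close> cannot jump over \<open>n\<close>.

  The main obstacle is a circle of constants. Maximality bounds the leftover only by a Ramsey number
  of the mark size, while absorption needs marks exponentially larger than the leftover, since up to
  \<open>2 ^ z\<close> vertices of a mark are discarded. The shrinking stage breaks the circle: the
  cliques inserted there have a size depending only on \<open>k\<close>, \<open>r\<close> and the
  number of vertices of \<open>H\<close>, so the final bound \<open>z\<close> on the leftover does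
  not involve the mark size. Hence the order of choice: \<open>z\<close>, mark sizes, number of
  marks per cycle (more than the first leftover bound), and \<open>n0\<close> last.\<close>

lemma ramsey_subset:
  assumes "ES k p q \<le> card U"
  obtains H where "H \<subseteq> U" "finite H" "card H = p" "\<forall>e\<subseteq>H. card e = k \<longrightarrow> \<not> c e"
  | H where "H \<subseteq> U" "finite H" "card H = q" "\<forall>e\<subseteq>H. card e = k \<longrightarrow> c e"
proof -
  define N where "N = ES k p q"
  obtain U' where U': "U' \<subseteq> U" "card U' = N" "finite U'"
    using assms obtain_subset_with_card_n unfolding N_def by metis
  obtain h where h: "bij_betw h {..<N} U'"
    using ex_bij_betw_nat_finite[OF U'(3)] U'(2) by (auto simp: atLeast0LessThan)
  \<comment> \<open>Colour 0 stands for \<open>\<not> c\<close>, so in the list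
    \<open>[p, q]\<close> the size \<open>p\<close> belongs to sets avoiding
    \<open>c\<close>.\<close>
  define f where "f e = (if c (h ` e) then 1 else (0::nat))" for e
  have "partn_lst {..<N} [p, q] k"
    unfolding N_def by (rule ramsey2_full)
  then obtain i H where i: "i < 2" and H: "H \<in> nsets {..<N} ([p,q] ! i)" and
      mono: "f ` nsets H k \<subseteq> {i}"
    unfolding partn_lst_def monochromatic_def
    by (fastforce simp: f_def numeral_2_eq_2 dest!: bspec[where x=f])
  have inj: "inj_on h H"
    using H h by (auto simp: bij_betw_def nsets_def intro: inj_on_subset)
  have sub: "h ` H \<subseteq> U" "finite (h ` H)" "card (h ` H) = [p,q] ! i"
    using H h U' inj by (auto simp: bij_betw_def nsets_def card_image)
  have col: "(c e \<longleftrightarrow> i = 1)" if e: "e \<subseteq> h ` H" "card e = k" for e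
  proof -
    obtain e' where e': "e' \<subseteq> H" "e = h ` e'"
      using e(1) by (auto simp: subset_image_iff)
    have "card e' = k"
      using e' e(2) inj by (metis card_image inj_on_subset)
    moreover have "finite e'"
      using e'(1) H by (auto simp: nsets_def intro: finite_subset)
    ultimately have "f e' = i"
      using mono e'(1) by (auto simp: nsets_def image_subset_iff)
    then show ?thesis using e' i by (auto simp: f_def split: if_splits)
  qed
  show ?thesis
  proof (cases "i = 0")
    case True then show ?thesis using that(1)[of "h ` H"] sub col by auto
  next
    case False
    then have "i = 1" using i by simp
    then show ?thesis using that(2)[of "h ` H"] sub col by auto
  qed
qed

text \<open>In an intersecting family any single member meets all members (the case
  \<open>e = f\<close> makes members nonempty). So one member per index, or nothing for an empty
  family, makes up \<open>D\<close>.\<close>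

lemma intersecting_hitting_set:
  assumes "finite Q" and "\<And>q e f. \<lbrakk>q \<in> Q; e \<in> F q; f \<in> F q\<rbrakk> \<Longrightarrow> e \<inter> f \<noteq> {}"
    and "\<And>q e. \<lbrakk>q \<in> Q; e \<in> F q\<rbrakk> \<Longrightarrow> finite e \<and> card e \<le> b"
  obtains D where "finite D" "card D \<le> card Q * b" "\<And>q e. \<lbrakk>q \<in> Q; e \<in> F q\<rbrakk> \<Longrightarrow> e \<inter> D \<noteq> {}"
proof -
  define g where "g q = (if F q = {} then {} else (SOME e. e \<in> F q))" for q
  have g: "g q \<in> F q \<or> F q = {} \<and> g q = {}" for q
    unfolding g_def by (auto intro: someI)
  have bd: "finite (g q) \<and> card (g q) \<le> b" if "q \<in> Q" for q
    using g[of q] assms(3)[of q "g q"] that by auto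
  show ?thesis
  proof
    show "finite (\<Union>q\<in>Q. g q)" using assms(1) bd by auto
    have "card (\<Union>q\<in>Q. g q) \<le> (\<Sum>q\<in>Q. card (g q))" by (rule card_UN_le[OF assms(1)])
    also have "\<dots> \<le> card Q * b" using bd by (metis mult.commute sum_bounded_above of_nat_id)
    finally show "card (\<Union>q\<in>Q. g q) \<le> card Q * b" .
    show "e \<inter> (\<Union>q\<in>Q. g q) \<noteq> {}" if "q \<in> Q" "e \<in> F q" for q e
      using assms(2)[OF that, of "g q"] g[of q] that by blast
  qed
qed

lemma subset_between:
  assumes "finite B" "A \<subseteq> B" "card A \<le> n" "n \<le> card B"
  obtains C where "A \<subseteq> C" "C \<subseteq> B" "card C = n"
proof -
  have fA: "finite A" using assms finite_subset by blast
  have "n - card A \<le> card (B - A)" using assms fA by (simp add: card_Diff_subset)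
  then obtain D where D: "D \<subseteq> B - A" "card D = n - card A" "finite D"
    by (meson obtain_subset_with_card_n)
  have "card (A \<union> D) = n" using D fA assms(3) by (subst card_Un_disjoint) auto
  then show ?thesis using that[of "A \<union> D"] D assms(2) by auto
qed

text \<open>A \<open>GREATEST\<close> is meaningful only once the admissible \<open>N\<close> are
  bounded. Ramsey's theorem bounds them: without an independent set of size \<open>\<alpha>\<close>
  a large hypergraph contains \<open>2 * j\<close> vertices all of whose \<open>j\<close>-subsets
  are edges, and among these are two edges meeting in one vertex.\<close>

lemma tau_fails:
  assumes "2 \<le> j"
  shows "\<not> (\<exists>E::nat set set. kgraph j {..<Suc (tau j \<alpha>)} E \<and> indep_less {..<Suc (tau j \<alpha>)} E \<alpha>
        \<and> (\<forall>e1\<in>E. \<forall>e2\<in>E. card (e1 \<inter> e2) \<noteq> 1))"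
proof
  define P where "P N \<longleftrightarrow> (\<exists>E::nat set set. kgraph j {..<N} E \<and> indep_less {..<N} E \<alpha>
        \<and> (\<forall>e1\<in>E. \<forall>e2\<in>E. card (e1 \<inter> e2) \<noteq> 1))" for N
  have tau: "tau j \<alpha> = (GREATEST N. P N)" unfolding tau_def P_def ..
  assume "\<exists>E::nat set set. kgraph j {..<Suc (tau j \<alpha>)} E \<and> indep_less {..<Suc (tau j \<alpha>)} E \<alpha>
        \<and> (\<forall>e1\<in>E. \<forall>e2\<in>E. card (e1 \<inter> e2) \<noteq> 1)"
  then have P: "P (Suc (tau j \<alpha>))" unfolding P_def .
  have bound: "N < ES j \<alpha> (2 * j)" if N: "P N" for N
  proof (rule ccontr)
    assume "\<not> N < ES j \<alpha> (2 * j)"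
    then have "ES j \<alpha> (2 * j) \<le> card {..<N}" by simp
    moreover obtain E :: "nat set set" where E: "kgraph j {..<N} E" "indep_less {..<N} E \<alpha>"
        "\<And>e1 e2. e1 \<in> E \<Longrightarrow> e2 \<in> E \<Longrightarrow> card (e1 \<inter> e2) \<noteq> 1"
      using N unfolding P_def by blast
    ultimately show False
    proof (cases rule: ramsey_subset[where c = "\<lambda>e. e \<in> E"])
      case (1 H)
      then have "\<forall>e\<in>E. \<not> e \<subseteq> H" using E(1) by (auto simp: kgraph_def)
      then show False using E(2) 1 by (auto simp: indep_less_def)
    next
      case (2 H)
      \<comment> \<open>Two edges sharing exactly \<open>x\<close> occupy \<open>2 * j - 1\<close>
        of the \<open>2 * j\<close> vertices.\<close>
      then obtain x where x: "x \<in> H" using assms by fastforce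
      have "j - 1 \<le> card (H - {x})" using 2 x by simp
      then obtain A where A: "A \<subseteq> H - {x}" "card A = j - 1" "finite A"
        using obtain_subset_with_card_n by metis
      have "j - 1 \<le> card (H - {x} - A)"
        using 2 x A by (subst card_Diff_subset) auto
      then obtain B where B: "B \<subseteq> H - {x} - A" "card B = j - 1" "finite B"
        using obtain_subset_with_card_n by metis
      have "card (insert x A) = j" "card (insert x B) = j"
        using A B assms by (auto simp: card_insert_if)
      moreover have "insert x A \<subseteq> H" "insert x B \<subseteq> H" using A B x by auto
      ultimately have "insert x A \<in> E" "insert x B \<in> E"
        using 2(4) \<open>insert x A \<subseteq> H\<close> \<open>insert x B \<subseteq> H\<close> by simp_all
      moreover have "insert x A \<inter> insert x B = {x}" using A B by auto
      ultimately show False using E(3)[of "insert x A" "insert x B"] by (metis card_1_singleton_iff One_nat_def)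
    qed
  qed
  have "Suc (tau j \<alpha>) \<le> (GREATEST N. P N)"
  proof (rule Greatest_le_nat[where P = P, OF P])
    show "y \<le> ES j \<alpha> (2 * j)" if "P y" for y using bound[OF that] by linarith
  qed
  then have "Suc (tau j \<alpha>) \<le> tau j \<alpha>" by (simp only: tau)
  then show False by simp
qed

text \<open>The form in which \<open>tau\<close> is applied: its failure is transported from initial
  segments of the naturals to an arbitrary set, with the members of \<open>F\<close> as edges.
  Because \<open>tau_fails\<close> concerns the single value \<open>Suc (tau j \<alpha>)\<close>,
  \<open>Z\<close> is first cut down to exactly that size.\<close>

lemma tau_dichotomy:
  assumes "2 \<le> j" "finite Z" "tau j \<alpha> < card Z" "\<And>T. T \<in> F \<Longrightarrow> card T = j"
  obtains S where "S \<subseteq> Z" "card S = \<alpha>" "\<And>T. T \<in> F \<Longrightarrow> \<not> T \<subseteq> S"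
  | T1 T2 where "T1 \<in> F" "T2 \<in> F" "T1 \<subseteq> Z" "T2 \<subseteq> Z" "card (T1 \<inter> T2) = 1"
proof (cases "\<exists>T1\<in>F. \<exists>T2\<in>F. T1 \<subseteq> Z \<and> T2 \<subseteq> Z \<and> card (T1 \<inter> T2) = 1")
  case True then show ?thesis using that by blast
next
  case False
  define N where "N = Suc (tau j \<alpha>)"
  obtain Z' where Z': "Z' \<subseteq> Z" "card Z' = N" "finite Z'"
    using assms(3) obtain_subset_with_card_n unfolding N_def by (metis Suc_leI)
  obtain h where h: "bij_betw h {..<N} Z'"
    using ex_bij_betw_nat_finite[OF Z'(3)] Z'(2) by (auto simp: atLeast0LessThan)
  have inj: "inj_on h A" if "A \<subseteq> {..<N}" for A
    using h that by (auto simp: bij_betw_def intro: inj_on_subset)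
  have im: "h ` A \<subseteq> Z" if "A \<subseteq> {..<N}" for A
    using h that Z' by (auto simp: bij_betw_def)
  define E where "E = {e. e \<subseteq> {..<N} \<and> h ` e \<in> F}"
  have "card e = j" if "e \<in> E" for e
    using that assms(4) inj by (auto simp: E_def) (metis card_image)
  then have "kgraph j {..<N} E" by (auto simp: kgraph_def E_def)
  moreover have "\<forall>e1\<in>E. \<forall>e2\<in>E. card (e1 \<inter> e2) \<noteq> 1"
  proof (intro ballI)
    fix e1 e2 assume e: "e1 \<in> E" "e2 \<in> E"
    have "h ` (e1 \<inter> e2) = h ` e1 \<inter> h ` e2"
      using inj_on_image_Int[OF inj[OF order_refl]] e by (auto simp: E_def)
    then have "card (e1 \<inter> e2) = card (h ` e1 \<inter> h ` e2)"
      using inj[of "e1 \<inter> e2"] e by (metis (no_types, lifting) CollectD E_def card_image inf.coboundedI1)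
    then show "card (e1 \<inter> e2) \<noteq> 1" using False e im by (auto simp: E_def)
  qed
  ultimately have "\<not> indep_less {..<N} E \<alpha>"
    using tau_fails[OF assms(1), of \<alpha>] unfolding N_def by blast
  then obtain S0 where S0: "S0 \<subseteq> {..<N}" "\<forall>e\<in>E. \<not> e \<subseteq> S0" "\<alpha> \<le> card S0"
    by (auto simp: indep_less_def not_less)
  obtain S where S: "S \<subseteq> S0" "card S = \<alpha>"
    using S0(3) obtain_subset_with_card_n by metis
  have SN: "S \<subseteq> {..<N}" using S S0 by auto
  show ?thesis
  proof (rule that(1)[of "h ` S"])
    show "h ` S \<subseteq> Z" using im SN .
    show "card (h ` S) = \<alpha>" using S inj[OF SN] by (simp add: card_image)
    show "\<not> T \<subseteq> h ` S" if "T \<in> F" for T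
    proof
      assume "T \<subseteq> h ` S"
      then obtain e where "e \<subseteq> S" "T = h ` e" by (auto simp: subset_image_iff)
      then have "e \<in> E" using that SN by (auto simp: E_def)
      then show False using S0(2) S(1) \<open>e \<subseteq> S\<close> by blast
    qed
  qed
qed

section \<open>Loose paths and cycles\<close>

lemma bij_betw_eqI: "bij_betw f A B \<Longrightarrow> (\<And>a. a \<in> A \<Longrightarrow> g a = f a) \<Longrightarrow> bij_betw g A B"
  by (metis bij_betw_cong)

locale red_hypergraph =
  fixes k :: nat and red :: "'v set \<Rightarrow> bool"
  assumes k3: "3 \<le> k"
begin

definition redge :: "'v set \<Rightarrow> bool" where
  "redge e \<longleftrightarrow> card e = k \<and> red e"

text \<open>Only the vertex set and the two ends are recorded, so paths can be glued by taking
  unions; the edges live in the derivation.\<close>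

inductive lpath :: "'v set \<Rightarrow> 'v \<Rightarrow> 'v \<Rightarrow> bool" where
  edge: "\<lbrakk>redge e; x \<in> e; y \<in> e; x \<noteq> y\<rbrakk> \<Longrightarrow> lpath e x y"
| step: "\<lbrakk>lpath X x y; redge e; X \<inter> e = {y}; z \<in> e; z \<noteq> y\<rbrakk> \<Longrightarrow> lpath (X \<union> e) x z"

text \<open>The closing edge meets the path in its two ends only. If the path is a single edge, the
  result is the loose cycle of two edges sharing two vertices.\<close>

definition cyc :: "'v set \<Rightarrow> bool" where
  "cyc X \<longleftrightarrow> (\<exists>Y e x y. lpath Y x y \<and> redge e \<and> Y \<inter> e = {x, y} \<and> X = Y \<union> e)"

definition clq :: "'v set \<Rightarrow> bool" where
  "clq K \<longleftrightarrow> finite K \<and> (\<forall>e\<subseteq>K. card e = k \<longrightarrow> red e)"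

lemma redgeD: "redge e \<Longrightarrow> card e = k" "redge e \<Longrightarrow> finite e"
  using k3 by (auto simp: redge_def intro: card_ge_0_finite)

lemma lpathD:
  "lpath X x y \<Longrightarrow> finite X \<and> x \<in> X \<and> y \<in> X \<and> x \<noteq> y"
  by (induction rule: lpath.induct) (use redgeD in auto)

lemma lpath_card:
  "lpath X x y \<Longrightarrow> \<exists>q\<ge>1. card X = (k - 1) * q + 1"
proof (induction rule: lpath.induct)
  case (edge e x y)
  then show ?case using redgeD[of e] k3 by (intro exI[of _ 1]) auto
next
  case (step X x y e z)
  then obtain q where q: "1 \<le> q" "card X = (k - 1) * q + 1" by auto
  have "card (X \<union> e) + 1 = card X + card e"
    using card_Un_Int[of X e] step lpathD[OF step(1)] redgeD[of e] by simp
  then have "card (X \<union> e) = (k - 1) * Suc q + 1" using q redgeD[OF step(2)] k3 by simp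
  then show ?case by (intro exI[of _ "Suc q"]) simp
qed

lemma lpath_append:
  assumes "lpath Y y z" "lpath X x y" "X \<inter> Y = {y}"
  shows "lpath (X \<union> Y) x z"
  using assms
proof (induction arbitrary: X rule: lpath.induct)
  case (edge e y z)
  then show ?case by (auto intro: lpath.step)
next
  case (step Y y y' e z)
  have y: "y \<in> Y" "y \<noteq> y'" using lpathD[OF step(1)] by auto
  have "X \<inter> Y = {y}" using step.prems y by auto
  then have "lpath (X \<union> Y) x y'" using step by auto
  moreover have "(X \<union> Y) \<inter> e = {y'}" using step y by blast
  ultimately have "lpath (X \<union> Y \<union> e) x z" using step lpath.step by blast
  then show ?case by (simp add: Un_assoc)
qed

lemma lpath_sym: "lpath X x y \<Longrightarrow> lpath X y x"
proof (induction rule: lpath.induct)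
  case (edge e x y)
  then show ?case by (auto intro: lpath.edge)
next
  case (step X x y e z)
  have "lpath e z y" using step by (auto intro: lpath.edge)
  then have "lpath (e \<union> X) z x" using step by (intro lpath_append[where y = y]) auto
  then show ?case by (simp add: Un_commute)
qed

lemma clq_subset: "clq K \<Longrightarrow> L \<subseteq> K \<Longrightarrow> clq L"
  unfolding clq_def using finite_subset by blast

lemma clq_redge: "clq K \<Longrightarrow> e \<subseteq> K \<Longrightarrow> card e = k \<Longrightarrow> redge e"
  by (auto simp: clq_def redge_def)

text \<open>The last edge is peeled off: \<open>k - 1\<close> vertices including \<open>y\<close>
  but not \<open>x\<close> are cut away, and any vertex other than \<open>x\<close> of the remaining
  clique can serve as the joint.\<close>

lemma clq_lpath:
  assumes "clq K" "card K = (k - 1) * q + 1" "1 \<le> q" "x \<in> K" "y \<in> K" "x \<noteq> y"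
  shows "lpath K x y"
  using assms(3,1,2,4,5,6)
proof (induction arbitrary: K y rule: dec_induct)
  case base
  then have "redge K" using k3 by (intro clq_redge[of K]) auto
  then show ?case using base by (intro lpath.edge)
next
  case (step q)
  have fK: "finite K" using step.prems by (simp add: clq_def)
  have "k - 1 \<le> card (K - {x})" using fK step by simp
  obtain e0 where e0: "{y} \<subseteq> e0" "e0 \<subseteq> K - {x}" "card e0 = k - 1"
    by (rule subset_between[of "K - {x}" "{y}" "k - 1"]) (use \<open>k - 1 \<le> card (K - {x})\<close> fK step.prems k3 in auto)
  have fe0: "finite e0" using fK e0 finite_subset by blast
  define L where "L = K - e0"
  have cL: "card L = (k - 1) * q + 1"
    using e0 fK fe0 step.prems unfolding L_def by (subst card_Diff_subset) auto
  have xL: "x \<in> L" "L \<subseteq> K" using e0 step.prems by (auto simp: L_def)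
  have "card (L - {x}) = (k - 1) * q" using cL xL by simp
  moreover have "0 < (k - 1) * q" using step k3 by simp
  ultimately have "0 < card (L - {x})" by linarith
  then obtain z where z: "z \<in> L" "z \<noteq> x"
    by (metis card_gt_0_iff Diff_iff ex_in_conv singletonI)
  have "lpath L x z"
    using step.IH[of L z] cL xL z clq_subset[OF step.prems(1) xL(2)] by simp
  moreover have "z \<notin> e0" using z L_def by auto
  then have "redge (insert z e0)"
    using e0 fe0 z k3 xL by (intro clq_redge[OF step.prems(1)]) auto
  ultimately have "lpath (L \<union> insert z e0) x y"
    using z e0 L_def by (intro lpath.step[where y = z]) auto
  moreover have "L \<union> insert z e0 = K" using z e0 L_def by auto
  ultimately show ?case by simp
qed

text \<open>The source of all flexibility in length: \<open>q\<close> may be any positive number of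
  edges for which the clique has room.\<close>

lemma clq_lpath_ex:
  assumes "clq K" "x \<in> K" "y \<in> K" "x \<noteq> y" "1 \<le> q" "(k - 1) * q + 1 \<le> card K"
  obtains Y where "Y \<subseteq> K" "card Y = (k - 1) * q + 1" "lpath Y x y"
proof -
  have "1 * 1 \<le> (k - 1) * q" using k3 assms(5) by (intro mult_le_mono) auto
  then have "card {x, y} \<le> (k - 1) * q + 1" using assms(4) by simp
  moreover have "finite K" "{x, y} \<subseteq> K" using assms(1-3) by (auto simp: clq_def)
  ultimately obtain Y where Y: "{x, y} \<subseteq> Y" "Y \<subseteq> K" "card Y = (k - 1) * q + 1"
    using subset_between[of K "{x, y}"] assms(6) by metis
  then show ?thesis
    using that[of Y] clq_lpath[of Y q x y] clq_subset[OF assms(1), of Y] assms(4,5) by auto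
qed

lemma cyc_card:
  assumes "cyc X" shows "(k - 1) dvd card X"
proof -
  obtain Y e x y where Y: "lpath Y x y" "redge e" "Y \<inter> e = {x, y}" "X = Y \<union> e"
    using assms unfolding cyc_def by blast
  obtain q where "1 \<le> q" "card Y = (k - 1) * q + 1" using lpath_card Y(1) by blast
  moreover have "card X + 2 = card Y + k"
    using card_Un_Int[of Y e] Y lpathD[OF Y(1)] redgeD[OF Y(2)] by simp
  ultimately have "card X = (k - 1) * q + (k - 1)" using k3 by linarith
  then show ?thesis by simp
qed

section \<open>Numbering the vertices of paths and cycles\<close>

lemma edge_enum:
  assumes "redge e" "x \<in> e" "y \<in> e" "x \<noteq> y"
  obtains g where "bij_betw g {p..p + (k - 1)} e" "g p = x" "g (p + (k - 1)) = y"
proof -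
  have fe: "finite e" "card e = k" using redgeD assms by auto
  have "card {p<..<p + (k - 1)} = card (e - {x, y})"
    using fe assms by (simp add: card_Diff_subset)
  then obtain h where h: "bij_betw h {p<..<p + (k - 1)} (e - {x, y})"
    using fe finite_same_card_bij[of "{p<..<p + (k - 1)}" "e - {x, y}"] by auto
  define g where "g i = (if i = p then x else if i = p + (k - 1) then y else h i)" for i
  have gh: "g i = h i" if "i \<in> {p<..<p + (k - 1)}" for i using that by (auto simp: g_def)
  have "bij_betw g {p<..<p + (k - 1)} (e - {x, y})"
    using h gh by (rule bij_betw_eqI)
  moreover have "bij_betw g {p} {x}" "bij_betw g {p + (k - 1)} {y}"
    using k3 by (auto simp: g_def bij_betw_def)
  ultimately have "bij_betw g ({p<..<p + (k - 1)} \<union> {p} \<union> {p + (k - 1)}) (e - {x, y} \<union> {x} \<union> {y})"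
    using assms by (intro bij_betw_combine) auto
  moreover have "{p<..<p + (k - 1)} \<union> {p} \<union> {p + (k - 1)} = {p..p + (k - 1)}" using k3 by auto
  moreover have "e - {x, y} \<union> {x} \<union> {y} = e" using assms by auto
  moreover have "g p = x" "g (p + (k - 1)) = y" using k3 by (auto simp: g_def)
  ultimately show ?thesis using that[of g] by metis
qed

lemma lpath_enum:
  "lpath X x y \<Longrightarrow> \<exists>\<phi> q. 1 \<le> q \<and> bij_betw \<phi> {..q * (k - 1)} X \<and> \<phi> 0 = x \<and> \<phi> (q * (k - 1)) = y
     \<and> (\<forall>i<q. redge (\<phi> ` {i * (k - 1)..i * (k - 1) + (k - 1)}))"
proof (induction rule: lpath.induct)
  case (edge e x y)
  obtain g where "bij_betw g {0..0 + (k - 1)} e" "g 0 = x" "g (0 + (k - 1)) = y"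
    using edge_enum[OF edge] by metis
  then show ?case using edge(1)
    by (intro exI[of _ g] exI[of _ 1]) (auto simp: atLeast0AtMost bij_betw_def)
next
  case (step X x y e z)
  then obtain \<phi> q where \<phi>: "1 \<le> q" "bij_betw \<phi> {..q * (k - 1)} X" "\<phi> 0 = x" "\<phi> (q * (k - 1)) = y"
      "\<And>i. i < q \<Longrightarrow> redge (\<phi> ` {i * (k - 1)..i * (k - 1) + (k - 1)})"
    by blast
  define p where "p = q * (k - 1)"
  obtain g where g: "bij_betw g {p..p + (k - 1)} e" "g p = y" "g (p + (k - 1)) = z"
    using edge_enum[of e y z] step by (metis Int_iff insertI1)
  define \<psi> where "\<psi> i = (if i \<le> p then \<phi> i else g i)" for i
  have \<psi>g: "\<psi> i = g i" if "i \<in> {p..p + (k - 1)}" for i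
    using that g \<phi> by (cases "i = p") (auto simp: \<psi>_def p_def)
  have "bij_betw \<psi> {..p} X" using \<phi>(2) unfolding p_def[symmetric] by (rule bij_betw_eqI) (auto simp: \<psi>_def p_def)
  moreover have "bij_betw \<psi> {p<..p + (k - 1)} (e - {y})"
  proof -
    have "bij_betw g ({p..p + (k - 1)} - {p}) (e - {g p})"
      using g(1) by (intro bij_betw_DiffI) (auto simp: bij_betw_def)
    moreover have "{p..p + (k - 1)} - {p} = {p<..p + (k - 1)}" by auto
    ultimately have "bij_betw g {p<..p + (k - 1)} (e - {y})" using g(2) by simp
    then show ?thesis by (rule bij_betw_eqI) (auto simp: \<psi>_def)
  qed
  ultimately have "bij_betw \<psi> ({..p} \<union> {p<..p + (k - 1)}) (X \<union> (e - {y}))"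
    using step by (intro bij_betw_combine) auto
  moreover have "{..p} \<union> {p<..p + (k - 1)} = {..Suc q * (k - 1)}" by (auto simp: p_def)
  moreover have "X \<union> (e - {y}) = X \<union> e" using step by auto
  ultimately have "bij_betw \<psi> {..Suc q * (k - 1)} (X \<union> e)" by simp
  moreover have "\<psi> 0 = x" "\<psi> (Suc q * (k - 1)) = z"
    using \<phi>(3) g(3) k3 by (auto simp: \<psi>_def p_def add.commute)
  moreover have "redge (\<psi> ` {i * (k - 1)..i * (k - 1) + (k - 1)})" if i: "i < Suc q" for i
  proof (cases "i = q")
    case True
    then have "\<psi> ` {i * (k - 1)..i * (k - 1) + (k - 1)} = g ` {p..p + (k - 1)}"
      using \<psi>g by (intro image_cong) (auto simp: p_def)
    then show ?thesis using g(1) step(2) by (simp add: bij_betw_def)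
  next
    case False
    then have "Suc i * (k - 1) \<le> p" unfolding p_def using i by (intro mult_le_mono1) auto
    then have "\<psi> ` {i * (k - 1)..i * (k - 1) + (k - 1)} = \<phi> ` {i * (k - 1)..i * (k - 1) + (k - 1)}"
      by (intro image_cong) (auto simp: \<psi>_def)
    then show ?thesis using \<phi>(5)[of i] i False by simp
  qed
  ultimately show ?case by (intro exI[of _ \<psi>] exI[of _ "Suc q"]) auto
qed

text \<open>Bridge from the set-based \<open>cyc\<close> to \<open>loose_cycle_edges\<close>: the
  path occupies the positions \<open>0\<close> to \<open>p\<close>, the closing edge those from
  \<open>p\<close> to \<open>n\<close>. Only for this last edge does the reduction modulo
  \<open>n\<close> matter.\<close>

lemma cyc_enum:
  assumes "cyc X" "card X = n"
  obtains \<phi> where "bij_betw \<phi> {..<n} X" "\<forall>e\<in>loose_cycle_edges k n. red (\<phi> ` e)"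
proof -
  obtain Y e x y where Y: "lpath Y x y" "redge e" "Y \<inter> e = {x, y}" "X = Y \<union> e"
    using assms unfolding cyc_def by blast
  obtain \<phi> q where \<phi>: "1 \<le> q" "bij_betw \<phi> {..q * (k - 1)} Y" "\<phi> 0 = x" "\<phi> (q * (k - 1)) = y"
      "\<And>i. i < q \<Longrightarrow> redge (\<phi> ` {i * (k - 1)..i * (k - 1) + (k - 1)})"
    using lpath_enum[OF Y(1)] by blast
  define p where "p = q * (k - 1)"
  have xy: "x \<in> e" "y \<in> e" "x \<noteq> y" using Y lpathD[OF Y(1)] by auto
  \<comment> \<open>The closing edge runs from \<open>y\<close> back to \<open>x\<close>: its last
    position is \<open>n\<close>, which is reduced to \<open>0\<close>, the position of
    \<open>x\<close>.\<close>
  obtain g where g: "bij_betw g {p..p + (k - 1)} e" "g p = y" "g (p + (k - 1)) = x"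
    using edge_enum[OF Y(2) xy(2,1)] xy(3) by metis
  define \<psi> where "\<psi> i = (if i \<le> p then \<phi> i else g i)" for i
  have p0: "0 < p" unfolding p_def using \<phi>(1) k3 by auto
  have \<psi>g: "\<psi> i = g i" if "i \<in> {p..p + (k - 1)}" for i
    using that g \<phi> by (cases "i = p") (auto simp: \<psi>_def p_def)
  have b1: "bij_betw \<psi> {..p} Y" using \<phi>(2) unfolding p_def[symmetric] by (rule bij_betw_eqI) (auto simp: \<psi>_def p_def)
  have b2: "bij_betw \<psi> {p<..<p + (k - 1)} (e - {x, y})"
  proof -
    have "bij_betw g {p, p + (k - 1)} {y, x}"
      using g(2,3) xy(3) by (auto simp: bij_betw_def)
    then have "bij_betw g ({p..p + (k - 1)} - {p, p + (k - 1)}) (e - {y, x})"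
      using xy by (intro bij_betw_DiffI[OF g(1)]) auto
    moreover have "{p..p + (k - 1)} - {p, p + (k - 1)} = {p<..<p + (k - 1)}" by auto
    moreover have "e - {y, x} = e - {x, y}" by auto
    ultimately have "bij_betw g {p<..<p + (k - 1)} (e - {x, y})" by simp
    then show ?thesis by (rule bij_betw_eqI) (auto simp: \<psi>_def)
  qed
  have "bij_betw \<psi> ({..p} \<union> {p<..<p + (k - 1)}) (Y \<union> (e - {x, y}))"
    using Y(3) by (intro bij_betw_combine[OF b1 b2]) auto
  moreover have "{..p} \<union> {p<..<p + (k - 1)} = {..<p + (k - 1)}" using k3 by auto
  moreover have "Y \<union> (e - {x, y}) = X" using Y by auto
  ultimately have bij: "bij_betw \<psi> {..<p + (k - 1)} X" by simp
  then have n: "n = p + (k - 1)" using assms(2) bij_betw_same_card by fastforce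
  have nq: "n = Suc q * (k - 1)" using n p_def by simp
  have "n div (k - 1) = Suc q" using k3 unfolding nq by (subst div_mult_self_is_m) auto
  moreover have "red (\<psi> ` {(i * (k - 1) + j) mod n |j. j \<le> k - 1})" if i: "i < Suc q" for i
  proof (cases "i = q")
    case True
    have "{(i * (k - 1) + j) mod n |j. j \<le> k - 1} = insert 0 {p..<n}" (is "?L = ?R")
    proof
      show "?L \<subseteq> ?R"
      proof clarify
        fix j assume j: "j \<le> k - 1" "(i * (k - 1) + j) mod n \<notin> {p..<n}"
        have "(i * (k - 1) + j) mod n = p + j" if "j < k - 1"
          using that True n by (simp add: p_def)
        then have "j = k - 1" using j n by fastforce
        then show "(i * (k - 1) + j) mod n = 0" using True n by (simp add: p_def)
      qed
      have "0 \<in> ?L" using True n p_def by (auto intro!: exI[of _ "k - 1"])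
      moreover have "t \<in> ?L" if "t \<in> {p..<n}" for t
        using that True n p_def by (auto intro!: exI[of _ "t - p"])
      ultimately show "?R \<subseteq> ?L" by auto
    qed
    moreover have "\<psi> 0 = g n" using \<phi>(3) g(3) n p0 by (simp add: \<psi>_def)
    moreover have "\<psi> ` {p..<n} = g ` {p..<n}" using \<psi>g n by (intro image_cong) auto
    ultimately have "\<psi> ` {(i * (k - 1) + j) mod n |j. j \<le> k - 1} = g ` insert n {p..<n}" by simp
    also have "insert n {p..<n} = {p..p + (k - 1)}" using n by auto
    finally show ?thesis using g(1) Y(2) by (simp add: bij_betw_def redge_def)
  next
    case False
    then have le: "Suc i * (k - 1) \<le> p" unfolding p_def using i by (intro mult_le_mono1) auto
    have lt: "i * (k - 1) + j < n" if "j \<le> k - 1" for j using le that n k3 by simp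
    have "{(i * (k - 1) + j) mod n |j. j \<le> k - 1} = {i * (k - 1) + j |j. j \<le> k - 1}"
      using lt by (metis (no_types, lifting) mod_less)
    also have "\<dots> = {i * (k - 1)..i * (k - 1) + (k - 1)}"
      by (auto simp: le_iff_add)
    finally have "\<psi> ` {(i * (k - 1) + j) mod n |j. j \<le> k - 1}
        = \<phi> ` {i * (k - 1)..i * (k - 1) + (k - 1)}"
      using le by (auto simp: \<psi>_def intro!: image_cong)
    then show ?thesis using \<phi>(5)[of i] i False by (simp add: redge_def)
  qed
  ultimately show ?thesis using that[of \<psi>] bij n by (auto simp: loose_cycle_edges_def)
qed

end

section \<open>Colourings and multipartite copies\<close>

text \<open>The injective colouring is proper because \<open>k\<close> is at least 2, so both minima
  are attained. Swapping two colours makes a smallest class the last one, the place reserved for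
  leftover vertices in the multipartite argument.\<close>

lemma sigma_colouring:
  assumes "kgraph k V E" "2 \<le> k" "V \<noteq> {}"
  obtains f where "proper_colouring V E (chromatic_number V E) f" "1 \<le> chromatic_number V E"
    "card {v \<in> V. f v = chromatic_number V E - 1} = sigma V E"
proof -
  define c where "c = chromatic_number V E"
  have fV: "finite V" using assms by (simp add: kgraph_def)
  obtain h where h: "bij_betw h V {..<card V}"
    using ex_bij_betw_finite_nat[OF fV] by (auto simp: atLeast0LessThan)
  have "proper_colouring V E (card V) h"
    unfolding proper_colouring_def
  proof (intro conjI ballI notI)
    show "h v < card V" if "v \<in> V" for v using h that by (auto simp: bij_betw_def)
    fix e assume e: "e \<in> E" "\<exists>i. \<forall>v\<in>e. h v = i"
    then have "e \<subseteq> V" "card e = k" using assms by (auto simp: kgraph_def)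
    then have "card (h ` e) = k" using h by (metis bij_betw_def card_image inj_on_subset)
    moreover obtain i where "h ` e \<subseteq> {i}" using e by auto
    then have "card (h ` e) \<le> 1" using card_mono[of "{i}" "h ` e"] by simp
    ultimately show False using assms by simp
  qed
  then have "\<exists>c f. proper_colouring V E c f" by blast
  then have "\<exists>f. proper_colouring V E c f"
    unfolding c_def chromatic_number_def by (rule LeastI_ex)
  then obtain f0 where f0: "proper_colouring V E c f0" by auto
  have c1: "1 \<le> c" using f0 assms(3) by (cases c) (auto simp: proper_colouring_def)
  have "\<exists>f i. proper_colouring V E c f \<and> i < c \<and> sigma V E = card {v \<in> V. f v = i}"
    unfolding sigma_def c_def[symmetric]
  proof (rule LeastI_ex)
    show "\<exists>s f i. proper_colouring V E c f \<and> i < c \<and> s = card {v \<in> V. f v = i}"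
      using f0 c1 by (intro exI[of _ "card {v \<in> V. f0 v = 0}"] exI[of _ f0] exI[of _ 0]) auto
  qed
  then obtain f i where f: "proper_colouring V E c f" "i < c" "sigma V E = card {v \<in> V. f v = i}"
    by auto
  define \<pi> where "\<pi> = (\<lambda>j. if j = i then c - 1 else if j = c - 1 then i else j)"
  have \<pi>: "\<pi> j = \<pi> l \<longleftrightarrow> j = l" for j l by (auto simp: \<pi>_def)
  have "proper_colouring V E c (\<pi> \<circ> f)"
    unfolding proper_colouring_def
  proof (intro conjI ballI notI)
    show "(\<pi> \<circ> f) v < c" if "v \<in> V" for v
      using f that c1 by (auto simp: \<pi>_def proper_colouring_def)
    fix e assume e: "e \<in> E" "\<exists>j. \<forall>v\<in>e. (\<pi> \<circ> f) v = j"
    then have "e \<noteq> {}" using assms by (auto simp: kgraph_def)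
    then have "\<exists>j. \<forall>v\<in>e. f v = j" using e(2) \<pi> by (metis comp_apply ex_in_conv)
    then show False using f(1) e(1) by (auto simp: proper_colouring_def)
  qed
  moreover have "{v \<in> V. (\<pi> \<circ> f) v = c - 1} = {v \<in> V. f v = i}"
    by (auto simp: \<pi>_def split: if_splits)
  ultimately show ?thesis using that[of "\<pi> \<circ> f"] f c1 unfolding c_def by simp
qed

text \<open>Colour class \<open>i\<close> is embedded into \<open>P i\<close>. An edge of the
  hypergraph is not monochromatic, so its image lies in no single part and is therefore
  blue.\<close>

lemma multipartite_copy:
  assumes "kgraph k V E" "proper_colouring V E c f"
    and P: "\<And>i. i < c \<Longrightarrow> finite (P i) \<and> card {v \<in> V. f v = i} \<le> card (P i) \<and> P i \<subseteq> {..<N}"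
    and disj: "\<And>i j. \<lbrakk>i < c; j < c; i \<noteq> j\<rbrakk> \<Longrightarrow> P i \<inter> P j = {}"
    and blue: "\<And>e. \<lbrakk>e \<subseteq> (\<Union>i<c. P i); card e = k; \<And>i. i < c \<Longrightarrow> \<not> e \<subseteq> P i\<rbrakk> \<Longrightarrow> \<not> col e"
  shows "mono_copy N col False V E"
proof -
  have "\<exists>g. i < c \<longrightarrow> inj_on g {v \<in> V. f v = i} \<and> g ` {v \<in> V. f v = i} \<subseteq> P i" for i
  proof (cases "i < c")
    case True
    have "finite {v \<in> V. f v = i}" using assms(1) by (simp add: kgraph_def)
    then show ?thesis using card_le_inj[of "{v \<in> V. f v = i}" "P i"] P[OF True] by auto
  qed auto
  then have "\<forall>i. \<exists>g. i < c \<longrightarrow> inj_on g {v \<in> V. f v = i} \<and> g ` {v \<in> V. f v = i} \<subseteq> P i" ..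
  from choice[OF this] obtain g where
    "\<forall>i. i < c \<longrightarrow> inj_on (g i) {v \<in> V. f v = i} \<and> g i ` {v \<in> V. f v = i} \<subseteq> P i" ..
  then have g: "\<And>i. i < c \<Longrightarrow> inj_on (g i) {v \<in> V. f v = i}"
      "\<And>i. i < c \<Longrightarrow> g i ` {v \<in> V. f v = i} \<subseteq> P i"
    by auto
  define \<phi> where "\<phi> v = g (f v) v" for v
  have fc: "f v < c" if "v \<in> V" for v using assms(2) that by (auto simp: proper_colouring_def)
  have \<phi>P: "\<phi> v \<in> P (f v)" if "v \<in> V" for v
    using g(2)[OF fc[OF that]] that by (auto simp: \<phi>_def)
  have same: "f v = i" if "v \<in> V" "\<phi> v \<in> P i" "i < c" for v i
    using disj[OF fc[OF that(1)] that(3)] \<phi>P[OF that(1)] that(2) by blast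
  have inj: "inj_on \<phi> V"
  proof (rule inj_onI)
    fix u v assume uv: "u \<in> V" "v \<in> V" "\<phi> u = \<phi> v"
    then have "f u = f v" using same[of u "f v"] \<phi>P fc by auto
    then show "u = v" using g(1)[OF fc[OF uv(1)]] uv by (auto simp: \<phi>_def inj_on_def)
  qed
  have "\<not> col (\<phi> ` e)" if e: "e \<in> E" for e
  proof (rule blue)
    have eV: "e \<subseteq> V" "card e = k" using e assms(1) by (auto simp: kgraph_def)
    show "\<phi> ` e \<subseteq> (\<Union>i<c. P i)" using eV \<phi>P fc by blast
    show "card (\<phi> ` e) = k" using eV inj by (metis card_image inj_on_subset)
    show "\<not> \<phi> ` e \<subseteq> P i" if "i < c" for i
    proof
      assume "\<phi> ` e \<subseteq> P i"
      then have "\<forall>v\<in>e. f v = i" using same that eV by blast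
      then show False using assms(2) e by (auto simp: proper_colouring_def)
    qed
  qed
  then show ?thesis unfolding mono_copy_def using inj \<phi>P fc P by (intro exI[of _ \<phi>]) blast
qed

section \<open>Cycles with marks\<close>

text \<open>A mark \<open>Segment a b K\<close> of a cycle is a segment from \<open>a\<close> to \<open>b\<close> running through a red clique \<open>K\<close>.
  A clump consists of the remaining vertices \<open>W\<close> of the cycle and of its marks, whose segments may be
  rerouted arbitrarily.\<close>

datatype 'v segment = Segment (st: 'v) (en: 'v) (bd: "'v set")

context red_hypergraph
begin

text \<open>A gadget is a red path with both ends in the clique \<open>K\<close>. One after the
  other they are traversed: an edge consisting of \<open>a\<close>, the entry \<open>y\<close> and
  \<open>k - 2\<close> fresh vertices of \<open>K\<close> leads into a gadget, whose exit
  \<open>z\<close> becomes the new start. The final segment inside the rest of \<open>K\<close>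
  absorbs the required length. The lower bound on \<open>q\<close> is the shortest such path (all
  gadgets, with one linking edge before, between and after them); the upper bound is the number of
  vertices available.\<close>

lemma gadget_chain:
  fixes \<Gamma> :: "('v set \<times> 'v \<times> 'v) set"
  assumes "finite \<Gamma>"
  shows "\<lbrakk>clq K; a \<in> K; b \<in> K; a \<noteq> b;
     \<And>G y z. (G, y, z) \<in> \<Gamma> \<Longrightarrow> lpath G y z \<and> y \<in> K \<and> z \<in> K \<and> a \<notin> G \<and> b \<notin> G;
     \<And>g h. \<lbrakk>g \<in> \<Gamma>; h \<in> \<Gamma>; g \<noteq> h\<rbrakk> \<Longrightarrow> fst g \<inter> fst h = {};
     (k - 2) * (card \<Gamma> + 1) + 2 \<le> card (K - \<Union>(fst ` \<Gamma>));
     card (\<Union>(fst ` \<Gamma>)) + 2 + (k - 2) * (card \<Gamma> + 1) \<le> (k - 1) * q + 1;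
     (k - 1) * q + 1 \<le> card (K \<union> \<Union>(fst ` \<Gamma>))\<rbrakk>
    \<Longrightarrow> \<exists>Y. lpath Y a b \<and> Y \<subseteq> K \<union> \<Union>(fst ` \<Gamma>) \<and> card Y = (k - 1) * q + 1"
  using assms
proof (induction \<Gamma> arbitrary: K a q rule: finite_induct)
  case empty
  have "1 \<le> q" using empty.prems(8) k3 by (cases q) auto
  moreover have "(k - 1) * q + 1 \<le> card K" using empty.prems(9) by simp
  ultimately obtain Y where "Y \<subseteq> K" "card Y = (k - 1) * q + 1" "lpath Y a b"
    using clq_lpath_ex[OF empty.prems(1-4)] by blast
  then show ?case by auto
next
  case (insert p \<Gamma>)
  obtain G y z where p: "p = (G, y, z)" by (cases p)
  define U where "U = \<Union>(fst ` \<Gamma>)"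
  have UI: "\<Union>(fst ` insert p \<Gamma>) = G \<union> U" by (simp add: U_def p)
  have G: "lpath G y z" "y \<in> K" "z \<in> K" "a \<notin> G" "b \<notin> G"
    using insert.prems(5)[of G y z] p by auto
  have Gf: "finite G" "y \<in> G" "z \<in> G" "y \<noteq> z" using lpathD[OF G(1)] by auto
  have fK: "finite K" using insert.prems(1) by (simp add: clq_def)
  have fU: "finite U" unfolding U_def using insert.hyps insert.prems(5) lpathD by fastforce
  have GU: "G \<inter> U = {}" using insert.prems(6)[of p] insert.hyps p unfolding U_def by fastforce
  have abU: "a \<notin> U" "b \<notin> U" using insert.prems(5) unfolding U_def by fastforce+
  have cI: "card (insert p \<Gamma>) = card \<Gamma> + 1" using insert.hyps by simp
  obtain g where g: "card G = (k - 1) * g + 1" using lpath_card[OF G(1)] by auto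
  have split: "(k - 2) * (card (insert p \<Gamma>) + 1) = (k - 2) * (card \<Gamma> + 1) + (k - 2)"
    unfolding cI by (simp only: distrib_left mult_1_right)
  have room: "(k - 2) * (card \<Gamma> + 1) + (k - 2) + 2 \<le> card (K - (G \<union> U))"
    using insert.prems(7) unfolding UI split by simp
  have abK: "a \<in> K - (G \<union> U)" "b \<in> K - (G \<union> U)" using abU G insert.prems by auto
  have "card (K - (G \<union> U) - {a, b}) = card (K - (G \<union> U)) - 2"
    using abK insert.prems(4) fK by (subst card_Diff_subset) auto
  then have "k - 2 \<le> card (K - (G \<union> U) - {a, b})" using room by simp
  then obtain I where I: "I \<subseteq> K - (G \<union> U) - {a, b}" "card I = k - 2" "finite I"
    using obtain_subset_with_card_n by metis
  have "a \<notin> I" using I by auto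
  then have caI: "card (insert a I) = k - 1" "a \<notin> I" using I k3 by simp_all
  define e where "e = insert a (insert y I)"
  have ce: "card e = k" using I G Gf k3 unfolding e_def by (subst card_insert_disjoint; auto)+
  have re: "redge e" using I G insert.prems ce unfolding e_def
    by (intro clq_redge[OF insert.prems(1)]) auto
  \<comment> \<open>\<open>G\<close> may contain further vertices of \<open>K\<close>; these are
    spent, and only the exit \<open>z\<close> is kept as the new start.\<close>
  define K' where "K' = insert z (K - (insert a I \<union> G))"
  have cGU: "card (G \<union> U) = card G + card U" using GU Gf fU by (simp add: card_Un_disjoint)
  have low: "card G + card U + 2 + (k - 2) * (card \<Gamma> + 1) + (k - 2) \<le> (k - 1) * q + 1"
    using insert.prems(8) unfolding UI split cGU by simp
  have "(k - 1) * g < (k - 1) * q" using low g by linarith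
  then have "g < q" by simp
  \<comment> \<open>One linking edge and the \<open>g\<close> edges of \<open>G\<close> have been
    used.\<close>
  define q' where "q' = q - 1 - g"
  then have q': "q = q' + 1 + g" using \<open>g < q\<close> by simp
  have qq: "(k - 1) * q + 1 = (k - 1) * q' + 1 + (k - 1) + ((k - 1) * g + 1) - 1"
  proof -
    have "(k - 1) * q = (k - 1) * q' + (k - 1) + (k - 1) * g"
      unfolding q' by (simp only: distrib_left mult_1_right)
    then show ?thesis by linarith
  qed
  have "\<exists>Y. lpath Y z b \<and> Y \<subseteq> K' \<union> \<Union>(fst ` \<Gamma>) \<and> card Y = (k - 1) * q' + 1"
  proof (rule insert.IH)
    show "clq K'" using insert.prems(1) G by (rule_tac clq_subset) (auto simp: K'_def)
    show "z \<in> K'" "b \<in> K'" "z \<noteq> b" using insert.prems G Gf I by (auto simp: K'_def)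
    show "lpath G' y' z' \<and> y' \<in> K' \<and> z' \<in> K' \<and> z \<notin> G' \<and> b \<notin> G'" if g': "(G', y', z') \<in> \<Gamma>" for G' y' z'
    proof -
      have *: "lpath G' y' z'" "y' \<in> K" "z' \<in> K" "a \<notin> G'" "b \<notin> G'"
        using insert.prems(5)[of G' y' z'] g' by auto
      have "G' \<subseteq> U" using g' unfolding U_def by force
      then show ?thesis using * lpathD[OF *(1)] GU I Gf unfolding K'_def by blast
    qed
    show "fst g \<inter> fst h = {}" if "g \<in> \<Gamma>" "h \<in> \<Gamma>" "g \<noteq> h" for g h
      using insert.prems(6) that by blast
    have "K' - U = insert z (K - (G \<union> U) - insert a I)" using Gf GU by (auto simp: K'_def)
    moreover have "z \<notin> K - (G \<union> U) - insert a I" using Gf by auto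
    ultimately have "card (K' - U) = Suc (card (K - (G \<union> U) - insert a I))" using fK by simp
    moreover have "card (K - (G \<union> U) - insert a I) = card (K - (G \<union> U)) - (k - 1)"
      using I abK caI by (subst card_Diff_subset) auto
    ultimately show "(k - 2) * (card \<Gamma> + 1) + 2 \<le> card (K' - \<Union>(fst ` \<Gamma>))"
      using room k3 unfolding U_def[symmetric] by linarith
    show "card (\<Union>(fst ` \<Gamma>)) + 2 + (k - 2) * (card \<Gamma> + 1) \<le> (k - 1) * q' + 1"
      using low qq g k3 unfolding U_def[symmetric] by linarith
    have "K' \<union> U = (K \<union> (G \<union> U)) - (insert a I \<union> (G - {z}))"
      using abU GU I G Gf unfolding K'_def by blast
    moreover have "card (insert a I \<union> (G - {z})) = (k - 1) + (card G - 1)"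
      using I G Gf abK caI by (subst card_Un_disjoint) auto
    moreover have "insert a I \<union> (G - {z}) \<subseteq> K \<union> (G \<union> U)" using I abK by auto
    ultimately have "card (K' \<union> U) = card (K \<union> (G \<union> U)) - ((k - 1) + (card G - 1))"
      using I Gf by (subst \<open>K' \<union> U = _\<close>, subst card_Diff_subset) auto
    then show "(k - 1) * q' + 1 \<le> card (K' \<union> \<Union>(fst ` \<Gamma>))"
      using insert.prems(9) qq g unfolding U_def[symmetric] UI by linarith
  qed
  then obtain Y where Y: "lpath Y z b" "Y \<subseteq> K' \<union> U" "card Y = (k - 1) * q' + 1"
    unfolding U_def by blast
  have zY: "z \<in> Y" "finite Y" using lpathD[OF Y(1)] by auto
  have eG: "e \<inter> G = {y}" using I G Gf unfolding e_def by auto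
  have "K' \<inter> (e \<union> G) = {z}" using Gf I G unfolding K'_def e_def by blast
  moreover have "U \<inter> (e \<union> G) = {}" using GU I abU Gf unfolding e_def by blast
  ultimately have YeG: "(e \<union> G) \<inter> Y = {z}" using Y(2) zY by blast
  have "lpath e a y" using re G Gf unfolding e_def by (intro lpath.edge) auto
  then have 1: "lpath (e \<union> G) a z" using G(1) eG by (intro lpath_append)
  have "lpath (e \<union> G \<union> Y) a b" using lpath_append[OF Y(1) 1 YeG] .
  moreover have "e \<union> G \<union> Y \<subseteq> K \<union> (G \<union> U)"
    using Y(2) I G insert.prems(2) unfolding e_def K'_def by blast
  moreover have "card (e \<union> G \<union> Y) = (k - 1) * q + 1"
  proof -
    have "card (e \<union> G) + 1 = card e + card G"
      using card_Un_Int[of e G] eG Gf redgeD[OF re] by simp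
    moreover have "card (e \<union> G \<union> Y) + 1 = card (e \<union> G) + card Y"
      using card_Un_Int[of "e \<union> G" Y] YeG Gf zY redgeD[OF re] by simp
    ultimately show ?thesis using qq ce g Y(3) k3 by linarith
  qed
  ultimately show ?case unfolding UI by blast
qed

section \<open>Marks, clumps and their rerouting\<close>

definition mark :: "nat \<Rightarrow> 'v segment \<Rightarrow> bool" where
  "mark w m \<longleftrightarrow> clq (bd m) \<and> card (bd m) = w \<and> st m \<in> bd m \<and> en m \<in> bd m \<and> st m \<noteq> en m"

definition inner :: "'v segment \<Rightarrow> 'v set" where
  "inner m = bd m - {st m, en m}"

text \<open>The paths \<open>Y m\<close> are arbitrary disjoint red paths between the ends and may
  leave \<open>bd m\<close>. This closes clumps under fixing a segment and under moving a mark
  elsewhere, without any reference to the edges outside the marks.\<close>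

definition clump :: "nat \<Rightarrow> 'v set \<Rightarrow> 'v segment set \<Rightarrow> bool" where
  "clump w W A \<longleftrightarrow> finite W \<and> finite A \<and> (\<forall>m\<in>A. mark w m \<and> bd m \<inter> W = {})
     \<and> (\<forall>m\<in>A. \<forall>m'\<in>A. m \<noteq> m' \<longrightarrow> bd m \<inter> bd m' = {})
     \<and> (\<forall>Y. (\<forall>m\<in>A. lpath (Y m) (st m) (en m) \<and> Y m \<inter> W = {})
          \<and> (\<forall>m\<in>A. \<forall>m'\<in>A. m \<noteq> m' \<longrightarrow> Y m \<inter> Y m' = {}) \<longrightarrow> cyc (W \<union> (\<Union>m\<in>A. Y m)))"

lemma clumpD:
  assumes "clump w W A"
  shows "finite W" "finite A" "\<And>m. m \<in> A \<Longrightarrow> mark w m" "\<And>m. m \<in> A \<Longrightarrow> bd m \<inter> W = {}"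
    "\<And>m m'. \<lbrakk>m \<in> A; m' \<in> A; m \<noteq> m'\<rbrakk> \<Longrightarrow> bd m \<inter> bd m' = {}"
  using assms unfolding clump_def by blast+

lemma clump_cyc_via:
  assumes "clump w W A" "\<And>m. m \<in> A \<Longrightarrow> lpath (Y m) (st m) (en m)" "\<And>m. m \<in> A \<Longrightarrow> Y m \<inter> W = {}"
    "\<And>m m'. \<lbrakk>m \<in> A; m' \<in> A; m \<noteq> m'\<rbrakk> \<Longrightarrow> Y m \<inter> Y m' = {}"
  shows "cyc (W \<union> (\<Union>m\<in>A. Y m))"
proof -
  have "(\<forall>m\<in>A. lpath (Y m) (st m) (en m) \<and> Y m \<inter> W = {})
      \<and> (\<forall>m\<in>A. \<forall>m'\<in>A. m \<noteq> m' \<longrightarrow> Y m \<inter> Y m' = {})"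
    using assms(2-4) by auto
  then show ?thesis using assms(1) by (simp only: clump_def)
qed

lemma clumpI:
  assumes "finite W" "finite A" "\<And>m. m \<in> A \<Longrightarrow> mark w m" "\<And>m. m \<in> A \<Longrightarrow> bd m \<inter> W = {}"
    "\<And>m m'. \<lbrakk>m \<in> A; m' \<in> A; m \<noteq> m'\<rbrakk> \<Longrightarrow> bd m \<inter> bd m' = {}"
    "\<And>Y. \<lbrakk>\<And>m. m \<in> A \<Longrightarrow> lpath (Y m) (st m) (en m); \<And>m. m \<in> A \<Longrightarrow> Y m \<inter> W = {};
       \<And>m m'. \<lbrakk>m \<in> A; m' \<in> A; m \<noteq> m'\<rbrakk> \<Longrightarrow> Y m \<inter> Y m' = {}\<rbrakk> \<Longrightarrow> cyc (W \<union> (\<Union>m\<in>A. Y m))"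
  shows "clump w W A"
  unfolding clump_def
proof (intro conjI allI impI)
  show "cyc (W \<union> (\<Union>m\<in>A. Y m))"
    if "(\<forall>m\<in>A. lpath (Y m) (st m) (en m) \<and> Y m \<inter> W = {})
      \<and> (\<forall>m\<in>A. \<forall>m'\<in>A. m \<noteq> m' \<longrightarrow> Y m \<inter> Y m' = {})" for Y
    using that by (intro assms(6)) auto
qed (use assms(1-5) in auto)

definition total :: "'v set \<Rightarrow> 'v segment set \<Rightarrow> 'v set" where
  "total W A = W \<union> (\<Union>m\<in>A. bd m)"

lemma card_total:
  assumes "clump w W A"
  shows "card (total W A) = card W + card A * w"
proof -
  have "card (\<Union>m\<in>A. bd m) = (\<Sum>m\<in>A. card (bd m))"
    using clumpD[OF assms] by (intro card_UN_disjoint) (auto simp: mark_def clq_def)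
  also have "\<dots> = card A * w" using clumpD(3)[OF assms] by (simp add: mark_def)
  finally show ?thesis
    unfolding total_def using clumpD[OF assms] by (subst card_Un_disjoint) (auto simp: mark_def clq_def)
qed

lemma finite_total: "clump w W A \<Longrightarrow> finite (total W A)"
  using clumpD[of w W A] by (auto simp: total_def mark_def clq_def)

lemma mark_lpath: "mark w m \<Longrightarrow> w = (k - 1) * q + 1 \<Longrightarrow> 1 \<le> q \<Longrightarrow> lpath (bd m) (st m) (en m)"
  using clq_lpath[of "bd m" q "st m" "en m"] by (auto simp: mark_def)

lemma clump_cyc:
  assumes "clump w W A" "w = (k - 1) * q + 1" "1 \<le> q"
  shows "cyc (total W A)"
  unfolding total_def
proof (rule clump_cyc_via[OF assms(1)])
  show "lpath (bd m) (st m) (en m)" if "m \<in> A" for m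
    using mark_lpath[OF clumpD(3)[OF assms(1) that] assms(2,3)] .
qed (use clumpD[OF assms(1)] in auto)

lemma clump_fix:
  assumes "clump w W A" "m \<in> A" "lpath Y (st m) (en m)" "Y \<inter> W = {}"
    and disj: "\<And>m'. m' \<in> A \<Longrightarrow> m' \<noteq> m \<Longrightarrow> Y \<inter> bd m' = {}"
  shows "clump w (W \<union> Y) (A - {m})"
proof (rule clumpI)
  note D = clumpD[OF assms(1)]
  show "finite (W \<union> Y)" "finite (A - {m})" using D lpathD[OF assms(3)] by auto
  show "mark w n" if "n \<in> A - {m}" for n using that D by auto
  show "bd n \<inter> (W \<union> Y) = {}" if "n \<in> A - {m}" for n using that D(4)[of n] disj[of n] by auto
  show "bd n \<inter> bd n' = {}" if "n \<in> A - {m}" "n' \<in> A - {m}" "n \<noteq> n'" for n n'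
    using that D(5)[of n n'] by auto
  fix Z assume Z: "\<And>n. n \<in> A - {m} \<Longrightarrow> lpath (Z n) (st n) (en n)"
    "\<And>n. n \<in> A - {m} \<Longrightarrow> Z n \<inter> (W \<union> Y) = {}"
    "\<And>n n'. n \<in> A - {m} \<Longrightarrow> n' \<in> A - {m} \<Longrightarrow> n \<noteq> n' \<Longrightarrow> Z n \<inter> Z n' = {}"
  have "cyc (W \<union> (\<Union>n\<in>A. (Z(m := Y)) n))"
  proof (rule clump_cyc_via[OF assms(1)])
    show "lpath ((Z(m := Y)) n) (st n) (en n)" "(Z(m := Y)) n \<inter> W = {}" if "n \<in> A" for n
      using Z(1,2)[of n] that assms(3,4) by (cases "n = m"; auto)+
    show "(Z(m := Y)) n \<inter> (Z(m := Y)) n' = {}" if "n \<in> A" "n' \<in> A" "n \<noteq> n'" for n n'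
      using Z(2)[of n] Z(2)[of n'] Z(3)[of n n'] that by auto
  qed
  moreover have "(\<Union>n\<in>A. (Z(m := Y)) n) = Y \<union> (\<Union>n\<in>A - {m}. Z n)" using assms(2) by auto
  ultimately show "cyc (W \<union> Y \<union> (\<Union>n\<in>A - {m}. Z n))" by (simp add: Un_assoc)
qed

text \<open>\<open>C\<close> extends every path between the ends of \<open>m'\<close> to one between
  the ends of \<open>m\<close>, so a rerouting of \<open>m'\<close> induces one of \<open>m\<close>.
  Vertices of \<open>bd m\<close> outside \<open>C\<close> and \<open>bd m'\<close> leave the
  cycle.\<close>

lemma clump_swap:
  assumes "clump w W A" "m \<in> A" "m' \<notin> A" "mark w m'" "finite C"
    and C: "\<And>Y. lpath Y (st m') (en m') \<Longrightarrow> Y \<inter> C = {} \<Longrightarrow> lpath (C \<union> Y) (st m) (en m)"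
    and disj: "C \<inter> W = {}" "bd m' \<inter> (W \<union> C) = {}"
      "\<And>n. n \<in> A \<Longrightarrow> n \<noteq> m \<Longrightarrow> (C \<union> bd m') \<inter> bd n = {}"
  shows "clump w (W \<union> C) (insert m' (A - {m}))"
proof (rule clumpI)
  note D = clumpD[OF assms(1)]
  show "finite (W \<union> C)" "finite (insert m' (A - {m}))" using D assms(5) by auto
  show "mark w n" if "n \<in> insert m' (A - {m})" for n using that D(3) assms(4) by auto
  show "bd n \<inter> (W \<union> C) = {}" if "n \<in> insert m' (A - {m})" for n
    using that D(4)[of n] disj(2) disj(3)[of n] by auto
  show "bd n \<inter> bd n' = {}" if "n \<in> insert m' (A - {m})" "n' \<in> insert m' (A - {m})" "n \<noteq> n'" for n n'
    using that D(5)[of n n'] disj(3)[of n] disj(3)[of n'] by auto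
  fix Z assume Z: "\<And>n. n \<in> insert m' (A - {m}) \<Longrightarrow> lpath (Z n) (st n) (en n)"
    "\<And>n. n \<in> insert m' (A - {m}) \<Longrightarrow> Z n \<inter> (W \<union> C) = {}"
    "\<And>n n'. n \<in> insert m' (A - {m}) \<Longrightarrow> n' \<in> insert m' (A - {m}) \<Longrightarrow> n \<noteq> n' \<Longrightarrow> Z n \<inter> Z n' = {}"
  define X where "X = Z(m := C \<union> Z m')"
  have Zm': "lpath (Z m') (st m') (en m')" "Z m' \<inter> (W \<union> C) = {}"
    using Z(1)[of m'] Z(2)[of m'] by auto
  have ZC: "Z l \<inter> (C \<union> Z m') = {}" if "l \<in> A" "l \<noteq> m" for l
  proof -
    have "l \<noteq> m'" using that assms(3) by auto
    then show ?thesis using Z(2)[of l] Z(3)[of l m'] that by auto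
  qed
  have "lpath (C \<union> Z m') (st m) (en m)" using Zm' by (intro C) auto
  moreover have "(C \<union> Z m') \<inter> W = {}" using Zm' disj(1) by auto
  ultimately have "cyc (W \<union> (\<Union>n\<in>A. X n))"
  proof (intro clump_cyc_via[OF assms(1)])
    fix n assume n: "n \<in> A" and *: "lpath (C \<union> Z m') (st m) (en m)" "(C \<union> Z m') \<inter> W = {}"
    show "lpath (X n) (st n) (en n)" using n * Z(1)[of n] by (cases "n = m") (auto simp: X_def)
    show "X n \<inter> W = {}" using n * Z(2)[of n] by (cases "n = m") (auto simp: X_def)
    fix n' assume n': "n' \<in> A" "n \<noteq> n'"
    consider "n = m" "n' \<noteq> m" | "n \<noteq> m" "n' = m" | "n \<noteq> m" "n' \<noteq> m" using n'(2) by blast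
    then show "X n \<inter> X n' = {}"
    proof cases
      case 1 then show ?thesis using ZC[of n'] n' by (auto simp: X_def)
    next
      case 2 then show ?thesis using ZC[of n] n by (auto simp: X_def)
    next
      case 3 then show ?thesis using Z(3)[of n n'] n n' by (auto simp: X_def)
    qed
  qed
  moreover have "(\<Union>n\<in>A. X n) = C \<union> Z m' \<union> (\<Union>n\<in>A - {m}. Z n)"
    using assms(2) unfolding X_def by auto
  ultimately show "cyc (W \<union> C \<union> (\<Union>n\<in>insert m' (A - {m}). Z n))" by (simp add: Un_ac)
qed

text \<open>\<open>Y\<close> may mix vertices of the clique of \<open>\<mu>\<close> with vertices
  outside the clump. Clique vertices that it omits are released, hence the \<open>w\<close> in the
  count.\<close>

lemma clump_reroute:
  assumes cl: "clump w W A" and \<mu>: "\<mu> \<in> A"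
    and Y: "lpath Y (st \<mu>) (en \<mu>)" "Y \<inter> total W A \<subseteq> bd \<mu>"
  shows "clump w (W \<union> Y) (A - {\<mu>})" (is ?clump)
    and "total (W \<union> Y) (A - {\<mu>}) = (total W A - bd \<mu>) \<union> Y" (is ?total)
    and "card (total (W \<union> Y) (A - {\<mu>})) + w = card (total W A) + card Y" (is ?card)
proof -
  note D = clumpD[OF cl]
  have 1: "Y \<inter> W = {}" using Y(2) D(4)[OF \<mu>] unfolding total_def by blast
  have 2: "Y \<inter> bd \<nu> = {}" if "\<nu> \<in> A" "\<nu> \<noteq> \<mu>" for \<nu>
  proof -
    have "Y \<inter> bd \<nu> \<subseteq> bd \<mu>" using Y(2) that unfolding total_def by blast
    then show ?thesis using D(5)[OF that(1) \<mu> that(2)] by blast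
  qed
  show cl': ?clump using clump_fix[OF cl \<mu> Y(1) 1 2] .
  have "(\<Union>\<nu>\<in>A. bd \<nu>) - bd \<mu> = (\<Union>\<nu>\<in>A - {\<mu>}. bd \<nu>)"
  proof
    show "(\<Union>\<nu>\<in>A. bd \<nu>) - bd \<mu> \<subseteq> (\<Union>\<nu>\<in>A - {\<mu>}. bd \<nu>)" by auto
    show "(\<Union>\<nu>\<in>A - {\<mu>}. bd \<nu>) \<subseteq> (\<Union>\<nu>\<in>A. bd \<nu>) - bd \<mu>" using D(5)[OF _ \<mu>] by blast
  qed
  then show ?total unfolding total_def using D(4)[OF \<mu>] by blast
  have "card (W \<union> Y) = card W + card Y"
    using 1 D(1) lpathD[OF Y(1)] by (subst card_Un_disjoint) auto
  moreover have "card A = Suc (card (A - {\<mu>}))" by (rule card_Suc_Diff1[OF D(2) \<mu>, symmetric])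
  ultimately show ?card using card_total[OF cl'] card_total[OF cl] by simp
qed

text \<open>Inside \<open>K\<close>, an edge \<open>e1\<close> links \<open>a\<close> to
  \<open>e\<close> and an edge \<open>f1\<close> links \<open>f\<close> to \<open>b\<close>. This
  gives a path from \<open>a\<close> to \<open>v\<close> and a path from \<open>v'\<close> to
  \<open>b\<close>, each of two edges and \<open>2 * k - 1\<close> vertices; \<open>C\<close> is
  their union without the gates \<open>v\<close> and \<open>v'\<close>. As \<open>e\<close> and
  \<open>f\<close> may contain more vertices of \<open>K\<close>, the fresh vertices of
  \<open>e1\<close> and \<open>f1\<close> are taken outside \<open>e \<union> f\<close>, for which
  \<open>4 * k\<close> vertices suffice.\<close>

lemma connector:
  assumes K: "clq K" "a \<in> K" "b \<in> K" "a \<noteq> b" "4 * k \<le> card K"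
    and ef: "redge e" "redge f" "e \<inter> f = {}" "a \<notin> e \<union> f" "b \<notin> e \<union> f"
    and u: "u \<in> e" "u \<in> K" "v \<in> e" "v \<notin> K" "u' \<in> f" "u' \<in> K" "v' \<in> f" "v' \<notin> K"
  obtains C where "C \<subseteq> K \<union> e \<union> f - {v, v'}" "e \<union> f \<subseteq> C \<union> {v, v'}" "card C = 4 * (k - 1)" "finite C"
    "\<And>Y. \<lbrakk>lpath Y v v'; Y \<inter> C = {}\<rbrakk> \<Longrightarrow> lpath (C \<union> Y) a b"
proof -
  have fin: "finite K" "finite e" "finite f" using K(1) ef redgeD by (auto simp: clq_def)
  have cef: "card e = k" "card f = k" using ef redgeD by auto
  have vv: "v \<noteq> v'" using u ef by auto
  have "card ((e - {v}) \<union> (f - {v'})) \<le> card (e - {v}) + card (f - {v'})" by (rule card_Un_le)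
  also have "\<dots> = 2 * (k - 1)" using u cef fin by simp
  finally have "card ((e - {v}) \<union> (f - {v'}) \<union> {a, b}) \<le> 2 * (k - 1) + 2"
    using card_Un_le[of "(e - {v}) \<union> (f - {v'})" "{a, b}"] K(4) by simp
  moreover have "card K - card ((e - {v}) \<union> (f - {v'}) \<union> {a, b}) \<le> card (K - ((e - {v}) \<union> (f - {v'}) \<union> {a, b}))"
    using fin by (intro diff_card_le_card_Diff) auto
  moreover have "K - ((e - {v}) \<union> (f - {v'}) \<union> {a, b}) = K - (e \<union> f) - {a, b}" using u by auto
  ultimately have room: "2 * (k - 2) \<le> card (K - (e \<union> f) - {a, b})" using K(5) k3 by simp
  then have "k - 2 \<le> card (K - (e \<union> f) - {a, b})" by simp
  then obtain I where I: "I \<subseteq> K - (e \<union> f) - {a, b}" "card I = k - 2" "finite I"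
    using obtain_subset_with_card_n by metis
  have "k - 2 \<le> card (K - (e \<union> f) - {a, b} - I)"
    using I room by (subst card_Diff_subset) auto
  then obtain J where J: "J \<subseteq> K - (e \<union> f) - {a, b} - I" "card J = k - 2" "finite J"
    using obtain_subset_with_card_n by metis
  define e1 where "e1 = insert a (insert u I)"
  define f1 where "f1 = insert u' (insert b J)"
  have "u \<noteq> a" "u' \<noteq> b" "u \<notin> I" "u' \<notin> J" "a \<notin> I" "b \<notin> J" using u ef I J by auto
  then have c1: "card e1 = k" "card f1 = k" using I J k3 by (auto simp: e1_def f1_def)
  have "e1 \<subseteq> K" "f1 \<subseteq> K" using K I J u by (auto simp: e1_def f1_def)
  then have r1: "redge e1" "redge f1" using c1 clq_redge[OF K(1)] by auto
  have "u \<noteq> v" "u' \<noteq> v'" using u by auto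
  then have l: "lpath e1 a u" "lpath e u v" "lpath f v' u'" "lpath f1 u' b"
    using r1 ef u \<open>u \<noteq> a\<close> \<open>u' \<noteq> b\<close> by (auto simp: e1_def f1_def intro!: lpath.edge)
  have i1: "e1 \<inter> e = {u}" "f \<inter> f1 = {u'}" "(e1 \<union> e) \<inter> (f \<union> f1) = {}"
    using I J ef u K(4) by (auto simp: e1_def f1_def)
  have L: "lpath (e1 \<union> e) a v" "lpath (f \<union> f1) v' b"
    using lpath_append[OF l(2) l(1) i1(1)] lpath_append[OF l(4) l(3) i1(2)] .
  define C where "C = (e1 \<union> e \<union> (f \<union> f1)) - {v, v'}"
  have c2: "card (e1 \<union> e) = 2 * k - 1" "card (f \<union> f1) = 2 * k - 1"
    using card_Un_Int[of e1 e] card_Un_Int[of f f1] i1 c1 cef fin I J by (auto simp: e1_def f1_def)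
  show ?thesis
  proof (rule that[of C])
    show "C \<subseteq> K \<union> e \<union> f - {v, v'}" using \<open>e1 \<subseteq> K\<close> \<open>f1 \<subseteq> K\<close> by (auto simp: C_def)
    show "e \<union> f \<subseteq> C \<union> {v, v'}" by (auto simp: C_def)
    show "finite C" using fin I J by (auto simp: C_def e1_def f1_def)
    have "card (e1 \<union> e \<union> (f \<union> f1)) = 2 * (2 * k - 1)"
      using c2 i1(3) lpathD[OF L(1)] lpathD[OF L(2)] by (subst card_Un_disjoint) auto
    moreover have "card C = card (e1 \<union> e \<union> (f \<union> f1)) - card {v, v'}"
      unfolding C_def using u by (intro card_Diff_subset) auto
    ultimately show "card C = 4 * (k - 1)" using vv by simp
    fix Y assume Y: "lpath Y v v'" "Y \<inter> C = {}"
    have YD: "v \<in> Y" "v' \<in> Y" using lpathD[OF Y(1)] by auto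
    have 1: "(e1 \<union> e) \<inter> Y = {v}" using Y(2) YD i1(3) u(3,7) unfolding C_def by blast
    have 2: "lpath (e1 \<union> e \<union> Y) a v'" using lpath_append[OF Y(1) L(1) 1] .
    have 3: "(e1 \<union> e \<union> Y) \<inter> (f \<union> f1) = {v'}" using Y(2) YD i1(3) u(3,7) unfolding C_def by blast
    have "lpath (e1 \<union> e \<union> Y \<union> (f \<union> f1)) a b" using lpath_append[OF L(2) 2 3] .
    moreover have "e1 \<union> e \<union> Y \<union> (f \<union> f1) = C \<union> Y" using YD unfolding C_def by auto
    ultimately show "lpath (C \<union> Y) a b" by simp
  qed
qed

text \<open>Blocks of \<open>w\<close> vertices of the clique become marks, joined by edges with
  \<open>k - 2\<close> private vertices, so \<open>w + k\<close> vertices per mark suffice. The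
  rerouting property is spelled out because \<open>clump\<close> speaks of closed cycles, whereas
  here the ends \<open>x\<close> and \<open>y\<close> stay open for the closing edge.\<close>

lemma initial_path:
  assumes "2 \<le> w"
  shows "\<lbrakk>clq K; Suc s * (w + k) \<le> card K\<rbrakk> \<Longrightarrow>
    \<exists>W A x y. finite W \<and> finite A \<and> total W A \<subseteq> K \<and> card A = Suc s \<and> x \<in> K \<and> y \<in> K
      \<and> (\<forall>m\<in>A. mark w m \<and> bd m \<inter> W = {}) \<and> (\<forall>m\<in>A. \<forall>m'\<in>A. m \<noteq> m' \<longrightarrow> bd m \<inter> bd m' = {})
      \<and> (\<forall>Y. (\<forall>m\<in>A. lpath (Y m) (st m) (en m) \<and> Y m \<inter> W = {}) \<longrightarrow>
            (\<forall>m\<in>A. \<forall>m'\<in>A. m \<noteq> m' \<longrightarrow> Y m \<inter> Y m' = {}) \<longrightarrow> lpath (W \<union> (\<Union>m\<in>A. Y m)) x y)"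
proof (induction s arbitrary: K)
  case 0
  obtain L where L: "L \<subseteq> K" "card L = w" "finite L"
    using obtain_subset_with_card_n[of w K] 0 by auto
  then obtain a b where ab: "a \<in> L" "b \<in> L" "a \<noteq> b"
    using assms by (metis One_nat_def Suc_1 card_le_Suc0_iff_eq not_less_eq_eq)
  have m: "mark w (Segment a b L)" using L ab clq_subset[OF 0(1)] by (simp add: mark_def)
  show ?case
    by (rule exI[of _ "{}"], rule exI[of _ "{Segment a b L}"], rule exI[of _ a], rule exI[of _ b])
      (use m L ab in \<open>auto simp: total_def\<close>)
next
  case (Suc s)
  have fK: "finite K" using Suc.prems by (simp add: clq_def)
  have "Suc s * (w + k) \<le> card K" using Suc.prems by simp
  then obtain K1 where K1: "K1 \<subseteq> K" "card K1 = Suc s * (w + k)" "finite K1"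
    using obtain_subset_with_card_n by metis
  have "clq K1" "Suc s * (w + k) \<le> card K1" using clq_subset[OF Suc.prems(1) K1(1)] K1 by auto
  from Suc.IH[OF this] obtain W A x y where IH:
    "finite W" "finite A" "total W A \<subseteq> K1" "card A = Suc s" "x \<in> K1" "y \<in> K1"
    "\<And>m. m \<in> A \<Longrightarrow> mark w m" "\<And>m. m \<in> A \<Longrightarrow> bd m \<inter> W = {}"
    "\<And>m m'. \<lbrakk>m \<in> A; m' \<in> A; m \<noteq> m'\<rbrakk> \<Longrightarrow> bd m \<inter> bd m' = {}"
    and path: "\<And>Y. \<lbrakk>\<forall>m\<in>A. lpath (Y m) (st m) (en m) \<and> Y m \<inter> W = {};
        \<forall>m\<in>A. \<forall>m'\<in>A. m \<noteq> m' \<longrightarrow> Y m \<inter> Y m' = {}\<rbrakk> \<Longrightarrow> lpath (W \<union> (\<Union>m\<in>A. Y m)) x y"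
    by auto
  have "card (K - K1) = card K - card K1" using K1 by (simp add: card_Diff_subset)
  then have K2: "w + k \<le> card (K - K1)" using K1 Suc.prems by simp
  then have "w \<le> card (K - K1)" by simp
  then obtain L where L: "L \<subseteq> K - K1" "card L = w" "finite L"
    using obtain_subset_with_card_n by metis
  have "k - 2 \<le> card (K - K1 - L)" using K2 L by (simp add: card_Diff_subset)
  then obtain I where I: "I \<subseteq> K - K1 - L" "card I = k - 2" "finite I"
    using obtain_subset_with_card_n by metis
  obtain a b where ab: "a \<in> L" "b \<in> L" "a \<noteq> b"
    using assms L by (metis One_nat_def Suc_1 card_le_Suc0_iff_eq not_less_eq_eq)
  define \<mu> where "\<mu> = Segment a b L"
  have m: "mark w \<mu>" using L ab clq_subset[OF Suc.prems(1), of L] by (auto simp: mark_def \<mu>_def)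
  define e where "e = insert y (insert a I)"
  have "a \<notin> I" "y \<noteq> a" "y \<notin> I" using I L ab IH K1 by auto
  then have "card e = k" using I k3 by (simp add: e_def)
  moreover have "e \<subseteq> K" using I L ab IH K1 by (auto simp: e_def)
  ultimately have re: "redge e" using clq_redge Suc.prems by blast
  have bdK: "bd n \<subseteq> K1" if "n \<in> A" for n using that IH(3) by (auto simp: total_def)
  have bd\<mu>: "bd \<mu> = L" "st \<mu> = a" "en \<mu> = b" by (simp_all add: \<mu>_def)
  have \<mu>A: "\<mu> \<notin> A" using bdK[of \<mu>] L ab bd\<mu> by auto
  have WK: "W \<subseteq> K1" using IH(3) by (auto simp: total_def)
  show ?case
  proof (rule exI[of _ "W \<union> I"], rule exI[of _ "insert \<mu> A"], rule exI[of _ x], rule exI[of _ b],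
      intro conjI allI impI ballI)
    show "finite (W \<union> I)" "finite (insert \<mu> A)" "card (insert \<mu> A) = Suc (Suc s)" "x \<in> K" "b \<in> K"
      using IH I \<mu>A K1 L ab by auto
    show "total (W \<union> I) (insert \<mu> A) \<subseteq> K" using IH(3) I K1 L by (auto simp: total_def bd\<mu>)
    show "mark w n" if "n \<in> insert \<mu> A" for n using that m IH by auto
    show "bd n \<inter> (W \<union> I) = {}" if "n \<in> insert \<mu> A" for n
      using that IH(8)[of n] bdK[of n] WK L I bd\<mu> by (cases "n = \<mu>") blast+
    show "bd n \<inter> bd n' = {}" if "n \<in> insert \<mu> A" "n' \<in> insert \<mu> A" "n \<noteq> n'" for n n'
      using that IH(9)[of n n'] bdK[of n] bdK[of n'] L bd\<mu> by auto
    fix Y assume Y: "\<forall>m\<in>insert \<mu> A. lpath (Y m) (st m) (en m) \<and> Y m \<inter> (W \<union> I) = {}"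
      "\<forall>m\<in>insert \<mu> A. \<forall>m'\<in>insert \<mu> A. m \<noteq> m' \<longrightarrow> Y m \<inter> Y m' = {}"
    define X where "X = W \<union> (\<Union>m\<in>A. Y m)"
    have lX: "lpath X x y" unfolding X_def using Y by (intro path) auto
    have lY: "lpath (Y \<mu>) a b" using Y bd\<mu> by auto
    have YX: "Y \<mu> \<inter> X = {}" using Y(1) Y(2)[rule_format, of \<mu>] \<mu>A unfolding X_def by fastforce
    have IX: "I \<inter> X = {}" "I \<inter> Y \<mu> = {}" using Y(1) I WK unfolding X_def by blast+
    have yX: "y \<in> X" "a \<in> Y \<mu>" using lpathD[OF lX] lpathD[OF lY] by auto
    have Xe: "X \<inter> e = {y}" using IX yX YX unfolding e_def by auto
    have "lpath (X \<union> e) x a" using re \<open>y \<noteq> a\<close> by (intro lpath.step[OF lX re Xe]) (auto simp: e_def)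
    moreover have "(X \<union> e) \<inter> Y \<mu> = {a}" using IX yX YX unfolding e_def by auto
    ultimately have "lpath (X \<union> e \<union> Y \<mu>) x b" using lpath_append[OF lY] by blast
    moreover have "X \<union> e \<union> Y \<mu> = W \<union> I \<union> (\<Union>m\<in>insert \<mu> A. Y m)"
      using yX unfolding X_def e_def by auto
    ultimately show "lpath (W \<union> I \<union> (\<Union>m\<in>insert \<mu> A. Y m)) x b" by simp
  qed
qed

text \<open>Of the \<open>s + 1\<close> blocks of \<open>w + k\<close> vertices, \<open>s\<close>
  carry the path and the remaining one supplies the \<open>k - 2\<close> new vertices of the closing
  edge.\<close>

lemma initial_clump:
  assumes "2 \<le> w" "clq K" "(s + 1) * (w + k) \<le> card K" "1 \<le> s"
  obtains W A where "clump w W A" "total W A \<subseteq> K" "card A = s"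
proof -
  obtain s' where s': "s = Suc s'" using assms(4) by (cases s) auto
  have "s * (w + k) \<le> card K" using assms(3) by simp
  then obtain K1 where K1: "K1 \<subseteq> K" "card K1 = s * (w + k)" "finite K1"
    using obtain_subset_with_card_n by metis
  have "clq K1" "Suc s' * (w + k) \<le> card K1" using clq_subset[OF assms(2) K1(1)] K1 s' by auto
  from initial_path[OF assms(1) this] obtain W A x y where IH:
    "finite W" "finite A" "total W A \<subseteq> K1" "card A = Suc s'" "x \<in> K1" "y \<in> K1"
    "\<And>m. m \<in> A \<Longrightarrow> mark w m" "\<And>m. m \<in> A \<Longrightarrow> bd m \<inter> W = {}"
    "\<And>m m'. \<lbrakk>m \<in> A; m' \<in> A; m \<noteq> m'\<rbrakk> \<Longrightarrow> bd m \<inter> bd m' = {}"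
    and path: "\<And>Y. \<lbrakk>\<forall>m\<in>A. lpath (Y m) (st m) (en m) \<and> Y m \<inter> W = {};
        \<forall>m\<in>A. \<forall>m'\<in>A. m \<noteq> m' \<longrightarrow> Y m \<inter> Y m' = {}\<rbrakk> \<Longrightarrow> lpath (W \<union> (\<Union>m\<in>A. Y m)) x y"
    by auto
  have "card (K - K1) = card K - card K1" using K1 by (simp add: card_Diff_subset)
  then have "k - 2 \<le> card (K - K1)" using K1 assms(3) by simp
  then obtain I where I: "I \<subseteq> K - K1" "card I = k - 2" "finite I"
    using obtain_subset_with_card_n by metis
  define e where "e = insert x (insert y I)"
  have bdK: "bd n \<subseteq> K1" if "n \<in> A" for n using that IH(3) by (auto simp: total_def)
  have WK: "W \<subseteq> K1" using IH(3) by (auto simp: total_def)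
  have "clump w (W \<union> I) A"
  proof (rule clumpI)
    show "finite (W \<union> I)" "finite A" using IH I by auto
    show "mark w n" if "n \<in> A" for n using that IH by auto
    show "bd n \<inter> (W \<union> I) = {}" if "n \<in> A" for n using that IH(8)[of n] bdK[of n] I by auto
    show "bd n \<inter> bd n' = {}" if "n \<in> A" "n' \<in> A" "n \<noteq> n'" for n n' using that IH(9) by auto
    fix Y assume Y: "\<And>n. n \<in> A \<Longrightarrow> lpath (Y n) (st n) (en n)" "\<And>n. n \<in> A \<Longrightarrow> Y n \<inter> (W \<union> I) = {}"
      "\<And>n n'. n \<in> A \<Longrightarrow> n' \<in> A \<Longrightarrow> n \<noteq> n' \<Longrightarrow> Y n \<inter> Y n' = {}"
    define X where "X = W \<union> (\<Union>m\<in>A. Y m)"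
    have "\<forall>n\<in>A. lpath (Y n) (st n) (en n) \<and> Y n \<inter> W = {}" using Y(1,2) by blast
    then have lX: "lpath X x y" unfolding X_def using Y(3) by (intro path) auto
    have X: "x \<in> X" "y \<in> X" "x \<noteq> y" using lpathD[OF lX] by auto
    have "card e = k" using I IH(5,6) X(3) k3 unfolding e_def
      by (subst card_insert_disjoint; auto)+
    moreover have "e \<subseteq> K" using I IH(5,6) K1 unfolding e_def by auto
    ultimately have "redge e" using clq_redge assms(2) by blast
    moreover have "I \<inter> X = {}" using Y(2) I WK unfolding X_def by blast
    then have "X \<inter> e = {x, y}" using X unfolding e_def by auto
    ultimately have "cyc (X \<union> e)" unfolding cyc_def using lX by blast
    moreover have "X \<union> e = W \<union> I \<union> (\<Union>m\<in>A. Y m)" using X unfolding e_def X_def by auto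
    ultimately show "cyc (W \<union> I \<union> (\<Union>m\<in>A. Y m))" by simp
  qed
  moreover have "total (W \<union> I) A \<subseteq> K" using IH(3) I K1(1) unfolding total_def by blast
  ultimately show ?thesis using that IH(4) s' by simp
qed

end

section \<open>Cycles of maximum length\<close>

text \<open>Only the length \<open>n\<close> itself is excluded. Longer red cycles may exist, so a
  cycle has to be kept below \<open>n\<close> by showing that it cannot pass \<open>n\<close>
  without attaining it.\<close>

locale counterexample = red_hypergraph k red
  for k :: nat and red :: "'v set \<Rightarrow> bool" +
  fixes V0 :: "'v set" and n :: nat
  assumes finite_V0: "finite V0" and no_cycle: "\<And>X. \<lbrakk>cyc X; X \<subseteq> V0\<rbrakk> \<Longrightarrow> card X \<noteq> n"
    and dvd_n: "(k - 1) dvd n"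
begin

text \<open>A discrete intermediate value argument. All lengths are multiples of
  \<open>k - 1\<close>; if \<open>N\<close> were at least \<open>n\<close>, then \<open>n\<close>
  would be one of the four lengths \<open>N - (k - 1) * t\<close> with \<open>t \<le> 3\<close>,
  each of which is attained.\<close>

lemma cyc_below:
  assumes "\<And>t. t \<le> 3 \<Longrightarrow> \<exists>X. cyc X \<and> X \<subseteq> V0 \<and> card X + (k - 1) * t = N" "N \<le> D + 4 * (k - 1)"
    "D < n" "(k - 1) dvd N"
  shows "N < n"
proof (rule ccontr)
  assume "\<not> N < n"
  then have "(k - 1) dvd (N - n)" using dvd_n assms(4) by (simp add: dvd_diff_nat)
  then obtain t where t: "N - n = (k - 1) * t" by auto
  have "(k - 1) * t < (k - 1) * 4" using assms(2,3) t \<open>\<not> N < n\<close> by linarith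
  then have "t \<le> 3" by simp
  then obtain X where "cyc X" "X \<subseteq> V0" "card X + (k - 1) * t = N" using assms(1) by blast
  then show False using no_cycle[of X] t \<open>\<not> N < n\<close> by linarith
qed

text \<open>Disjoint edges \<open>e\<close> and \<open>f\<close> between \<open>m\<close> and
  \<open>R\<close> would allow \<open>m\<close> to be replaced by a connector and a new mark inside
  \<open>R\<close>: again \<open>s\<close> marks, and \<open>4 * (k - 1)\<close> more vertices. This
  contradicts maximality provided the new cycle is still shorter than \<open>n\<close>, which
  follows from \<open>cyc_below\<close> because its segment in \<open>R\<close> can be shortened by
  up to three edges. The size of \<open>R\<close> leaves \<open>w\<close> vertices outside
  \<open>e \<union> f\<close>.\<close>

lemma longest_clump:
  assumes U: "U \<subseteq> V0" and w: "w = (k - 1) * q + 1" "8 \<le> q" and s: "1 \<le> s"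
    and K0: "clq K0" "K0 \<subseteq> U" "card K0 = (s + 1) * (w + k)" "(s + 1) * (w + k) < n"
  obtains W A where "clump w W A" "total W A \<subseteq> U" "card A = s" "card (total W A) < n"
    "\<And>R m e f. \<lbrakk>m \<in> A; clq R; w + 2 * k \<le> card R; R \<subseteq> U - total W A; redge e; redge f;
      e \<subseteq> inner m \<union> (U - total W A); f \<subseteq> inner m \<union> (U - total W A); e \<inter> inner m \<noteq> {};
      f \<inter> inner m \<noteq> {}; e \<inter> R \<noteq> {}; f \<inter> R \<noteq> {}\<rbrakk> \<Longrightarrow> e \<inter> f \<noteq> {}"
proof -
  define P where "P W A \<longleftrightarrow> clump w W A \<and> total W A \<subseteq> U \<and> card A = s \<and> card (total W A) < n" for W A
  have w2: "2 \<le> w" using w k3 by (cases q) auto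
  have wk: "4 * k \<le> w"
  proof -
    have "(k - 1) * 8 \<le> (k - 1) * q" using w(2) by (intro mult_le_mono2)
    then show ?thesis using w(1) k3 by linarith
  qed
  obtain W0 A0 where "clump w W0 A0" "total W0 A0 \<subseteq> K0" "card A0 = s"
    using initial_clump[OF w2 K0(1) _ s] K0(3) by auto
  moreover have "card (total W0 A0) \<le> card K0"
    using calculation(2) K0(1) by (simp add: card_mono clq_def)
  ultimately have P0: "P W0 A0" unfolding P_def using K0 by auto
  \<comment> \<open>With \<open>s\<close> and \<open>w\<close> fixed, maximising
    \<open>card W\<close> is the same as maximising the length of the cycle.\<close>
  have "\<exists>p. P (fst p) (snd p) \<and> (\<forall>p'. P (fst p') (snd p') \<longrightarrow> card (fst p') \<le> card (fst p))"
  proof (rule ex_has_greatest_nat[of "\<lambda>p. P (fst p) (snd p)" "(W0, A0)" "\<lambda>p. card (fst p)" n])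
    show "P (fst (W0, A0)) (snd (W0, A0))" using P0 by simp
    show "\<forall>p. P (fst p) (snd p) \<longrightarrow> card (fst p) < n"
    proof (intro allI impI)
      fix p assume "P (fst p) (snd p)"
      then have "clump w (fst p) (snd p)" "card (total (fst p) (snd p)) < n" unfolding P_def by auto
      then show "card (fst p) < n" using card_total by fastforce
    qed
  qed
  then obtain W A where P: "P W A" and mx: "\<And>W' A'. P W' A' \<Longrightarrow> card W' \<le> card W"
    by (metis fst_conv snd_conv)
  have cl: "clump w W A" and tU: "total W A \<subseteq> U" and cA: "card A = s" and tn: "card (total W A) < n"
    using P unfolding P_def by auto
  show ?thesis
  proof (rule that[OF cl tU cA tn])
    fix R m e f
    assume m: "m \<in> A" and R: "clq R" "w + 2 * k \<le> card R" "R \<subseteq> U - total W A" and ef: "redge e" "redge f"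
      and sub: "e \<subseteq> inner m \<union> (U - total W A)" "f \<subseteq> inner m \<union> (U - total W A)"
      and ne: "e \<inter> inner m \<noteq> {}" "f \<inter> inner m \<noteq> {}" "e \<inter> R \<noteq> {}" "f \<inter> R \<noteq> {}"
    show "e \<inter> f \<noteq> {}"
    proof
      assume dis: "e \<inter> f = {}"
      note D = clumpD[OF cl]
      have mm: "clq (bd m)" "card (bd m) = w" "st m \<in> bd m" "en m \<in> bd m" "st m \<noteq> en m"
        using D(3)[OF m] by (auto simp: mark_def)
      have mT: "bd m \<subseteq> total W A" using m by (auto simp: total_def)
      obtain u v u' v' where u: "u \<in> e" "u \<in> inner m" "v \<in> e" "v \<in> R" "u' \<in> f" "u' \<in> inner m" "v' \<in> f" "v' \<in> R"
        using ne by blast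
      have RT: "R \<inter> total W A = {}" using R(3) by auto
      have vK: "v \<notin> bd m" "v' \<notin> bd m" using u(4,8) RT mT by auto
      have ab: "st m \<notin> e \<union> f" "en m \<notin> e \<union> f" using sub mm mT by (auto simp: inner_def)
      have uK: "u \<in> bd m" "u' \<in> bd m" using u by (auto simp: inner_def)
      obtain C where C: "C \<subseteq> bd m \<union> e \<union> f - {v, v'}" "e \<union> f \<subseteq> C \<union> {v, v'}" "card C = 4 * (k - 1)" "finite C"
        and Cp: "\<And>Y. \<lbrakk>lpath Y v v'; Y \<inter> C = {}\<rbrakk> \<Longrightarrow> lpath (C \<union> Y) (st m) (en m)"
        using connector[OF mm(1) mm(3,4,5) _ ef dis ab u(1) uK(1) u(3) vK(1) u(5) uK(2) u(7) vK(2)] mm(2) wk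
        by metis
      have CU: "C \<subseteq> bd m \<union> (U - total W A)" using C(1) sub by (auto simp: inner_def)
      have CW: "C \<inter> W = {}" using CU D(4)[OF m] by (auto simp: total_def)
      have Cn: "C \<inter> bd l = {}" if "l \<in> A" "l \<noteq> m" for l
        using CU D(5)[OF m that(1)] that by (auto simp: total_def)
      have Rl: "R \<inter> bd l = {}" if "l \<in> A" for l using RT that by (auto simp: total_def)
      have vv: "v \<noteq> v'" using u dis by auto
      have fR: "finite R" using R(1) by (simp add: clq_def)
      have "R - C \<supseteq> R - (e \<union> f)" using C(1) RT mT by auto
      have "card (e \<union> f) \<le> 2 * k" using card_Un_le[of e f] redgeD ef by simp
      moreover have "card R - card (e \<union> f) \<le> card (R - (e \<union> f))"
        using redgeD ef by (intro diff_card_le_card_Diff) auto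
      moreover have "card (R - (e \<union> f)) \<le> card (R - C)" using \<open>R - C \<supseteq> R - (e \<union> f)\<close> fR by (intro card_mono) auto
      ultimately have RC: "w \<le> card (R - C)" using R(2) by linarith
      have vRC: "{v, v'} \<subseteq> R - C" using u C(1) by auto
      have seg: "\<exists>L. L \<subseteq> R - C \<and> card L = (k - 1) * (q - t) + 1 \<and> lpath L v v'" if "t \<le> 3" for t
      proof -
        have q1: "1 \<le> q - t" "q - t \<le> q" using that w by auto
        have "(k - 1) * (q - t) + 1 \<le> card (R - C)"
          using RC w(1) mult_le_mono2[OF q1(2), of "k - 1"] by linarith
        moreover have "clq (R - C)" using clq_subset[OF R(1)] by blast
        ultimately show ?thesis using vRC by (metis clq_lpath_ex insert_subset vv q1(1))
      qed
      obtain L where L: "L \<subseteq> R - C" "card L = w" "lpath L v v'" using seg[of 0] w by auto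
      define m' where "m' = Segment v v' L"
      have m'A: "m' \<notin> A" using Rl[of m'] L(1) lpathD[OF L(3)] by (auto simp: m'_def)
      have "mark w m'" using L vv clq_subset[OF R(1), of L] lpathD[OF L(3)] by (auto simp: mark_def m'_def)
      then have cl': "clump w (W \<union> C) (insert m' (A - {m}))"
      proof (rule clump_swap[OF cl m m'A _ C(4)])
        show "lpath (C \<union> Y) (st m) (en m)" if "lpath Y (st m') (en m')" "Y \<inter> C = {}" for Y
          using Cp that by (simp add: m'_def)
        show "C \<inter> W = {}" by (rule CW)
        show "bd m' \<inter> (W \<union> C) = {}" using L RT by (auto simp: m'_def total_def)
        show "(C \<union> bd m') \<inter> bd l = {}" if "l \<in> A" "l \<noteq> m" for l
          using Cn[OF that] Rl[OF that(1)] L(1) by (auto simp: m'_def)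
      qed
      have cA': "card (insert m' (A - {m})) = s" using m m'A D(2) cA s by simp
      have cWC: "card (W \<union> C) = card W + 4 * (k - 1)" using card_Un_disjoint[OF D(1) C(4)] CW C(3) by (simp add: Int_commute)
      have "total (W \<union> C) (insert m' (A - {m})) \<subseteq> total W A \<union> C \<union> L" by (auto simp: total_def m'_def)
      then have tU': "total (W \<union> C) (insert m' (A - {m})) \<subseteq> U" using tU CU L(1) R(3) mT by blast
      define N where "N = card (total (W \<union> C) (insert m' (A - {m})))"
      have N: "N = card W + 4 * (k - 1) + s * w" unfolding N_def using card_total[OF cl'] cA' cWC by simp
      have "N < n"
      proof (rule cyc_below[OF _ _ tn])
        show "N \<le> card (total W A) + 4 * (k - 1)" using card_total[OF cl] cA N by simp
        show "(k - 1) dvd N" unfolding N_def using clump_cyc[OF cl' w(1)] w(2) cyc_card by simp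
        fix t :: nat assume t: "t \<le> 3"
        then obtain L' where L': "L' \<subseteq> R - C" "card L' = (k - 1) * (q - t) + 1" "lpath L' v v'"
          using seg[OF t] by blast
        have lp: "lpath (C \<union> L') (st m) (en m)" using Cp L' by auto
        have CL: "(C \<union> L') \<inter> W = {}" using CW L'(1) RT by (auto simp: total_def)
        have CL2: "(C \<union> L') \<inter> bd l = {}" if "l \<in> A" "l \<noteq> m" for l using Cn[OF that] Rl[OF that(1)] L'(1) by auto
        have cl2: "clump w (W \<union> (C \<union> L')) (A - {m})" using clump_fix[OF cl m lp CL CL2] .
        have cy: "cyc (total (W \<union> (C \<union> L')) (A - {m}))" using clump_cyc[OF cl2 w(1)] w(2) by simp
        have "total (W \<union> (C \<union> L')) (A - {m}) \<subseteq> total W A \<union> C \<union> L'" by (auto simp: total_def)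
        then have sV: "total (W \<union> (C \<union> L')) (A - {m}) \<subseteq> V0" using tU CU L'(1) R(3) mT U by blast
        have "card (C \<union> L') = 4 * (k - 1) + ((k - 1) * (q - t) + 1)"
          using C L' fR finite_subset[OF L'(1)] by (subst card_Un_disjoint) auto
        then have "card (W \<union> (C \<union> L')) = card W + (4 * (k - 1) + ((k - 1) * (q - t) + 1))"
          using CL D(1) lpathD[OF lp] by (subst card_Un_disjoint) auto
        then have c1: "card (total (W \<union> (C \<union> L')) (A - {m}))
            = card W + (4 * (k - 1) + ((k - 1) * (q - t) + 1)) + (s - 1) * w"
          using card_total[OF cl2] D(2) m cA by simp
        have "(k - 1) * q = (k - 1) * (q - t) + (k - 1) * t"
          using t w(2) by (simp flip: distrib_left)
        then have w': "w = (k - 1) * (q - t) + 1 + (k - 1) * t" using w(1) by linarith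
        have "s * w = (s - 1) * w + w" using s by (cases s) auto
        then have "card (total (W \<union> (C \<union> L')) (A - {m})) + (k - 1) * t = N"
          using c1 w' N by linarith
        then show "\<exists>X. cyc X \<and> X \<subseteq> V0 \<and> card X + (k - 1) * t = N" using cy sV by blast
      qed
      then have "P (W \<union> C) (insert m' (A - {m}))" unfolding P_def N_def using cl' tU' cA' by auto
      then show False using mx cWC k3 by fastforce
    qed
  qed
qed

end

lemma card_index_pairs: "card {(i, j). i < j \<and> j < (r::nat)} = r choose 2"
proof -
  have "{(i, j). i < j \<and> j < r} = (SIGMA j:{..<r}. {..<j})\<inverse>" by auto
  then have "card {(i, j). i < j \<and> j < r} = (\<Sum>j<r. j)" by simp
  also have "\<dots> = r choose 2"
    by (induction r) (auto simp: numeral_2_eq_2)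
  finally show ?thesis .
qed

text \<open>\<open>H\<close> enters only through \<open>ramsey\<close> and \<open>no_blue\<close>.
  The parameters \<open>r + 1\<close>, \<open>m\<close> and \<open>\<sigma>\<close> stand for its
  chromatic number, its number of vertices and \<open>sigma\<close>. A part of size \<open>m\<close>
  holds any colour class; the last part need only hold a smallest one.\<close>

locale blue_free = counterexample k red V0 n
  for k :: nat and red :: "'v set \<Rightarrow> bool" and V0 :: "'v set" and n :: nat +
  fixes r m \<sigma> :: nat
  assumes ramsey: "\<And>U q. \<lbrakk>U \<subseteq> V0; ES k m q \<le> card U\<rbrakk> \<Longrightarrow> \<exists>K\<subseteq>U. clq K \<and> card K = q"
    and no_blue: "\<And>P. \<lbrakk>\<And>i. i \<le> r \<Longrightarrow> P i \<subseteq> V0; \<And>i. i < r \<Longrightarrow> m \<le> card (P i); \<sigma> \<le> card (P r);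
        \<And>i j. \<lbrakk>i \<le> r; j \<le> r; i \<noteq> j\<rbrakk> \<Longrightarrow> P i \<inter> P j = {}\<rbrakk>
      \<Longrightarrow> \<exists>e. redge e \<and> e \<subseteq> (\<Union>i\<le>r. P i) \<and> (\<forall>i\<le>r. \<not> e \<subseteq> P i)"
    and \<sigma>m: "\<sigma> \<le> m"
begin

text \<open>Suppose there is no such pair. Classify red edges by the lowest part \<open>i\<close>
  they meet and one further part, \<open>R\<close> counting as part \<open>r\<close>. Every class is
  then intersecting, by \<open>sep\<close> or by the assumption, so deleting one edge for each of at
  most \<open>(r + 1)\<^sup>2\<close> index pairs meets them all. The parts keep at least
  \<open>m\<close> vertices, and a crossing red edge from \<open>no_blue\<close> belongs to some
  class yet avoids the deleted set.\<close>

lemma crossing_pair: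
  assumes B: "\<And>i. i < r \<Longrightarrow> B i \<subseteq> V0 \<and> m + (r + 1)\<^sup>2 * k \<le> card (B i)"
    and disj: "\<And>i j. \<lbrakk>i < r; j < r; i \<noteq> j\<rbrakk> \<Longrightarrow> B i \<inter> B j = {}"
    and R: "R \<subseteq> V0" "m + (r + 1)\<^sup>2 * k \<le> card R" "\<And>i. i < r \<Longrightarrow> R \<inter> B i = {}"
    and sep: "\<And>i j e f. \<lbrakk>i < j; j < r; redge e; redge f; e \<subseteq> (\<Union>l\<in>{i..<r}. B l); f \<subseteq> (\<Union>l\<in>{i..<r}. B l);
        e \<inter> B i \<noteq> {}; f \<inter> B i \<noteq> {}; e \<inter> B j \<noteq> {}; f \<inter> B j \<noteq> {}\<rbrakk> \<Longrightarrow> e \<inter> f \<noteq> {}"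
  obtains i e f where "i < r" "redge e" "redge f" "e \<inter> f = {}"
    "e \<subseteq> (\<Union>l\<in>{i..<r}. B l) \<union> R" "f \<subseteq> (\<Union>l\<in>{i..<r}. B l) \<union> R"
    "e \<inter> B i \<noteq> {}" "f \<inter> B i \<noteq> {}" "e \<inter> R \<noteq> {}" "f \<inter> R \<noteq> {}"
proof (rule ccontr)
  assume "\<not> thesis"
  with that have no: "e \<inter> f \<noteq> {}" if "i < r" "redge e" "redge f"
      "e \<subseteq> (\<Union>l\<in>{i..<r}. B l) \<union> R" "f \<subseteq> (\<Union>l\<in>{i..<r}. B l) \<union> R"
      "e \<inter> B i \<noteq> {}" "f \<inter> B i \<noteq> {}" "e \<inter> R \<noteq> {}" "f \<inter> R \<noteq> {}" for i e f
    using that by meson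
  define P where "P = B(r := R)"
  define Q where "Q = {(i, j). i < j \<and> j < Suc r}"
  define F where "F p = {e. redge e \<and> e \<subseteq> (\<Union>l\<in>{fst p..<r}. B l) \<union> (if snd p = r then R else {})
      \<and> e \<inter> B (fst p) \<noteq> {} \<and> e \<inter> P (snd p) \<noteq> {}}" for p
  have "Q \<subseteq> {..r} \<times> {..r}" by (auto simp: Q_def)
  then have fQ: "finite Q" "card Q \<le> (r + 1)\<^sup>2"
    using finite_subset card_mono[of "{..r} \<times> {..r}" Q] by (auto simp: power2_eq_square)
  obtain D where D: "finite D" "card D \<le> card Q * k" "\<And>p e. p \<in> Q \<Longrightarrow> e \<in> F p \<Longrightarrow> e \<inter> D \<noteq> {}"
  proof (rule intersecting_hitting_set[OF fQ(1), of F k])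
    show "e \<inter> f \<noteq> {}" if p: "p \<in> Q" and ef: "e \<in> F p" "f \<in> F p" for p e f
    proof (cases "snd p = r")
      case True
      then show ?thesis using ef p by (rule_tac no[of "fst p"]) (auto simp: F_def P_def Q_def)
    next
      case False
      then show ?thesis using ef p by (rule_tac sep[of "fst p" "snd p"]) (auto simp: F_def P_def Q_def)
    qed
    show "finite e \<and> card e \<le> k" if "e \<in> F p" for p e using that redgeD by (auto simp: F_def)
  qed blast
  have cD: "card D \<le> (r + 1)\<^sup>2 * k" using D(2) fQ(2) by (meson le_trans mult_le_mono1)
  have big: "m \<le> card (X - D)" if "m + (r + 1)\<^sup>2 * k \<le> card X" for X
    using that cD diff_card_le_card_Diff[OF D(1), of X] by linarith
  have PV: "P i \<subseteq> V0" if "i \<le> r" for i using that B[of i] R by (cases "i = r") (auto simp: P_def)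
  have Pd: "P i \<inter> P j = {}" if "i \<le> r" "j \<le> r" "i \<noteq> j" for i j
    using that disj[of i j] R(3)[of i] R(3)[of j] by (auto simp: P_def)
  have "\<exists>e. redge e \<and> e \<subseteq> (\<Union>i\<le>r. P i - D) \<and> (\<forall>i\<le>r. \<not> e \<subseteq> P i - D)"
  proof (rule no_blue)
    show "P i - D \<subseteq> V0" if "i \<le> r" for i using PV[OF that] by auto
    show "m \<le> card (P i - D)" if "i < r" for i using big B[OF that] that by (simp add: P_def)
    show "\<sigma> \<le> card (P r - D)" using big[OF R(2)] \<sigma>m by (simp add: P_def)
    show "(P i - D) \<inter> (P j - D) = {}" if "i \<le> r" "j \<le> r" "i \<noteq> j" for i j using Pd[OF that] by auto
  qed
  then obtain e where e: "redge e" "e \<subseteq> (\<Union>i\<le>r. P i - D)" "\<And>i. i \<le> r \<Longrightarrow> \<not> e \<subseteq> P i - D" by blast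
  have eD: "e \<inter> D = {}" using e(2) by auto
  have eP: "e \<subseteq> (\<Union>i\<le>r. P i)" using e(2) by auto
  have eN: "\<not> e \<subseteq> P i" if "i \<le> r" for i using e(3)[OF that] eD by auto
  obtain i0 where "i0 < r" "e \<inter> B i0 \<noteq> {}"
  proof -
    obtain x where x: "x \<in> e" "x \<notin> P r" using eN[of r] by auto
    then obtain l where l: "l \<le> r" "x \<in> P l" using eP by blast
    then have "l < r" using x by (metis le_neq_implies_less)
    moreover have "x \<in> B l" using l \<open>l < r\<close> by (simp add: P_def)
    ultimately show ?thesis using that x by blast
  qed
  then have ex: "\<exists>i. i < r \<and> e \<inter> B i \<noteq> {}" by blast
  define i where "i = (LEAST i. i < r \<and> e \<inter> B i \<noteq> {})"
  have i: "i < r" "e \<inter> B i \<noteq> {}" using LeastI_ex[OF ex] by (auto simp: i_def)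
  have least: "i \<le> l" if "l < r" "e \<inter> B l \<noteq> {}" for l using that unfolding i_def by (intro Least_le) auto
  have sub: "e \<subseteq> (\<Union>l\<in>{i..<r}. B l) \<union> R"
  proof
    fix x assume x: "x \<in> e"
    then obtain l where l: "l \<le> r" "x \<in> P l" using eP by auto
    show "x \<in> (\<Union>l\<in>{i..<r}. B l) \<union> R"
    proof (cases "l = r")
      case True then show ?thesis using l by (auto simp: P_def)
    next
      case False
      then have "l < r" "x \<in> B l" using l by (auto simp: P_def)
      then have "l \<in> {i..<r}" using x least[of l] by auto
      then show ?thesis using \<open>x \<in> B l\<close> by blast
    qed
  qed
  show False
  proof (cases "e \<inter> R = {}")
    case False
    then have "e \<in> F (i, r)" using e(1) i sub by (auto simp: F_def P_def)
    then show False using D(3)[of "(i, r)" e] eD i by (auto simp: Q_def)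
  next
    case True
    obtain x where x: "x \<in> e" "x \<notin> P i" using eN[of i] i by auto
    then obtain j where j: "j \<in> {i..<r}" "x \<in> B j" using sub True by auto
    then have "i < j" using x i by (cases "i = j") (auto simp: P_def)
    then have "e \<in> F (i, j)" using e(1) i sub True x j by (auto simp: F_def P_def)
    then show False using D(3)[of "(i, j)" e] eD j \<open>i < j\<close> by (auto simp: Q_def)
  qed
qed

text \<open>What the maximality of a cycle says about its marks.\<close>

definition separated :: "nat \<Rightarrow> 'v set \<Rightarrow> 'v segment \<Rightarrow> bool" where
  "separated w U \<mu> \<longleftrightarrow> (\<forall>R e f. clq R \<and> w + 2 * k \<le> card R \<and> R \<subseteq> U \<and> redge e \<and> redge f
     \<and> e \<subseteq> inner \<mu> \<union> U \<and> f \<subseteq> inner \<mu> \<union> U \<and> e \<inter> inner \<mu> \<noteq> {} \<and> f \<inter> inner \<mu> \<noteq> {}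
     \<and> e \<inter> R \<noteq> {} \<and> f \<inter> R \<noteq> {} \<longrightarrow> e \<inter> f \<noteq> {})"

lemma separatedD:
  assumes "separated w U \<mu>" "clq R" "w + 2 * k \<le> card R" "R \<subseteq> U" "redge e" "redge f"
    "e \<subseteq> inner \<mu> \<union> U" "f \<subseteq> inner \<mu> \<union> U" "e \<inter> inner \<mu> \<noteq> {}" "f \<inter> inner \<mu> \<noteq> {}"
    "e \<inter> R \<noteq> {}" "f \<inter> R \<noteq> {}"
  shows "e \<inter> f \<noteq> {}"
  using assms(1)[unfolded separated_def, rule_format, of R e f] assms(2-) by simp

text \<open>Cycle \<open>i\<close> is separated within the complement of the cycles \<open>0\<close>
  to \<open>i\<close>: this is what was available after its choice, and it contains all later cycles
  and the leftover.\<close>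

definition clump_family :: "(nat \<Rightarrow> nat) \<Rightarrow> nat \<Rightarrow> nat \<Rightarrow> (nat \<Rightarrow> 'v set) \<Rightarrow> (nat \<Rightarrow> 'v segment set) \<Rightarrow> bool" where
  "clump_family w s t W A \<longleftrightarrow>
     (\<forall>i<t. clump (w i) (W i) (A i) \<and> total (W i) (A i) \<subseteq> V0 \<and> card (A i) = s
        \<and> card (total (W i) (A i)) < n
        \<and> (\<forall>\<mu>\<in>A i. separated (w i) (V0 - (\<Union>l\<in>{..i}. total (W l) (A l))) \<mu>))
      \<and> (\<forall>i<t. \<forall>j<t. i \<noteq> j \<longrightarrow> total (W i) (A i) \<inter> total (W j) (A j) = {})"

text \<open>The \<open>t\<close> cycles chosen so far have at most \<open>n - 1\<close> vertices
  each, so at least \<open>n\<close> vertices remain. They contain a red clique with room for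
  \<open>s\<close> marks, from which the next longest cycle is obtained.\<close>

lemma clump_sequence:
  assumes w: "\<And>i. w i = (k - 1) * q i + 1" "\<And>i. 8 \<le> q i" and s: "1 \<le> s"
    and large: "\<And>i. i < r \<Longrightarrow> ES k m ((s + 1) * (w i + k)) \<le> n \<and> (s + 1) * (w i + k) < n"
    and V0: "r * (n - 1) + 1 \<le> card V0"
  shows "t \<le> r \<Longrightarrow> \<exists>W A. clump_family w s t W A"
proof (induction t)
  case 0
  show ?case by (simp add: clump_family_def)
next
  case (Suc t)
  then have t: "t < r" by simp
  from Suc obtain W A where "clump_family w s t W A" by auto
  then have IH: "\<And>i. i < t \<Longrightarrow> clump (w i) (W i) (A i)"
      "\<And>i. i < t \<Longrightarrow> total (W i) (A i) \<subseteq> V0" "\<And>i. i < t \<Longrightarrow> card (A i) = s"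
      "\<And>i. i < t \<Longrightarrow> card (total (W i) (A i)) < n"
      "\<And>i \<mu>. i < t \<Longrightarrow> \<mu> \<in> A i \<Longrightarrow> separated (w i) (V0 - (\<Union>l\<in>{..i}. total (W l) (A l))) \<mu>"
      "\<And>i j. i < t \<Longrightarrow> j < t \<Longrightarrow> i \<noteq> j \<Longrightarrow> total (W i) (A i) \<inter> total (W j) (A j) = {}"
    unfolding clump_family_def by blast+
  define T where "T = (\<Union>l<t. total (W l) (A l))"
  define U where "U = V0 - T"
  have "card T \<le> (\<Sum>l<t. card (total (W l) (A l)))" unfolding T_def by (rule card_UN_le) simp
  also have "\<dots> \<le> (\<Sum>l<t. n - 1)" using IH(4) by (intro sum_mono) fastforce
  finally have "card T \<le> t * (n - 1)" by simp
  moreover have "t * (n - 1) + (n - 1) \<le> r * (n - 1)" using mult_le_mono1[of "Suc t" r "n - 1"] t by simp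
  moreover have "finite T" unfolding T_def using IH(1) finite_total by blast
  ultimately have "n \<le> card U"
    using V0 diff_card_le_card_Diff[of T V0] unfolding U_def by linarith
  then have "ES k m ((s + 1) * (w t + k)) \<le> card U" using large[OF t] by linarith
  then obtain K where K: "K \<subseteq> U" "clq K" "card K = (s + 1) * (w t + k)"
    using ramsey[of U] unfolding U_def by blast
  have UV: "U \<subseteq> V0" by (auto simp: U_def)
  obtain X B where X: "clump (w t) X B" "total X B \<subseteq> U" "card B = s" "card (total X B) < n"
    and sep: "\<And>R \<mu> e f. \<lbrakk>\<mu> \<in> B; clq R; w t + 2 * k \<le> card R; R \<subseteq> U - total X B; redge e; redge f;
      e \<subseteq> inner \<mu> \<union> (U - total X B); f \<subseteq> inner \<mu> \<union> (U - total X B); e \<inter> inner \<mu> \<noteq> {};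
      f \<inter> inner \<mu> \<noteq> {}; e \<inter> R \<noteq> {}; f \<inter> R \<noteq> {}\<rbrakk> \<Longrightarrow> e \<inter> f \<noteq> {}"
    using longest_clump[OF UV w(1)[of t] w(2)[of t] s K(2,1,3)] large[OF t] by blast
  define W' where "W' = W(t := X)"
  define A' where "A' = A(t := B)"
  have old: "W' i = W i" "A' i = A i" if "i < t" for i using that by (auto simp: W'_def A'_def)
  have new: "W' t = X" "A' t = B" by (auto simp: W'_def A'_def)
  have T': "(\<Union>l\<in>{..i}. total (W' l) (A' l)) = (\<Union>l\<in>{..i}. total (W l) (A l))" if "i < t" for i
    using that old by (intro SUP_cong) auto
  have "{..t} = insert t {..<t}" by auto
  moreover have "(\<Union>l<t. total (W' l) (A' l)) = T" unfolding T_def using old by (intro SUP_cong) auto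
  ultimately have "(\<Union>l\<in>{..t}. total (W' l) (A' l)) = total X B \<union> T" using new by simp
  then have rest: "V0 - (\<Union>l\<in>{..t}. total (W' l) (A' l)) = U - total X B" by (auto simp: U_def)
  have sepB: "separated (w t) (U - total X B) \<mu>" if "\<mu> \<in> B" for \<mu>
    unfolding separated_def using sep[OF that] by blast
  have disj: "total X B \<inter> total (W i) (A i) = {}" if "i < t" for i
    using X(2) that unfolding U_def T_def by blast
  have "clump_family w s (Suc t) W' A'"
    unfolding clump_family_def
  proof (intro conjI allI impI ballI)
    fix i assume i: "i < Suc t"
    consider "i < t" | "i = t" using i by linarith
    then show "clump (w i) (W' i) (A' i)" "total (W' i) (A' i) \<subseteq> V0" "card (A' i) = s"
        "card (total (W' i) (A' i)) < n"
      by (cases; use IH(1-4) X UV old new in auto)+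
    show "separated (w i) (V0 - (\<Union>l\<in>{..i}. total (W' l) (A' l))) \<mu>" if "\<mu> \<in> A' i" for \<mu>
    proof (cases "i = t")
      case True then show ?thesis using sepB that rest new by simp
    next
      case False
      then have "i < t" using i by simp
      then show ?thesis using IH(5)[of i \<mu>] that old[of i] T'[of i] by simp
    qed
    fix j assume j: "j < Suc t" "i \<noteq> j"
    consider "i < t" "j < t" | "i = t" "j < t" | "i < t" "j = t" using i j by linarith
    then show "total (W' i) (A' i) \<inter> total (W' j) (A' j) = {}"
    proof cases
      case 1 then show ?thesis using IH(6)[of i j] j old by simp
    next
      case 2 then show ?thesis using disj[of j] old[of j] new by simp
    next
      case 3 then show ?thesis using disj[of i] old[of i] new by (simp add: Int_commute)
    qed
  qed
  then show ?case by blast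
qed

end

context blue_free
begin

section \<open>Shrinking the set of leftover vertices\<close>

text \<open>Of \<open>separated\<close> only the consequence between marks of different cycles is
  kept. It involves the chosen marks alone, for every choice of one per cycle, and so it survives
  when marks are removed and the cycles are rerouted, whereas the complement \<open>U\<close> in
  \<open>separated\<close> may change.\<close>

definition system :: "(nat \<Rightarrow> nat) \<Rightarrow> nat \<Rightarrow> (nat \<Rightarrow> 'v set) \<Rightarrow> (nat \<Rightarrow> 'v segment set) \<Rightarrow> bool" where
  "system w s W A \<longleftrightarrow>
     (\<forall>i<r. clump (w i) (W i) (A i) \<and> total (W i) (A i) \<subseteq> V0 \<and> card (A i) = s
        \<and> card (total (W i) (A i)) < n)
     \<and> (\<forall>i<r. \<forall>j<r. i \<noteq> j \<longrightarrow> total (W i) (A i) \<inter> total (W j) (A j) = {})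
     \<and> (\<forall>\<mu> i j e f. (\<forall>l<r. \<mu> l \<in> A l) \<and> i < j \<and> j < r \<and> redge e \<and> redge f
        \<and> e \<subseteq> (\<Union>l\<in>{i..<r}. inner (\<mu> l)) \<and> f \<subseteq> (\<Union>l\<in>{i..<r}. inner (\<mu> l))
        \<and> e \<inter> inner (\<mu> i) \<noteq> {} \<and> f \<inter> inner (\<mu> i) \<noteq> {}
        \<and> e \<inter> inner (\<mu> j) \<noteq> {} \<and> f \<inter> inner (\<mu> j) \<noteq> {} \<longrightarrow> e \<inter> f \<noteq> {})"

definition leftover :: "(nat \<Rightarrow> 'v set) \<Rightarrow> (nat \<Rightarrow> 'v segment set) \<Rightarrow> 'v set" where
  "leftover W A = V0 - (\<Union>i<r. total (W i) (A i))"

lemma systemD: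
  assumes "system w s W A"
  shows "\<And>i. i < r \<Longrightarrow> clump (w i) (W i) (A i)" "\<And>i. i < r \<Longrightarrow> total (W i) (A i) \<subseteq> V0"
    "\<And>i. i < r \<Longrightarrow> card (A i) = s" "\<And>i. i < r \<Longrightarrow> card (total (W i) (A i)) < n"
    "\<And>i j. \<lbrakk>i < r; j < r; i \<noteq> j\<rbrakk> \<Longrightarrow> total (W i) (A i) \<inter> total (W j) (A j) = {}"
    "\<And>\<mu> i j e f. \<lbrakk>\<And>l. l < r \<Longrightarrow> \<mu> l \<in> A l; i < j; j < r; redge e; redge f;
        e \<subseteq> (\<Union>l\<in>{i..<r}. inner (\<mu> l)); f \<subseteq> (\<Union>l\<in>{i..<r}. inner (\<mu> l));
        e \<inter> inner (\<mu> i) \<noteq> {}; f \<inter> inner (\<mu> i) \<noteq> {};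
        e \<inter> inner (\<mu> j) \<noteq> {}; f \<inter> inner (\<mu> j) \<noteq> {}\<rbrakk> \<Longrightarrow> e \<inter> f \<noteq> {}"
proof -
  note sys = assms[unfolded system_def]
  have 1: "\<forall>i<r. clump (w i) (W i) (A i) \<and> total (W i) (A i) \<subseteq> V0 \<and> card (A i) = s
        \<and> card (total (W i) (A i)) < n"
    by (rule conjunct1[OF sys])
  have 2: "\<forall>i<r. \<forall>j<r. i \<noteq> j \<longrightarrow> total (W i) (A i) \<inter> total (W j) (A j) = {}"
    by (rule conjunct1[OF conjunct2[OF sys]])
  have 3: "\<forall>\<mu> i j e f. (\<forall>l<r. \<mu> l \<in> A l) \<and> i < j \<and> j < r \<and> redge e \<and> redge f
        \<and> e \<subseteq> (\<Union>l\<in>{i..<r}. inner (\<mu> l)) \<and> f \<subseteq> (\<Union>l\<in>{i..<r}. inner (\<mu> l))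
        \<and> e \<inter> inner (\<mu> i) \<noteq> {} \<and> f \<inter> inner (\<mu> i) \<noteq> {}
        \<and> e \<inter> inner (\<mu> j) \<noteq> {} \<and> f \<inter> inner (\<mu> j) \<noteq> {} \<longrightarrow> e \<inter> f \<noteq> {}"
    by (rule conjunct2[OF conjunct2[OF sys]])
  show "\<And>i. i < r \<Longrightarrow> clump (w i) (W i) (A i)" "\<And>i. i < r \<Longrightarrow> total (W i) (A i) \<subseteq> V0"
    "\<And>i. i < r \<Longrightarrow> card (A i) = s" "\<And>i. i < r \<Longrightarrow> card (total (W i) (A i)) < n"
    using 1 by auto
  show "\<And>i j. \<lbrakk>i < r; j < r; i \<noteq> j\<rbrakk> \<Longrightarrow> total (W i) (A i) \<inter> total (W j) (A j) = {}" using 2 by auto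
  fix \<mu> i j e f
  assume "\<And>l. l < r \<Longrightarrow> \<mu> l \<in> A l" "i < j" "j < r" "redge e" "redge f"
        "e \<subseteq> (\<Union>l\<in>{i..<r}. inner (\<mu> l))" "f \<subseteq> (\<Union>l\<in>{i..<r}. inner (\<mu> l))"
        "e \<inter> inner (\<mu> i) \<noteq> {}" "f \<inter> inner (\<mu> i) \<noteq> {}"
        "e \<inter> inner (\<mu> j) \<noteq> {}" "f \<inter> inner (\<mu> j) \<noteq> {}"
  then show "e \<inter> f \<noteq> {}" by (intro 3[rule_format, of \<mu> i j e f] conjI allI impI)
qed

lemma card_leftover:
  assumes "system w s W A"
  shows "card (leftover W A) + (\<Sum>i<r. card (total (W i) (A i))) = card V0"
proof -
  note S = systemD[OF assms]
  have "card (\<Union>i<r. total (W i) (A i)) = (\<Sum>i<r. card (total (W i) (A i)))"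
    using finite_total[OF S(1)] S(5) by (intro card_UN_disjoint) auto
  moreover have "(\<Union>i<r. total (W i) (A i)) \<subseteq> V0" using S(2) by auto
  ultimately show ?thesis
    unfolding leftover_def using card_Diff_subset[of "\<Union>i<r. total (W i) (A i)" V0]
      card_mono[OF finite_V0, of "\<Union>i<r. total (W i) (A i)"] finite_subset[OF _ finite_V0] by simp
qed

lemma mark_inner:
  assumes "mark w \<mu>" "4 \<le> w"
  shows "card (inner \<mu>) = w - 2" "inner \<mu> \<subseteq> bd \<mu>" "clq (inner \<mu>)" "finite (bd \<mu>)"
proof -
  have m: "clq (bd \<mu>)" "card (bd \<mu>) = w" "st \<mu> \<in> bd \<mu>" "en \<mu> \<in> bd \<mu>" "st \<mu> \<noteq> en \<mu>"
    using assms by (auto simp: mark_def)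
  show "finite (bd \<mu>)" using m by (simp add: clq_def)
  show "card (inner \<mu>) = w - 2" unfolding inner_def using m by (subst card_Diff_subset) auto
  show "inner \<mu> \<subseteq> bd \<mu>" by (auto simp: inner_def)
  then show "clq (inner \<mu>)" using m clq_subset by blast
qed

text \<open>The marks have to grow with \<open>i\<close>: those of later cycles then are cliques large enough to be
  separated from the marks of the earlier ones.\<close>

lemma initial_system:
  assumes w: "\<And>i. w i = (k - 1) * (Q + 4 * i) + 1" "8 \<le> Q" "m + (r + 1)\<^sup>2 * k + 2 \<le> Q" and s: "1 \<le> s"
    and large: "\<And>i. i < r \<Longrightarrow> ES k m ((s + 1) * (w i + k)) \<le> n \<and> (s + 1) * (w i + k) < n"
    and V0: "r * (n - 1) + 1 \<le> card V0"
  obtains W A where "system w s W A" "card (leftover W A) < ES k m (w r + 2 * k)"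
proof -
  have wi: "Q \<le> w i" for i
  proof -
    have "1 * Q \<le> (k - 1) * (Q + 4 * i)" using k3 by (intro mult_le_mono) auto
    then show ?thesis using w(1)[of i] by linarith
  qed
  \<comment> \<open>The \<open>inner\<close> vertices of a later mark number at least
    \<open>w i + 4 * (k - 1) - 2\<close>, and \<open>4 * (k - 1) - 2 \<ge> 2 * k\<close> since
    \<open>k\<close> is at least 3.\<close>
  have wmono: "w i + 4 * (k - 1) \<le> w j" if "i < j" for i j
  proof -
    have "(k - 1) * (Q + 4 * i + 4) \<le> (k - 1) * (Q + 4 * j)" using that by (intro mult_le_mono2) auto
    moreover have "(k - 1) * (Q + 4 * i + 4) = (k - 1) * (Q + 4 * i) + 4 * (k - 1)"
      by (simp only: distrib_left mult.commute)
    ultimately show ?thesis using w(1)[of i] w(1)[of j] by linarith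
  qed
  have w4: "4 \<le> w i" for i using wi[of i] w(2) by linarith
  have "\<exists>W A. clump_family w s r W A"
  proof (rule clump_sequence[OF w(1) _ s large V0 order_refl])
    show "8 \<le> Q + 4 * i" for i using w(2) by simp
  qed
  then obtain W A where WA: "clump_family w s r W A" by blast
  then have S: "\<And>i. i < r \<Longrightarrow> clump (w i) (W i) (A i)" "\<And>i. i < r \<Longrightarrow> total (W i) (A i) \<subseteq> V0"
      "\<And>i. i < r \<Longrightarrow> card (A i) = s" "\<And>i. i < r \<Longrightarrow> card (total (W i) (A i)) < n"
      "\<And>i \<mu>. i < r \<Longrightarrow> \<mu> \<in> A i \<Longrightarrow> separated (w i) (V0 - (\<Union>l\<in>{..i}. total (W l) (A l))) \<mu>"
      "\<And>i j. i < r \<Longrightarrow> j < r \<Longrightarrow> i \<noteq> j \<Longrightarrow> total (W i) (A i) \<inter> total (W j) (A j) = {}"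
    unfolding clump_family_def by blast+
  have mk: "mark (w i) \<mu>" "inner \<mu> \<subseteq> total (W i) (A i)" if "i < r" "\<mu> \<in> A i" for i \<mu>
    using clumpD(3)[OF S(1)[OF that(1)] that(2)] that by (auto simp: total_def inner_def)
  \<comment> \<open>Outside the mark of cycle \<open>i\<close> such a set uses only later cycles and
    the leftover, which is the region that \<open>separated\<close> speaks of.\<close>
  have rest: "X - inner (\<mu> i) \<subseteq> V0 - (\<Union>l\<in>{..i}. total (W l) (A l))"
    if "\<And>l. l < r \<Longrightarrow> \<mu> l \<in> A l" "i < r" "X \<subseteq> (\<Union>l\<in>{i..<r}. inner (\<mu> l)) \<union> R" "R \<subseteq> leftover W A" for X \<mu> i R
  proof
    note H = that
    fix x assume x: "x \<in> X - inner (\<mu> i)"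
    show "x \<in> V0 - (\<Union>l\<in>{..i}. total (W l) (A l))"
    proof (cases "x \<in> R")
      case True then show ?thesis using H(2,4) by (auto simp: leftover_def)
    next
      case False
      then have "x \<in> (\<Union>l\<in>{i..<r}. inner (\<mu> l))" using x H(3) by blast
      then obtain l where l: "i \<le> l" "l < r" "x \<in> inner (\<mu> l)" by auto
      then have "i < l" using x by (cases "i = l") auto
      have "x \<in> total (W l) (A l)" using mk(2)[OF l(2) H(1)[OF l(2)]] l(3) by auto
      moreover have "x \<notin> total (W j) (A j)" if "j \<le> i" for j
        using S(6)[of j l] that calculation l(2) \<open>i < l\<close> by auto
      ultimately show ?thesis using S(2)[OF l(2)] by auto
    qed
  qed
  have sys: "system w s W A"
    unfolding system_def
  proof (intro conjI allI impI)
    fix \<mu> i j e f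
    assume H: "(\<forall>l<r. \<mu> l \<in> A l) \<and> i < j \<and> j < r \<and> redge e \<and> redge f
        \<and> e \<subseteq> (\<Union>l\<in>{i..<r}. inner (\<mu> l)) \<and> f \<subseteq> (\<Union>l\<in>{i..<r}. inner (\<mu> l))
        \<and> e \<inter> inner (\<mu> i) \<noteq> {} \<and> f \<inter> inner (\<mu> i) \<noteq> {}
        \<and> e \<inter> inner (\<mu> j) \<noteq> {} \<and> f \<inter> inner (\<mu> j) \<noteq> {}"
    then have i: "i < r" and \<mu>: "\<And>l. l < r \<Longrightarrow> \<mu> l \<in> A l" by auto
    have mj: "mark (w j) (\<mu> j)" using mk(1)[of j "\<mu> j"] H by auto
    let ?U = "V0 - (\<Union>l\<in>{..i}. total (W l) (A l))"
    have H': "redge e" "redge f" "e \<subseteq> (\<Union>l\<in>{i..<r}. inner (\<mu> l)) \<union> {}"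
      "f \<subseteq> (\<Union>l\<in>{i..<r}. inner (\<mu> l)) \<union> {}"
      "e \<inter> inner (\<mu> i) \<noteq> {}" "f \<inter> inner (\<mu> i) \<noteq> {}"
      "e \<inter> inner (\<mu> j) \<noteq> {}" "f \<inter> inner (\<mu> j) \<noteq> {}" "i < j" "j < r"
      using H by simp_all
    have "e - inner (\<mu> i) \<subseteq> ?U" "f - inner (\<mu> i) \<subseteq> ?U"
      using rest[OF \<mu> i H'(3)] rest[OF \<mu> i H'(4)] by simp_all
    then have ef: "e \<subseteq> inner (\<mu> i) \<union> ?U" "f \<subseteq> inner (\<mu> i) \<union> ?U" by auto
    have "inner (\<mu> j) \<subseteq> (\<Union>l\<in>{i..<r}. inner (\<mu> l)) \<union> {}" using H'(9,10) by force
    from rest[OF \<mu> i this] have "inner (\<mu> j) - inner (\<mu> i) \<subseteq> ?U" by simp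
    moreover have "inner (\<mu> j) \<inter> inner (\<mu> i) = {}"
      using mk(2)[OF i \<mu>[OF i]] mk(2)[OF H'(10) \<mu>[OF H'(10)]] S(6)[OF i H'(10)] H'(9) by blast
    ultimately have jU: "inner (\<mu> j) \<subseteq> ?U" by auto
    have "w i + 2 * k \<le> card (inner (\<mu> j))"
      using mark_inner(1)[OF mj w4] wmono[OF H'(9)] k3 by simp
    then show "e \<inter> f \<noteq> {}"
      using separatedD[OF S(5)[OF i \<mu>[OF i]] mark_inner(3)[OF mj w4] _ jU H'(1,2) ef H'(5-8)] by blast
  qed (use S in auto)
  moreover have "card (leftover W A) < ES k m (w r + 2 * k)"
  proof (rule ccontr)
    assume "\<not> ?thesis"
    then have "ES k m (w r + 2 * k) \<le> card (leftover W A)" by simp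
    moreover have "leftover W A \<subseteq> V0" by (auto simp: leftover_def)
    ultimately obtain R where R: "R \<subseteq> leftover W A" "clq R" "card R = w r + 2 * k"
      using ramsey by blast
    have "\<forall>l. \<exists>\<mu>. l < r \<longrightarrow> \<mu> \<in> A l"
      using S(3) s by (metis card.empty ex_in_conv not_one_le_zero)
    then obtain \<mu> where \<mu>: "\<And>l. l < r \<Longrightarrow> \<mu> l \<in> A l" by metis
    obtain i e f where ief: "i < r" "redge e" "redge f" "e \<inter> f = {}"
      "e \<subseteq> (\<Union>l\<in>{i..<r}. inner (\<mu> l)) \<union> R" "f \<subseteq> (\<Union>l\<in>{i..<r}. inner (\<mu> l)) \<union> R"
      "e \<inter> inner (\<mu> i) \<noteq> {}" "f \<inter> inner (\<mu> i) \<noteq> {}" "e \<inter> R \<noteq> {}" "f \<inter> R \<noteq> {}"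
    proof (rule crossing_pair[of "\<lambda>l. inner (\<mu> l)" R])
      show "inner (\<mu> l) \<subseteq> V0 \<and> m + (r + 1)\<^sup>2 * k \<le> card (inner (\<mu> l))" if "l < r" for l
        using mk[OF that \<mu>[OF that]] S(2)[OF that] mark_inner(1)[OF mk(1)[OF that \<mu>[OF that]] w4] wi[of l] w(3) by auto
      show "inner (\<mu> l) \<inter> inner (\<mu> j) = {}" if "l < r" "j < r" "l \<noteq> j" for l j
        using mk(2)[OF that(1) \<mu>[OF that(1)]] mk(2)[OF that(2) \<mu>[OF that(2)]] S(6)[OF that] by blast
      show "R \<subseteq> V0" using R by (auto simp: leftover_def)
      show "m + (r + 1)\<^sup>2 * k \<le> card R" using R(3) wi[of r] w(3) by simp
      show "R \<inter> inner (\<mu> l) = {}" if "l < r" for l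
        using R(1) mk(2)[OF that \<mu>[OF that]] that by (auto simp: leftover_def)
      show "e \<inter> f \<noteq> {}" if "i < j" "j < r" "redge e" "redge f" "e \<subseteq> (\<Union>l\<in>{i..<r}. inner (\<mu> l))"
        "f \<subseteq> (\<Union>l\<in>{i..<r}. inner (\<mu> l))" "e \<inter> inner (\<mu> i) \<noteq> {}" "f \<inter> inner (\<mu> i) \<noteq> {}"
        "e \<inter> inner (\<mu> j) \<noteq> {}" "f \<inter> inner (\<mu> j) \<noteq> {}" for i j e f
        using systemD(6)[OF sys \<mu> that] by blast
    qed blast
    let ?U = "V0 - (\<Union>l\<in>{..i}. total (W l) (A l))"
    have "e - inner (\<mu> i) \<subseteq> ?U" "f - inner (\<mu> i) \<subseteq> ?U"
      using rest[OF \<mu> ief(1) ief(5) R(1)] rest[OF \<mu> ief(1) ief(6) R(1)] by auto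
    then have ef: "e \<subseteq> inner (\<mu> i) \<union> ?U" "f \<subseteq> inner (\<mu> i) \<union> ?U" by auto
    have RU: "R \<subseteq> ?U" using R(1) ief(1) by (auto simp: leftover_def)
    have "w i + 2 * k \<le> card R" using R(3) wmono[OF ief(1)] by simp
    then have "e \<inter> f \<noteq> {}"
      using separatedD[OF S(5)[OF ief(1) \<mu>[OF ief(1)]] R(2) _ RU ief(2,3) ef ief(7-10)] by blast
    then show False using ief(4) by simp
  qed
  ultimately show ?thesis using that by blast
qed

text \<open>The upward counterpart of \<open>cyc_below\<close>: a cycle shorter than
  \<open>n\<close> that can be lengthened by every number of steps up to \<open>T\<close> would hit
  \<open>n\<close> before passing it.\<close>

lemma cyc_below_steps:
  assumes "\<And>t. t \<le> T \<Longrightarrow> \<exists>X. cyc X \<and> X \<subseteq> V0 \<and> card X = D + (k - 1) * t" "D < n" "(k - 1) dvd D"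
  shows "D + (k - 1) * T < n"
proof (rule ccontr)
  assume "\<not> ?thesis"
  have "(k - 1) dvd (n - D)" using dvd_n assms(3) by (simp add: dvd_diff_nat)
  then obtain t where t: "n - D = (k - 1) * t" by auto
  have "(k - 1) * t \<le> (k - 1) * T" using assms(2) t \<open>\<not> _\<close> by linarith
  then have "t \<le> T" using k3 by simp
  then obtain X where "cyc X" "X \<subseteq> V0" "card X = D + (k - 1) * t" using assms(1) by blast
  then show False using no_cycle[of X] t assms(2) by linarith
qed

text \<open>The clique \<open>R\<close> is inserted into the mark of cycle \<open>i\<close> through
  the disjoint edges \<open>e\<close> and \<open>f\<close>. These edges may also use vertices of the
  chosen marks of other cycles, which are rerouted around them. The segment through \<open>R\<close>
  is long enough for the gain of cycle \<open>i\<close> to exceed the total loss of the others. All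
  chosen marks become fixed segments, so every cycle pays one. In the size of \<open>R\<close>, the
  summand \<open>m + (r + 1)\<^sup>2 * k\<close> serves \<open>crossing_pair\<close> and
  \<open>2 * k\<close> the removal of \<open>e \<union> f\<close>.\<close>

lemma system_step:
  assumes sys: "system w (Suc s) W A" and w: "\<And>i. w i = (k - 1) * q i + 1"
    and q: "\<And>i. m + (r + 1)\<^sup>2 * k + 2 \<le> q i" "\<And>i. 2 * r + 20 \<le> q i"
    and Z: "ES k m ((k - 1) * (2 * r + 2) + 1 + 2 * k + m + (r + 1)\<^sup>2 * k) \<le> card (leftover W A)"
  obtains W' A' where "system w s W' A'" "card (leftover W' A') < card (leftover W A)"
proof -
  note S = systemD[OF sys]
  have wi: "q i \<le> w i" for i
    using mult_le_mono1[of 1 "k - 1" "q i"] w(1)[of i] k3 by linarith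
  have w4: "4 \<le> w i" for i using wi[of i] q(2)[of i] by linarith
  have fL: "leftover W A \<subseteq> V0" by (auto simp: leftover_def)
  obtain R where R: "R \<subseteq> leftover W A" "clq R" "card R = (k - 1) * (2 * r + 2) + 1 + 2 * k + m + (r + 1)\<^sup>2 * k"
    using ramsey[OF fL Z] by blast
  have "\<forall>l. \<exists>\<mu>. l < r \<longrightarrow> \<mu> \<in> A l"
    using S(3) by (metis card.empty ex_in_conv nat.distinct(1))
  then obtain \<mu> where \<mu>: "\<And>l. l < r \<Longrightarrow> \<mu> l \<in> A l" by metis
  have mk: "mark (w l) (\<mu> l)" if "l < r" for l using clumpD(3)[OF S(1)[OF that] \<mu>[OF that]] .
  have bdT: "bd (\<mu> l) \<subseteq> total (W l) (A l)" if "l < r" for l using \<mu>[OF that] by (auto simp: total_def)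
  note mi = mark_inner[OF mk w4]
  have RT: "R \<inter> total (W l) (A l) = {}" if "l < r" for l using R(1) that by (auto simp: leftover_def)
  have innd: "inner (\<mu> l) \<inter> total (W j) (A j) = {}" if "l < r" "j < r" "l \<noteq> j" for l j
    using mi(2)[OF that(1)] bdT[OF that(1)] S(5)[OF that] by blast
  obtain i e f where ief: "i < r" "redge e" "redge f" "e \<inter> f = {}"
      "e \<subseteq> (\<Union>l\<in>{i..<r}. inner (\<mu> l)) \<union> R" "f \<subseteq> (\<Union>l\<in>{i..<r}. inner (\<mu> l)) \<union> R"
      "e \<inter> inner (\<mu> i) \<noteq> {}" "f \<inter> inner (\<mu> i) \<noteq> {}" "e \<inter> R \<noteq> {}" "f \<inter> R \<noteq> {}"
  proof (rule crossing_pair[of "\<lambda>l. inner (\<mu> l)" R])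
    show "inner (\<mu> l) \<subseteq> V0 \<and> m + (r + 1)\<^sup>2 * k \<le> card (inner (\<mu> l))" if "l < r" for l
      using mi(1,2)[OF that] bdT[OF that] S(2)[OF that] wi[of l] q(1)[of l] by auto
    show "inner (\<mu> l) \<inter> inner (\<mu> j) = {}" if "l < r" "j < r" "l \<noteq> j" for l j
      using innd[OF that] mi(2)[OF that(2)] bdT[OF that(2)] by blast
    show "R \<subseteq> V0" using R fL by auto
    show "m + (r + 1)\<^sup>2 * k \<le> card R" using R(3) by simp
    show "R \<inter> inner (\<mu> l) = {}" if "l < r" for l using RT[OF that] mi(2)[OF that] bdT[OF that] by blast
    show "e \<inter> f \<noteq> {}" if "i < j" "j < r" "redge e" "redge f" "e \<subseteq> (\<Union>l\<in>{i..<r}. inner (\<mu> l))"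
        "f \<subseteq> (\<Union>l\<in>{i..<r}. inner (\<mu> l))" "e \<inter> inner (\<mu> i) \<noteq> {}" "f \<inter> inner (\<mu> i) \<noteq> {}"
        "e \<inter> inner (\<mu> j) \<noteq> {}" "f \<inter> inner (\<mu> j) \<noteq> {}" for i j e f
      using S(6)[OF \<mu> that] by blast
  qed blast
  define B where "B = e \<union> f"
  have B: "finite B" "B \<subseteq> (\<Union>l<r. inner (\<mu> l)) \<union> R" "card B \<le> 2 * k"
  proof -
    show "finite B" using redgeD(2)[OF ief(2)] redgeD(2)[OF ief(3)] by (simp add: B_def)
    have sub: "(\<Union>l\<in>{i..<r}. inner (\<mu> l)) \<union> R \<subseteq> (\<Union>l<r. inner (\<mu> l)) \<union> R"
      by (intro Un_mono UN_mono) auto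
    show "B \<subseteq> (\<Union>l<r. inner (\<mu> l)) \<union> R"
      unfolding B_def by (intro Un_least order_trans[OF ief(5) sub] order_trans[OF ief(6) sub])
    show "card B \<le> 2 * k"
      using card_Un_le[of e f] redgeD(1)[OF ief(2)] redgeD(1)[OF ief(3)] by (simp add: B_def)
  qed
  have BT: "B \<inter> total (W l) (A l) \<subseteq> inner (\<mu> l)" if "l < r" for l
  proof
    fix x assume x: "x \<in> B \<inter> total (W l) (A l)"
    then have "x \<notin> R" using RT[OF that] by auto
    then obtain j where "j < r" "x \<in> inner (\<mu> j)" using B x by auto
    then show "x \<in> inner (\<mu> l)" using innd[of j l] that x by (cases "j = l") auto
  qed
  obtain u v u' v' where u: "u \<in> e" "u \<in> inner (\<mu> i)" "v \<in> e" "v \<in> R" "u' \<in> f" "u' \<in> inner (\<mu> i)" "v' \<in> f" "v' \<in> R"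
    using ief by blast
  have vv: "v \<noteq> v'" and uu: "u \<noteq> u'" using u ief(4) by auto
  have Bbd: "card (B \<inter> bd (\<mu> l)) \<le> 2 * (k - 1)" if "l < r" for l
  proof -
    have "B \<inter> bd (\<mu> l) \<subseteq> B - {v, v'}" using RT[OF that] bdT[OF that] u by auto
    then have "card (B \<inter> bd (\<mu> l)) \<le> card (B - {v, v'})" using B(1) by (intro card_mono) auto
    also have "\<dots> = card B - 2" using vv u by (subst card_Diff_subset) (auto simp: B_def)
    finally show ?thesis using B(3) k3 by linarith
  qed
  have bd_card: "w l \<le> card (bd (\<mu> l) - X) + card (X \<inter> bd (\<mu> l))" if "l < r" for l X
  proof -
    have "card (bd (\<mu> l)) = card (bd (\<mu> l) \<inter> X) + card (bd (\<mu> l) - X)"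
      using mi(4)[OF that] by (metis card_Int_Diff)
    then show ?thesis using mk[OF that] by (simp add: mark_def Int_commute)
  qed
  have ends: "st (\<mu> l) \<in> bd (\<mu> l)" "en (\<mu> l) \<in> bd (\<mu> l)" "st (\<mu> l) \<noteq> en (\<mu> l)" "clq (bd (\<mu> l))"
      "st (\<mu> l) \<notin> B" "en (\<mu> l) \<notin> B" if "l < r" for l
    using mk[OF that] BT[OF that] bdT[OF that] by (auto simp: mark_def inner_def)
  \<comment> \<open>As \<open>v\<close> and \<open>v'\<close> lie in \<open>R\<close>, at most
    \<open>2 * (k - 1)\<close> vertices of \<open>B\<close> lie in a mark. A path with two edges
    fewer can therefore avoid \<open>B\<close>.\<close>
  have shrink: "\<exists>Y. Y \<subseteq> bd (\<mu> l) - B \<and> card Y + 2 * (k - 1) = w l \<and> lpath Y (st (\<mu> l)) (en (\<mu> l))" if l: "l < r" for l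
  proof -
    have q2: "q l = (q l - 2) + 2" using q(2)[of l] by simp
    have "(k - 1) * q l = (k - 1) * (q l - 2) + 2 * (k - 1)"
      by (subst q2) (simp only: distrib_left mult.commute)
    then have w2: "w l = (k - 1) * (q l - 2) + 1 + 2 * (k - 1)" using w by simp
    have h6: "(k - 1) * (q l - 2) + 1 \<le> card (bd (\<mu> l) - B)" using bd_card[OF l, of B] Bbd[OF l] w2 by linarith
    have h2: "st (\<mu> l) \<in> bd (\<mu> l) - B" "en (\<mu> l) \<in> bd (\<mu> l) - B" using ends[OF l] by auto
    have h1: "clq (bd (\<mu> l) - B)" by (rule clq_subset[OF ends(4)[OF l]]) auto
    have h5: "1 \<le> q l - 2" using q(2)[of l] by simp
    obtain Y where "Y \<subseteq> bd (\<mu> l) - B" "card Y = (k - 1) * (q l - 2) + 1" "lpath Y (st (\<mu> l)) (en (\<mu> l))"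
      by (rule clq_lpath_ex[OF h1 h2 ends(3)[OF l] h5 h6])
    then show ?thesis using w2 by auto
  qed
  \<comment> \<open>\<open>L\<close> has to meet \<open>e\<close> in \<open>v\<close> only and
    \<open>f\<close> in \<open>v'\<close> only, so all other vertices of \<open>B\<close> are
    removed from \<open>R\<close>.\<close>
  define R' where "R' = insert v (insert v' (R - B))"
  have fR: "finite R" using R(2) by (simp add: clq_def)
  have "card R \<le> card (R - B) + card B" using diff_card_le_card_Diff[OF B(1), of R] by linarith
  moreover have "card (R - B) \<le> card R'" unfolding R'_def using fR by (intro card_mono) auto
  ultimately have cR': "(k - 1) * (2 * r + 2) + 1 \<le> card R'" using R(3) B(3) by linarith
  have "R' \<subseteq> R" using u by (auto simp: R'_def)
  then have "clq R'" "v \<in> R'" "v' \<in> R'" "1 \<le> 2 * r + 2" using clq_subset[OF R(2)] by (auto simp: R'_def)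
  then obtain L where L: "L \<subseteq> R'" "card L = (k - 1) * (2 * r + 2) + 1" "lpath L v v'"
    using vv cR' by (metis clq_lpath_ex)
  have vL: "v \<in> L" "v' \<in> L" using lpathD[OF L(3)] by auto
  define G where "G = e \<union> L \<union> f"
  have Lef: "e \<inter> L = {v}" "(e \<union> L) \<inter> f = {v'}" using L(1) vL u ief(4) unfolding R'_def B_def by blast+
  have uv: "u \<noteq> v" "u' \<noteq> v'" using u RT[OF ief(1)] mi(2)[OF ief(1)] bdT[OF ief(1)] by blast+
  have lp: "lpath e u v" "lpath f v' u'" using ief u uv by (auto intro: lpath.edge)
  have "lpath (e \<union> L) u v'" using lpath_append[OF L(3) lp(1) Lef(1)] .
  then have lG: "lpath G u u'" using lpath_append[OF lp(2) _ Lef(2)] unfolding G_def by blast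
  have GB: "G \<subseteq> B \<union> R" using L(1) u unfolding G_def B_def R'_def by auto
  have cG: "card G = (k - 1) * (2 * r + 4) + 1"
  proof -
    have "card (e \<union> L) + 1 = card e + card L"
      using card_Un_Int[of e L] Lef(1) redgeD ief lpathD[OF L(3)] by simp
    moreover have "card G + 1 = card (e \<union> L) + card f"
      using card_Un_Int[of "e \<union> L" f] Lef(2) redgeD ief lpathD[OF L(3)] by (simp add: G_def)
    moreover have "(k - 1) * (2 * r + 4) = (k - 1) * (2 * r + 2) + 2 * (k - 1)"
      by (simp add: algebra_simps)
    ultimately show ?thesis using L(2) redgeD(1)[OF ief(2)] redgeD(1)[OF ief(3)] k3 by linarith
  qed
  have GT: "G \<inter> total (W i) (A i) \<subseteq> inner (\<mu> i)" using GB BT[OF ief(1)] RT[OF ief(1)] by blast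
  have "G \<inter> bd (\<mu> i) \<subseteq> B \<inter> bd (\<mu> i)" using GB RT[OF ief(1)] bdT[OF ief(1)] by blast
  then have cGb: "card (G \<inter> bd (\<mu> i)) \<le> 2 * (k - 1)"
    using Bbd[OF ief(1)] card_mono[of "B \<inter> bd (\<mu> i)" "G \<inter> bd (\<mu> i)"] B(1) by simp
  define wi' where "wi' = (k - 1) * q i"
  have qi: "(k - 1) * (2 * r + 20) \<le> wi'" unfolding wi'_def using q(2) by (intro mult_le_mono2)
  have q20: "(k - 1) * (2 * r + 20) = (k - 1) * (2 * r + 4) + 16 * (k - 1)"
    by (simp add: algebra_simps)
  have wiw: "w i = wi' + 1" using w wi'_def by simp
  \<comment> \<open>\<open>G\<close> has \<open>2 * r + 4\<close> edges and shares at most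
    \<open>2 * (k - 1)\<close> vertices with the mark, so there is room for every extension by up to
    \<open>2 * r\<close> steps. All of them are needed to apply
    \<open>cyc_below_steps\<close>.\<close>
  have grow: "\<exists>Y. lpath Y (st (\<mu> i)) (en (\<mu> i)) \<and> Y \<subseteq> bd (\<mu> i) \<union> G \<and> card Y = w i + (k - 1) * t" if t: "t \<le> 2 * r" for t
  proof -
    have ex: "(k - 1) * (q i + t) + 1 = wi' + (k - 1) * t + 1" unfolding wi'_def by (simp only: distrib_left)
    have t2: "(k - 1) * t \<le> (k - 1) * (2 * r)" using t by (intro mult_le_mono2)
    have r4: "(k - 1) * (2 * r + 4) = (k - 1) * (2 * r) + 4 * (k - 1)" by (simp only: distrib_left mult.commute)
    have "\<exists>Y. lpath Y (st (\<mu> i)) (en (\<mu> i)) \<and> Y \<subseteq> bd (\<mu> i) \<union> \<Union>(fst ` {(G, u, u')}) \<and> card Y = (k - 1) * (q i + t) + 1"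
    proof (rule gadget_chain)
      show "clq (bd (\<mu> i))" "st (\<mu> i) \<in> bd (\<mu> i)" "en (\<mu> i) \<in> bd (\<mu> i)" "st (\<mu> i) \<noteq> en (\<mu> i)"
        using ends[OF ief(1)] by auto
      show "lpath G' y z \<and> y \<in> bd (\<mu> i) \<and> z \<in> bd (\<mu> i) \<and> st (\<mu> i) \<notin> G' \<and> en (\<mu> i) \<notin> G'"
        if "(G', y, z) \<in> {(G, u, u')}" for G' y z
        using that lG u mi(2)[OF ief(1)] GT bdT[OF ief(1)] ends[OF ief(1)] by (auto simp: inner_def)
      show "fst g \<inter> fst h = {}" if "g \<in> {(G, u, u')}" "h \<in> {(G, u, u')}" "g \<noteq> h" for g h
        using that by auto
      have "w i \<le> card (bd (\<mu> i) - G) + 2 * (k - 1)" using bd_card[OF ief(1), of G] cGb by linarith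
      then show "(k - 2) * (card {(G, u, u')} + 1) + 2 \<le> card (bd (\<mu> i) - \<Union>(fst ` {(G, u, u')}))"
        using qi q20 wiw k3 by simp
      show "card (\<Union>(fst ` {(G, u, u')})) + 2 + (k - 2) * (card {(G, u, u')} + 1) \<le> (k - 1) * (q i + t) + 1"
        unfolding ex using qi q20 cG k3 by simp
      have "card (bd (\<mu> i) \<union> G) = card (bd (\<mu> i) - G) + card G"
        using mi(4)[OF ief(1)] lpathD[OF lG] card_Un_disjoint[of "bd (\<mu> i) - G" G]
        by (simp add: Un_Diff_cancel2 Diff_disjoint Int_commute)
      then have "wi' + (k - 1) * t + 1 \<le> card (bd (\<mu> i) \<union> G)"
        using bd_card[OF ief(1), of G] cGb cG wiw t2 r4 by linarith
      then show "(k - 1) * (q i + t) + 1 \<le> card (bd (\<mu> i) \<union> \<Union>(fst ` {(G, u, u')}))"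
        unfolding ex by simp
    qed simp
    then show ?thesis using ex wiw by (auto simp: add_ac)
  qed
  note fixed = clump_reroute[OF S(1) \<mu>]
  have GV: "G \<subseteq> V0"
  proof -
    have "inner (\<mu> l) \<subseteq> V0" if "l < r" for l using mi(2)[OF that] bdT[OF that] S(2)[OF that] by blast
    then show ?thesis using GB B(2) R(1) fL by blast
  qed
  have Yi: "Y \<inter> total (W i) (A i) \<subseteq> bd (\<mu> i)" if "Y \<subseteq> bd (\<mu> i) \<union> G" for Y
    using that GT mi(2)[OF ief(1)] by blast
  have q1: "1 \<le> q i" for i using q(2)[of i] by simp
  have lt: "card (total (W i) (A i)) + (k - 1) * (2 * r) < n"
  proof (rule cyc_below_steps)
    show "card (total (W i) (A i)) < n" using S(4)[OF ief(1)] .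
    show "(k - 1) dvd card (total (W i) (A i))" using cyc_card clump_cyc[OF S(1)[OF ief(1)] w q1] by blast
    fix t assume "t \<le> 2 * r"
    then obtain Y where Y: "lpath Y (st (\<mu> i)) (en (\<mu> i))" "Y \<subseteq> bd (\<mu> i) \<union> G" "card Y = w i + (k - 1) * t"
      using grow by blast
    note F = fixed[OF ief(1) ief(1) Y(1) Yi[OF Y(2)]]
    have "total (W i \<union> Y) (A i - {\<mu> i}) \<subseteq> V0"
      unfolding F(2) using S(2)[OF ief(1)] Y(2) GV bdT[OF ief(1)] by blast
    moreover have "card (total (W i \<union> Y) (A i - {\<mu> i})) = card (total (W i) (A i)) + (k - 1) * t"
      using F(3) Y(3) by simp
    ultimately show "\<exists>X. cyc X \<and> X \<subseteq> V0 \<and> card X = card (total (W i) (A i)) + (k - 1) * t"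
      using clump_cyc[OF F(1) w q1] by blast
  qed
  obtain Yi where Yi': "lpath Yi (st (\<mu> i)) (en (\<mu> i))" "Yi \<subseteq> bd (\<mu> i) \<union> G" "card Yi = w i + (k - 1) * (2 * r)"
    using grow[of "2 * r"] by blast
  have "\<forall>l. \<exists>Y. l < r \<longrightarrow> Y \<subseteq> bd (\<mu> l) - B \<and> card Y + 2 * (k - 1) = w l \<and> lpath Y (st (\<mu> l)) (en (\<mu> l))"
    using shrink by blast
  then obtain Y0 where Y0: "\<And>l. l < r \<Longrightarrow> Y0 l \<subseteq> bd (\<mu> l) - B" "\<And>l. l < r \<Longrightarrow> card (Y0 l) + 2 * (k - 1) = w l"
      "\<And>l. l < r \<Longrightarrow> lpath (Y0 l) (st (\<mu> l)) (en (\<mu> l))"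
    by metis
  define Y where "Y = Y0(i := Yi)"
  define W' where "W' l = W l \<union> Y l" for l
  define A' where "A' l = A l - {\<mu> l}" for l
  have Yp: "lpath (Y l) (st (\<mu> l)) (en (\<mu> l))" "Y l \<inter> total (W l) (A l) \<subseteq> bd (\<mu> l)" if "l < r" for l
    using Y0[OF that] Yi' Yi[OF Yi'(2)] unfolding Y_def by (cases "l = i"; auto)+
  have F: "clump (w l) (W' l) (A' l)" "total (W' l) (A' l) = (total (W l) (A l) - bd (\<mu> l)) \<union> Y l"
      "card (total (W' l) (A' l)) + w l = card (total (W l) (A l)) + card (Y l)" if "l < r" for l
    using fixed[OF that that Yp[OF that]] unfolding W'_def A'_def by auto
  have Toth: "total (W' l) (A' l) \<subseteq> total (W l) (A l) - B" if "l < r" "l \<noteq> i" for l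
  proof -
    have "Y l = Y0 l" using that by (simp add: Y_def)
    then show ?thesis using F(2)[OF that(1)] Y0(1)[OF that(1)] bdT[OF that(1)] BT[OF that(1)] mi(2)[OF that(1)] by blast
  qed
  have Ti: "total (W' i) (A' i) \<subseteq> total (W i) (A i) \<union> B \<union> R"
    using F(2)[OF ief(1)] Yi'(2) GB bdT[OF ief(1)] unfolding Y_def by auto
  have coth: "card (total (W' l) (A' l)) + 2 * (k - 1) = card (total (W l) (A l))" if "l < r" "l \<noteq> i" for l
    using F(3)[OF that(1)] Y0(2)[OF that(1)] that(2) by (simp add: Y_def)
  have ci: "card (total (W' i) (A' i)) = card (total (W i) (A i)) + (k - 1) * (2 * r)"
    using F(3)[OF ief(1)] Yi'(3) by (simp add: Y_def)
  have dj: "total (W' i) (A' i) \<inter> total (W' l) (A' l) = {}" if "l < r" "l \<noteq> i" for l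
    using Ti Toth[OF that] S(5)[OF ief(1) that(1)] RT[OF that(1)] that by blast
  have sys': "system w s W' A'"
    unfolding system_def
  proof (intro conjI allI impI)
    fix l assume l: "l < r"
    show "clump (w l) (W' l) (A' l)" using F(1)[OF l] .
    show "total (W' l) (A' l) \<subseteq> V0"
    proof (cases "l = i")
      case True
      have "total (W i) (A i) \<union> Yi \<subseteq> V0" using S(2)[OF ief(1)] Yi'(2) GV bdT[OF ief(1)] by blast
      then show ?thesis using F(2)[OF l] True unfolding Y_def by auto
    next
      case False then show ?thesis using Toth[OF l] S(2)[OF l] by blast
    qed
    show "card (A' l) = s" using S(3)[OF l] \<mu>[OF l] clumpD(2)[OF S(1)[OF l]] by (simp add: A'_def)
    show "card (total (W' l) (A' l)) < n"
      using ci lt coth[OF l] S(4)[OF l] by (cases "l = i") auto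
    fix j assume j: "j < r" "l \<noteq> j"
    consider "l = i" | "j = i" | "l \<noteq> i" "j \<noteq> i" by blast
    then show "total (W' l) (A' l) \<inter> total (W' j) (A' j) = {}"
    proof cases
      case 1 then show ?thesis using dj[of j] j by auto
    next
      case 2 then show ?thesis using dj[of l] l j by auto
    next
      case 3 then show ?thesis using Toth[OF l] Toth[OF j(1)] S(5)[OF l j] by blast
    qed
  next
    fix \<nu> i j e f
    assume H: "(\<forall>l<r. \<nu> l \<in> A' l) \<and> i < j \<and> j < r \<and> redge e \<and> redge f
        \<and> e \<subseteq> (\<Union>l\<in>{i..<r}. inner (\<nu> l)) \<and> f \<subseteq> (\<Union>l\<in>{i..<r}. inner (\<nu> l))
        \<and> e \<inter> inner (\<nu> i) \<noteq> {} \<and> f \<inter> inner (\<nu> i) \<noteq> {}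
        \<and> e \<inter> inner (\<nu> j) \<noteq> {} \<and> f \<inter> inner (\<nu> j) \<noteq> {}"
    then have "\<And>l. l < r \<Longrightarrow> \<nu> l \<in> A l" by (auto simp: A'_def)
    then show "e \<inter> f \<noteq> {}" using S(6)[of \<nu> i j e f] H by blast
  qed
  \<comment> \<open>Cycle \<open>i\<close> gains \<open>2 * r * (k - 1)\<close> vertices, while each
    of the \<open>r - 1\<close> other cycles loses only \<open>2 * (k - 1)\<close>.\<close>
  have "(\<Sum>l<r. card (total (W l) (A l))) < (\<Sum>l<r. card (total (W' l) (A' l)))"
  proof -
    have sp: "(\<Sum>l<r. g l) = g i + (\<Sum>l\<in>{..<r} - {i}. g l)" for g :: "nat \<Rightarrow> nat"
      using ief(1) by (intro sum.remove) auto
    have "(\<Sum>l\<in>{..<r} - {i}. card (total (W l) (A l))) = (\<Sum>l\<in>{..<r} - {i}. card (total (W' l) (A' l)) + 2 * (k - 1))"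
      using coth by (intro sum.cong) auto
    also have "\<dots> = (\<Sum>l\<in>{..<r} - {i}. card (total (W' l) (A' l))) + (r - 1) * (2 * (k - 1))"
      using ief(1) by (simp add: sum.distrib)
    finally have 1: "(\<Sum>l\<in>{..<r} - {i}. card (total (W l) (A l)))
      = (\<Sum>l\<in>{..<r} - {i}. card (total (W' l) (A' l))) + (r - 1) * (2 * (k - 1))" .
    obtain r' where r': "r = Suc r'" using ief(1) by (cases r) auto
    have "(r - 1) * (2 * (k - 1)) < (k - 1) * (2 * r)" using k3 unfolding r' by (simp add: algebra_simps)
    then show ?thesis using 1 ci sp[of "\<lambda>l. card (total (W l) (A l))"] sp[of "\<lambda>l. card (total (W' l) (A' l))"] by linarith
  qed
  then have "card (leftover W' A') < card (leftover W A)"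
    using card_leftover[OF sys'] card_leftover[OF sys] by linarith
  then show ?thesis using that sys' by blast
qed

text \<open>Each step costs one mark per cycle and removes at least one leftover vertex. Hence
  \<open>card (leftover W A) < s\<close> is an invariant, and the marks cannot run out above the
  threshold.\<close>

lemma small_leftover_system:
  assumes w: "\<And>i. w i = (k - 1) * q i + 1"
    and q: "\<And>i. m + (r + 1)\<^sup>2 * k + 2 \<le> q i" "\<And>i. 2 * r + 20 \<le> q i"
  shows "\<lbrakk>system w s W A; card (leftover W A) < s\<rbrakk> \<Longrightarrow> \<exists>s' W' A'. 1 \<le> s' \<and> system w s' W' A'
    \<and> card (leftover W' A') < ES k m ((k - 1) * (2 * r + 2) + 1 + 2 * k + m + (r + 1)\<^sup>2 * k)"
proof (induction s arbitrary: W A)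
  case 0
  then show ?case by simp
next
  case (Suc s)
  show ?case
  proof (cases "card (leftover W A) < ES k m ((k - 1) * (2 * r + 2) + 1 + 2 * k + m + (r + 1)\<^sup>2 * k)")
    case True
    then show ?thesis using Suc.prems by (intro exI[of _ "Suc s"]) auto
  next
    case False
    then obtain W' A' where "system w s W' A'" "card (leftover W' A') < card (leftover W A)"
      using system_step[OF Suc.prems(1) w q] by (metis not_less)
    then show ?thesis using Suc.IH[of W' A'] Suc.prems(2) by simp
  qed
qed

end

section \<open>Absorbing leftover vertices\<close>

text \<open>Cycle \<open>i\<close> now consists of a fixed part \<open>W i\<close> and a single
  clique \<open>K i\<close> crossed from \<open>a i\<close> to \<open>b i\<close>. In the bound on
  \<open>q\<close>, \<open>m + 2 ^ z\<close> leaves a part of size \<open>m\<close> after bad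
  vertices are discarded, \<open>(r choose 2) * (2 * k)\<close> pays for destroying connections, and
  the remaining terms are generous room for detours. The last assumption is the negation of the
  bound to be proved.\<close>

locale absorption = blue_free k red V0 n r m \<sigma>
  for k :: nat and red :: "'v set \<Rightarrow> bool" and V0 :: "'v set" and n r m \<sigma> :: nat +
  fixes W K :: "nat \<Rightarrow> 'v set" and a b :: "nat \<Rightarrow> 'v" and q :: "nat \<Rightarrow> nat" and Z :: "'v set" and z :: nat
  assumes K: "\<And>i. i < r \<Longrightarrow> clq (K i)" "\<And>i. i < r \<Longrightarrow> card (K i) = (k - 1) * q i + 1"
      "\<And>i. i < r \<Longrightarrow> a i \<in> K i" "\<And>i. i < r \<Longrightarrow> b i \<in> K i" "\<And>i. i < r \<Longrightarrow> a i \<noteq> b i"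
    and W: "\<And>i. i < r \<Longrightarrow> W i \<inter> K i = {}" "\<And>i. i < r \<Longrightarrow> W i \<union> K i \<subseteq> V0"
      "\<And>i. i < r \<Longrightarrow> card (W i \<union> K i) < n" "\<And>i. i < r \<Longrightarrow> (k - 1) dvd card (W i \<union> K i)"
      "\<And>i j. \<lbrakk>i < r; j < r; i \<noteq> j\<rbrakk> \<Longrightarrow> (W i \<union> K i) \<inter> (W j \<union> K j) = {}"
    and Z: "Z = V0 - (\<Union>i<r. W i \<union> K i)" "card Z \<le> z"
    and reroute: "\<And>i Y. \<lbrakk>i < r; lpath Y (a i) (b i); Y \<inter> W i = {}; Y \<subseteq> V0\<rbrakk> \<Longrightarrow> card (W i) + card Y \<noteq> n"
    and q: "\<And>i. m + (r choose 2) * (2 * k) + 10 * (k * k) + 10 * (k * z) + 10 * k + 2 ^ z \<le> q i"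
    and card_V0: "r * (n - 1) + (r choose 2) * (2 * k) + tau (k - 1) \<sigma> + 1 \<le> card V0"
begin

definition core :: "nat \<Rightarrow> 'v set" where "core i = K i - {a i, b i}"
text \<open>The vertices that detours and connections may use. The fixed parts of the cycles and the
  ends of the marks are kept out, so that a detour can always be threaded into its mark.\<close>

definition arena :: "'v set" where "arena = Z \<union> (\<Union>i<r. core i)"

lemma Z_V0: "Z \<subseteq> V0" "finite Z" "\<And>i. i < r \<Longrightarrow> Z \<inter> (W i \<union> K i) = {}"
  using Z(1) finite_V0 finite_subset by auto

lemma fin_WK: "i < r \<Longrightarrow> finite (W i)" "i < r \<Longrightarrow> finite (K i)"
  using W(2)[of i] finite_V0 finite_subset by auto

lemma core_K: "core i \<subseteq> K i" "i < r \<Longrightarrow> a i \<notin> core i" "i < r \<Longrightarrow> b i \<notin> core i"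
  by (auto simp: core_def)

lemma core_disjoint: "\<lbrakk>i < r; j < r; i \<noteq> j\<rbrakk> \<Longrightarrow> core i \<inter> (W j \<union> K j) = {}"
  using W(5)[of i j] core_K(1)[of i] by blast

lemma arena_Int: "i < r \<Longrightarrow> arena \<inter> (W i \<union> K i) \<subseteq> core i"
proof
  fix x assume i: "i < r" and x: "x \<in> arena \<inter> (W i \<union> K i)"
  then have "x \<notin> Z" using Z_V0(3)[OF i] by auto
  then obtain j where j: "j < r" "x \<in> core j" using x by (auto simp: arena_def)
  then show "x \<in> core i" using core_disjoint[of j i] i x by (cases "j = i") auto
qed

lemma arena_V0: "arena \<subseteq> V0"
  using Z_V0 W(2) core_K(1) unfolding arena_def by blast

lemma q_bounds:
  "m + (r choose 2) * (2 * k) + 10 * (k * k) + 10 * (k * z) + 10 * k + 2 ^ z \<le> (k - 1) * q i"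
  using q[of i] mult_le_mono1[of 1 "k - 1" "q i"] k3 by linarith

lemma card_core: "i < r \<Longrightarrow> card (core i) + 2 = card (K i)"
  unfolding core_def using K[of i] fin_WK[of i] q_bounds[of i] k3
  by (subst card_Diff_subset) auto

lemma card_V0_eq: "card V0 = card Z + (\<Sum>i<r. card (W i \<union> K i))"
proof -
  have "card (\<Union>i<r. W i \<union> K i) = (\<Sum>i<r. card (W i \<union> K i))"
    using fin_WK W(5) by (intro card_UN_disjoint) auto
  moreover have "(\<Union>i<r. W i \<union> K i) \<subseteq> V0" using W(2) by blast
  ultimately show ?thesis
    unfolding Z(1) using card_Diff_subset[of "\<Union>i<r. W i \<union> K i" V0]
      card_mono[OF finite_V0, of "\<Union>i<r. W i \<union> K i"] finite_subset[OF _ finite_V0] by simp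
qed

text \<open>The other cycles have at most \<open>n - 1\<close> vertices each, so the size of
  \<open>V0\<close> leaves cycle \<open>l\<close> at most \<open>card Z\<close> vertices short of
  \<open>n\<close>.\<close>

lemma card_clump_large:
  assumes "l < r" shows "n \<le> card (W l \<union> K l) + card Z"
proof -
  have "(\<Sum>i<r. card (W i \<union> K i)) = card (W l \<union> K l) + (\<Sum>i\<in>{..<r} - {l}. card (W i \<union> K i))"
    using assms by (intro sum.remove) auto
  moreover have "(\<Sum>i\<in>{..<r} - {l}. card (W i \<union> K i)) \<le> (\<Sum>i\<in>{..<r} - {l}. n - 1)"
    using W(3) by (intro sum_mono) fastforce
  moreover have "(\<Sum>i\<in>{..<r} - {l}. n - 1) = (r - 1) * (n - 1)" using assms by simp
  moreover have "r * (n - 1) = (r - 1) * (n - 1) + (n - 1)" using assms by (cases r) auto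
  ultimately show ?thesis using card_V0 card_V0_eq by linarith
qed

text \<open>If the cycle together with its detours reached \<open>n\<close> vertices,
  \<open>gadget_chain\<close> would yield a path through all detours of exactly the right size;
  \<open>t\<close> is the number of edges by which the mark's path must grow.\<close>

lemma no_gadgets:
  assumes l: "l < r" and "finite \<Gamma>"
    and G: "\<And>G y y'. (G, y, y') \<in> \<Gamma> \<Longrightarrow> lpath G y y' \<and> y \<in> core l \<and> y' \<in> core l \<and> G \<subseteq> arena"
    and disj: "\<And>g h. \<lbrakk>g \<in> \<Gamma>; h \<in> \<Gamma>; g \<noteq> h\<rbrakk> \<Longrightarrow> fst g \<inter> fst h = {}"
    and room: "(k - 2) * (card \<Gamma> + 1) + 2 \<le> card (K l - \<Union>(fst ` \<Gamma>))"
      "card (\<Union>(fst ` \<Gamma>)) + 2 + (k - 2) * (card \<Gamma> + 1) \<le> (k - 1) * q l"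
  shows "card (W l) + card (K l \<union> \<Union>(fst ` \<Gamma>)) < n"
proof (rule ccontr)
  assume no: "\<not> ?thesis"
  have cWK: "card (W l \<union> K l) = card (W l) + ((k - 1) * q l + 1)"
    using K(2)[OF l] W(1)[OF l] fin_WK[OF l] by (subst card_Un_disjoint) auto
  have "(k - 1) dvd (n - card (W l \<union> K l))" using dvd_n W(4)[OF l] by (simp add: dvd_diff_nat)
  then obtain t where t: "n - card (W l \<union> K l) = (k - 1) * t" by auto
  have ex: "(k - 1) * (q l + t) + 1 = (k - 1) * q l + (k - 1) * t + 1" by (simp only: distrib_left)
  have nt: "n = card (W l) + ((k - 1) * (q l + t) + 1)"
    using t W(3)[OF l] cWK ex by linarith
  have aA: "a l \<notin> arena" "b l \<notin> arena"
    using arena_Int[OF l] core_K(2,3)[OF l] K(3,4)[OF l] by auto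
  have "\<exists>Y. lpath Y (a l) (b l) \<and> Y \<subseteq> K l \<union> \<Union>(fst ` \<Gamma>) \<and> card Y = (k - 1) * (q l + t) + 1"
  proof (rule gadget_chain[OF assms(2) K(1,3,4,5)[OF l] _ disj room(1)])
    show "lpath G y y' \<and> y \<in> K l \<and> y' \<in> K l \<and> a l \<notin> G \<and> b l \<notin> G" if "(G, y, y') \<in> \<Gamma>" for G y y'
      using assms(3)[OF that] core_K(1)[of l] aA by auto
    show "card (\<Union>(fst ` \<Gamma>)) + 2 + (k - 2) * (card \<Gamma> + 1) \<le> (k - 1) * (q l + t) + 1"
      using room(2) ex by linarith
    show "(k - 1) * (q l + t) + 1 \<le> card (K l \<union> \<Union>(fst ` \<Gamma>))" using no nt by linarith
  qed
  then obtain Y where Y: "lpath Y (a l) (b l)" "Y \<subseteq> K l \<union> \<Union>(fst ` \<Gamma>)" "card Y = (k - 1) * (q l + t) + 1"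
    by blast
  have GA: "\<Union>(fst ` \<Gamma>) \<subseteq> arena" using G by fastforce
  have "Y \<inter> W l = {}" using Y(2) GA arena_Int[OF l] core_K(1)[of l] W(1)[OF l] by blast
  moreover have "Y \<subseteq> V0" using Y(2) GA arena_V0 W(2)[OF l] by blast
  ultimately show False using reroute[OF l Y(1)] Y(3) nt by simp
qed

section \<open>Connections between the marks of two cycles\<close>

definition connection :: "nat \<Rightarrow> nat \<Rightarrow> 'v set \<Rightarrow> bool" where
  "connection i j p \<longleftrightarrow> p \<subseteq> arena \<and> card p \<le> 2 * k \<and> (\<exists>u\<in>core i. \<exists>v\<in>core j. lpath p u v)"

text \<open>Two disjoint connections together with a long path inside \<open>core j\<close> form a
  detour of cycle \<open>i\<close> that adds more than \<open>z\<close> vertices, enough to reach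
  \<open>n\<close>. Cycle \<open>j\<close> is sacrificed; a single cycle on \<open>n\<close>
  vertices suffices. The size bound in \<open>connection\<close> admits just one or two
  edges.\<close>

lemma connections_intersect:
  assumes i: "i < r" "j < r" "i \<noteq> j" and p: "connection i j p" "connection i j p'"
  shows "p \<inter> p' \<noteq> {}"
proof
  assume dis: "p \<inter> p' = {}"
  obtain u v where uv: "u \<in> core i" "v \<in> core j" "lpath p u v" using p by (auto simp: connection_def)
  obtain u' v' where uv': "u' \<in> core i" "v' \<in> core j" "lpath p' u' v'" using p by (auto simp: connection_def)
  have P: "finite p" "u \<in> p" "v \<in> p" "finite p'" "u' \<in> p'" "v' \<in> p'"
    using lpathD[OF uv(3)] lpathD[OF uv'(3)] by auto
  have cp: "card p \<le> 2 * k" "card p' \<le> 2 * k" "p \<subseteq> arena" "p' \<subseteq> arena" using p by (auto simp: connection_def)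
  define L0 where "L0 = core j - (p \<union> p') \<union> {v, v'}"
  have vv: "v \<noteq> v'" using P dis by auto
  have fc: "finite (core j)" using core_K(1)[of j] fin_WK(2)[OF i(2)] finite_subset by blast
  have cpp: "card (p \<union> p') \<le> 4 * k" using card_Un_le[of p p'] cp by linarith
  have "card (core j) - card (p \<union> p') \<le> card (core j - (p \<union> p'))"
    using P by (intro diff_card_le_card_Diff) auto
  also have "\<dots> \<le> card L0" unfolding L0_def using fc by (intro card_mono) auto
  finally have cL0: "card (core j) \<le> card L0 + 4 * k" using cpp by linarith
  \<comment> \<open>At most \<open>4 * k\<close> vertices of the detour already lie in
    \<open>K i\<close>; the other \<open>z\<close> edges cover what cycle \<open>i\<close> may
    lack.\<close>
  define g where "g = z + 4 * k"
  have kk: "(k - 1) * g \<le> k * z + 4 * (k * k)"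
    using mult_le_mono1[of "k - 1" k g] unfolding g_def by (simp add: algebra_simps)
  have h6: "(k - 1) * g + 1 \<le> card L0"
    using cL0 card_core[OF i(2)] K(2)[OF i(2)] q_bounds[of j] kk by linarith
  have "L0 \<subseteq> K j" using core_K(1)[of j] uv(2) uv'(2) unfolding L0_def by blast
  then have h1: "clq L0" by (rule clq_subset[OF K(1)[OF i(2)]])
  have h2: "v \<in> L0" "v' \<in> L0" by (auto simp: L0_def)
  have h5: "1 \<le> g" unfolding g_def using k3 by simp
  obtain L where L: "L \<subseteq> L0" "card L = (k - 1) * g + 1" "lpath L v v'"
    by (rule clq_lpath_ex[OF h1 h2 vv h5 h6])
  have vL: "v \<in> L" "v' \<in> L" "finite L" using lpathD[OF L(3)] by auto
  have "lpath (p \<union> L) u v'"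
  proof (rule lpath_append[OF L(3) uv(3)])
    show "p \<inter> L = {v}" using L(1) vL P dis unfolding L0_def by blast
  qed
  moreover have "(p \<union> L) \<inter> p' = {v'}" using L(1) vL P dis unfolding L0_def by blast
  ultimately have lG: "lpath (p \<union> L \<union> p') u u'" using lpath_append[OF lpath_sym[OF uv'(3)]] by blast
  define G where "G = p \<union> L \<union> p'"
  define \<Gamma> where "\<Gamma> = {(G, u, u')}"
  have LA: "L \<subseteq> core j" using L(1) uv uv' unfolding L0_def by blast
  have GA: "G \<subseteq> arena" using LA cp i(2) unfolding G_def arena_def by blast
  have fG: "finite G" using P vL by (auto simp: G_def)
  have cG: "card G \<le> 4 * k + ((k - 1) * g + 1)"
  proof -
    have "G = (p \<union> p') \<union> L" by (auto simp: G_def)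
    then show ?thesis using card_Un_le[of "p \<union> p'" L] cpp L(2) by simp
  qed
  have cG2: "(k - 1) * g + 1 \<le> card G" using L(2) card_mono[OF fG, of L] unfolding G_def by auto
  have "L \<inter> K i = {}" using LA core_disjoint[of j i] i by blast
  then have "K i \<inter> G \<subseteq> p \<union> p'" by (auto simp: G_def)
  then have cKG: "card (K i \<inter> G) \<le> 4 * k" using cpp P card_mono[of "p \<union> p'" "K i \<inter> G"] by simp
  have cK: "card (K i) = card (K i \<inter> G) + card (K i - G)" using fin_WK[OF i(1)] by (metis card_Int_Diff)
  have "(K i - G) \<inter> G = {}" by auto
  then have cKuG: "card (K i \<union> G) = card (K i - G) + card G"
    using card_Un_disjoint[of "K i - G" G] fin_WK[OF i(1)] fG by (simp add: Un_Diff_cancel2)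
  have "card (W i) + card (K i \<union> \<Union>(fst ` \<Gamma>)) < n"
  proof (rule no_gadgets[OF i(1)])
    show "finite \<Gamma>" by (simp add: \<Gamma>_def)
    show "lpath G' y y' \<and> y \<in> core i \<and> y' \<in> core i \<and> G' \<subseteq> arena" if "(G', y, y') \<in> \<Gamma>" for G' y y'
      using that lG GA uv uv' by (auto simp: \<Gamma>_def G_def)
    show "fst g \<inter> fst h = {}" if "g \<in> \<Gamma>" "h \<in> \<Gamma>" "g \<noteq> h" for g h using that by (auto simp: \<Gamma>_def)
    have \<Gamma>2: "(k - 2) * (card \<Gamma> + 1) \<le> 2 * k" "\<Union>(fst ` \<Gamma>) = G" by (simp_all add: \<Gamma>_def)
    show "(k - 2) * (card \<Gamma> + 1) + 2 \<le> card (K i - \<Union>(fst ` \<Gamma>))"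
      using \<Gamma>2(1) cK cKG K(2)[OF i(1)] q_bounds[of i] k3 unfolding \<Gamma>2(2) by linarith
    show "card (\<Union>(fst ` \<Gamma>)) + 2 + (k - 2) * (card \<Gamma> + 1) \<le> (k - 1) * q i"
      using \<Gamma>2(1) q_bounds[of i] kk cG k3 unfolding \<Gamma>2(2) by linarith
  qed
  then have "card (W i) + card (K i \<union> G) < n" by (simp add: \<Gamma>_def)
  moreover have "card (W i \<union> K i) = card (W i) + card (K i)"
    using W(1)[OF i(1)] fin_WK[OF i(1)] by (simp add: card_Un_disjoint)
  moreover have "1 * g \<le> (k - 1) * g" using k3 by (intro mult_le_mono1) auto
  ultimately show False
    using card_clump_large[OF i(1)] Z(2) cKuG cK cKG cG2 g_def by linarith
qed

text \<open>Detours of at most two edges from the mark of cycle \<open>l\<close> to itself; both kinds, a single edge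
  with two vertices in the mark and two edges meeting outside it, are needed.\<close>

definition gadget :: "'v set \<Rightarrow> nat \<times> 'v set \<times> 'v \<times> 'v \<Rightarrow> bool" where
  "gadget D = (\<lambda>(l, G, y, y'). l < r \<and> lpath G y y' \<and> y \<in> core l \<and> y' \<in> core l \<and> G \<subseteq> core l \<union> Z
     \<and> G \<inter> D = {} \<and> G \<inter> Z \<noteq> {} \<and> card G \<le> 2 * k)"

definition packing :: "'v set \<Rightarrow> (nat \<times> 'v set \<times> 'v \<times> 'v) set \<Rightarrow> bool" where
  "packing D \<Gamma> \<longleftrightarrow> finite \<Gamma> \<and> (\<forall>g\<in>\<Gamma>. gadget D g)
     \<and> (\<forall>g\<in>\<Gamma>. \<forall>h\<in>\<Gamma>. g \<noteq> h \<longrightarrow> fst (snd g) \<inter> fst (snd h) = {})"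

text \<open>Disjoint gadgets contain distinct vertices of \<open>Z\<close>, each having at least one
  by definition. This is what makes a packing of maximum size exist.\<close>

lemma card_packing:
  assumes "packing D \<Gamma>" shows "card \<Gamma> \<le> card Z"
proof -
  have ne: "fst (snd g) \<inter> Z \<noteq> {}" if "g \<in> \<Gamma>" for g
    using assms that unfolding packing_def gadget_def by (cases g) fastforce
  have "card \<Gamma> = (\<Sum>g\<in>\<Gamma>. 1)" by simp
  also have "\<dots> \<le> (\<Sum>g\<in>\<Gamma>. card (fst (snd g) \<inter> Z))"
    using ne Z_V0(2) by (intro sum_mono) (simp add: Suc_le_eq card_gt_0_iff)
  also have "\<dots> = card (\<Union>g\<in>\<Gamma>. fst (snd g) \<inter> Z)"
  proof (rule card_UN_disjoint[symmetric])
    show "finite \<Gamma>" using assms by (simp add: packing_def)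
    show "\<forall>g\<in>\<Gamma>. finite (fst (snd g) \<inter> Z)" using Z_V0(2) by simp
    show "\<forall>g\<in>\<Gamma>. \<forall>h\<in>\<Gamma>. g \<noteq> h \<longrightarrow> fst (snd g) \<inter> Z \<inter> (fst (snd h) \<inter> Z) = {}"
      using assms unfolding packing_def by blast
  qed
  also have "\<dots> \<le> card Z" using Z_V0(2) by (intro card_mono) auto
  finally show ?thesis .
qed

text \<open>Here \<open>D\<close> meets all connections and \<open>X\<close> all detours. If
  \<open>S\<close> had more than \<open>tau (k - 1) \<sigma>\<close> vertices,
  \<open>tau_dichotomy\<close> would apply to \<open>F\<close>. Two members of \<open>F\<close>
  meeting in one vertex extend to two red edges forming a path between marks, hence a detour or a
  connection avoiding \<open>D\<close> and \<open>X\<close>. An independent \<open>S'\<close> of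
  size \<open>\<sigma>\<close> serves as the last part in \<open>no_blue\<close>.\<close>

lemma saturated_leftover:
  assumes D: "finite D" "\<And>i j p. \<lbrakk>i < j; j < r; connection i j p\<rbrakk> \<Longrightarrow> p \<inter> D \<noteq> {}"
    and S: "S \<subseteq> Z" "S \<inter> D = {}" "S \<inter> X = {}"
    and none: "\<And>g. gadget D g \<Longrightarrow> fst (snd g) \<inter> X \<noteq> {}"
    and big: "\<And>i. i < r \<Longrightarrow> m + 2 ^ z \<le> card (core i - D - X)"
  shows "card S \<le> tau (k - 1) \<sigma>"
proof (rule ccontr)
  assume "\<not> ?thesis"
  define C where "C i = core i - D - X" for i
  have CA: "C i \<subseteq> core i" "C i \<inter> D = {}" "C i \<inter> X = {}" for i by (auto simp: C_def)
  \<comment> \<open>Two extensions \<open>y\<close> and \<open>y'\<close> in the same mark are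
    demanded so that in the meeting case the second edge can avoid the vertex used by the first, and
    in the independent case sets outside \<open>F\<close> have at most one extension per
    mark.\<close>
  define F where "F = {T. T \<subseteq> S \<and> card T = k - 1 \<and> (\<exists>l<r. \<exists>y\<in>C l. \<exists>y'\<in>C l. y \<noteq> y'
      \<and> redge (insert y T) \<and> redge (insert y' T))}"
  have fS: "finite S" using S(1) Z_V0(2) finite_subset by blast
  have SC: "S \<inter> core i = {}" if "i < r" for i using S(1) Z_V0(3)[OF that] core_K(1)[of i] by auto
  have nocon: False if "i < r" "j < r" "i \<noteq> j" "lpath p u v" "u \<in> core i" "v \<in> core j" "p \<subseteq> arena"
      "card p \<le> 2 * k" "p \<inter> D = {}" for i j p u v
  proof (cases "i < j")
    case True
    then show False using D(2)[of i j p] that unfolding connection_def by blast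
  next
    case False
    then show False using D(2)[of j i p] that lpath_sym[OF that(4)] unfolding connection_def by auto
  qed
  have nogad: False if "l < r" "lpath p y y'" "y \<in> core l" "y' \<in> core l" "p \<subseteq> core l \<union> Z" "p \<inter> Z \<noteq> {}"
      "card p \<le> 2 * k" "p \<inter> D = {}" "p \<inter> X = {}" for l p y y'
    using none[of "(l, p, y, y')"] that by (simp add: gadget_def)
  have "2 \<le> k - 1" "tau (k - 1) \<sigma> < card S" using k3 \<open>\<not> _\<close> by auto
  moreover have "card T = k - 1" if "T \<in> F" for T using that by (simp add: F_def)
  ultimately consider (meet) T1 T2 where "T1 \<in> F" "T2 \<in> F" "T1 \<subseteq> S" "T2 \<subseteq> S" "card (T1 \<inter> T2) = 1"
    | (indep) S' where "S' \<subseteq> S" "card S' = \<sigma>" "\<And>T. T \<in> F \<Longrightarrow> \<not> T \<subseteq> S'"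
    using tau_dichotomy[OF _ fS, of "k - 1" \<sigma> F] by blast
  then show False
  proof cases
    case meet
    note 5 = meet
    obtain x where x: "T1 \<inter> T2 = {x}" using 5(5) by (auto simp: card_1_singleton_iff)
    obtain l1 y1 where 1: "l1 < r" "y1 \<in> C l1" "redge (insert y1 T1)" using 5(1) by (auto simp: F_def)
    obtain l2 y2 y2' where 2: "l2 < r" "y2 \<in> C l2" "y2' \<in> C l2" "y2 \<noteq> y2'" "redge (insert y2 T2)" "redge (insert y2' T2)"
      using 5(2) by (auto simp: F_def)
    \<comment> \<open>The two edges must leave \<open>x\<close> towards different vertices, also
      when \<open>l1 = l2\<close>.\<close>
    define y where "y = (if y1 = y2 then y2' else y2)"
    have y: "y \<in> C l2" "y \<noteq> y1" "redge (insert y T2)" using 2 by (auto simp: y_def)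
    have T: "T1 \<subseteq> S" "T2 \<subseteq> S" "card T1 = k - 1" "card T2 = k - 1" using 5 by (auto simp: F_def)
    have ny: "y1 \<notin> S" "y \<notin> S" using SC[OF 1(1)] SC[OF 2(1)] 1(2) y(1) CA(1) by blast+
    have xx: "x \<in> T1" "x \<in> T2" using x by auto
    define p where "p = insert y1 T1 \<union> insert y T2"
    have "lpath (insert y1 T1) y1 x" using 1(3) xx ny T by (intro lpath.edge) auto
    moreover have "lpath (insert y T2) x y" using y(3) xx ny T by (intro lpath.edge) auto
    moreover have "insert y1 T1 \<inter> insert y T2 = {x}" using x y(2) ny T by auto
    ultimately have lp: "lpath p y1 y" unfolding p_def using lpath_append by blast
    have "card p \<le> card (insert y1 T1) + card (insert y T2)" unfolding p_def by (rule card_Un_le)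
    then have cp: "card p \<le> 2 * k" using redgeD 1(3) y(3) by simp
    have pD: "p \<inter> D = {}" "p \<inter> X = {}" using 1(2) y(1) T S CA unfolding p_def by blast+
    have pA: "p \<subseteq> insert y1 (insert y Z)" using T S unfolding p_def by blast
    have pZ: "p \<inter> Z \<noteq> {}" using xx T S unfolding p_def by blast
    have yc: "y1 \<in> core l1" "y \<in> core l2" using 1(2) y(1) CA(1) by blast+
    show False
    proof (cases "l1 = l2")
      case True
      then show False using nogad[OF 1(1) lp _ _ _ pZ cp pD] yc pA by auto
    next
      case False
      then show False using nocon[OF 1(1) 2(1) False lp yc _ cp pD(1)] pA yc 1(1) 2(1) unfolding arena_def by blast
    qed
  next
    case indep
    note 4 = indep
    define bad where "bad l = {y \<in> C l. \<exists>T\<subseteq>S'. card T = k - 1 \<and> redge (insert y T)}" for l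
    have fS': "finite S'" using 4(1) fS finite_subset by blast
    have cS': "card S' \<le> z" using card_mono[OF Z_V0(2) order_trans[OF 4(1) S(1)]] Z(2) by linarith
    have fC: "finite (C l)" if "l < r" for l
      using CA(1)[of l] core_K(1)[of l] fin_WK(2)[OF that] by (meson finite_subset)
    \<comment> \<open>Each subset of \<open>S'\<close> contributes at most one vertex per mark, as
      otherwise it would belong to \<open>F\<close>.\<close>
    have badc: "card (bad l) \<le> 2 ^ z" if l: "l < r" for l
    proof -
      define h where "h T = {y \<in> C l. card T = k - 1 \<and> redge (insert y T)}" for T
      have h1: "card (h T) \<le> 1" if T: "T \<subseteq> S'" for T
      proof (rule ccontr)
        assume "\<not> card (h T) \<le> 1"
        then have "\<not> (\<forall>y\<in>h T. \<forall>y'\<in>h T. y = y')" using fC[OF l] unfolding h_def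
          by (subst card_le_Suc0_iff_eq[symmetric]) auto
        then obtain y y' where "y \<in> h T" "y' \<in> h T" "y \<noteq> y'" by blast
        then have "T \<in> F" using T 4(1) l unfolding F_def h_def by blast
        then show False using 4(3) T by blast
      qed
      have "bad l = (\<Union>T\<in>Pow S'. h T)" unfolding bad_def h_def by blast
      then have "card (bad l) \<le> (\<Sum>T\<in>Pow S'. card (h T))"
        using card_UN_le[of "Pow S'" h] fS' by simp
      also have "\<dots> \<le> (\<Sum>T\<in>Pow S'. 1)" using h1 by (intro sum_mono) auto
      also have "\<dots> = 2 ^ card S'" using fS' by (simp add: card_Pow)
      also have "\<dots> \<le> 2 ^ z" using cS' by (rule power_increasing) simp
      finally show ?thesis .
    qed
    define P where "P i = (if i = r then S' else C i - bad i)" for i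
    have PC: "P i \<subseteq> C i" if "i < r" for i using that by (auto simp: P_def)
    have Pr: "P r = S'" by (simp add: P_def)
    have dPS: "P i \<inter> S' = {}" if "i < r" for i using PC[OF that] SC[OF that] CA(1)[of i] 4(1) by blast
    have dPP: "P i \<inter> P j = {}" if "i < r" "j < r" "i \<noteq> j" for i j
      using PC[OF that(1)] PC[OF that(2)] CA(1)[of i] CA(1)[of j] core_disjoint[OF that] core_K(1)[of j] by blast
    have "\<exists>e. redge e \<and> e \<subseteq> (\<Union>i\<le>r. P i) \<and> (\<forall>i\<le>r. \<not> e \<subseteq> P i)"
    proof (rule no_blue)
      show "P i \<subseteq> V0" if "i \<le> r" for i
      proof (cases "i = r")
        case True then show ?thesis using Pr 4(1) S(1) Z_V0(1) by auto
      next
        case False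
        then have "i < r" using that by simp
        then show ?thesis using PC CA(1)[of i] core_K(1)[of i] W(2)[of i] by blast
      qed
      show "m \<le> card (P i)" if "i < r" for i
      proof -
        have "bad i \<subseteq> C i" by (auto simp: bad_def)
        then have "card (C i - bad i) = card (C i) - card (bad i)"
          using fC[OF that] by (simp add: card_Diff_subset finite_subset)
        then show ?thesis using big[OF that] badc[OF that] that unfolding P_def C_def by simp
      qed
      show "\<sigma> \<le> card (P r)" using Pr 4(2) by simp
      show "P i \<inter> P j = {}" if ij: "i \<le> r" "j \<le> r" "i \<noteq> j" for i j
      proof -
        consider "i < r" "j < r" | "i = r" "j < r" | "i < r" "j = r" using ij by linarith
        then show ?thesis using dPP[of i j] dPS[of i] dPS[of j] Pr ij by cases auto
      qed
    qed
    then obtain e where e: "redge e" "e \<subseteq> (\<Union>i\<le>r. P i)" "\<And>i. i \<le> r \<Longrightarrow> \<not> e \<subseteq> P i" by blast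
    have ce: "card e = k" "finite e" using redgeD e(1) by auto
    have inP: "x \<in> S' \<or> (\<exists>i<r. x \<in> P i)" if x: "x \<in> e" for x
    proof -
      obtain i where "i \<le> r" "x \<in> P i" using e(2) x by auto
      then show ?thesis using Pr by (cases "i = r") auto
    qed
    have PS: "P i \<subseteq> core i" "P i \<inter> D = {}" "P i \<inter> X = {}" if "i < r" for i using PC[OF that] CA[of i] by auto
    have S'p: "S' \<subseteq> Z" "S' \<inter> D = {}" "S' \<inter> X = {}" using 4(1) S by auto
    have eA: "e \<subseteq> arena"
    proof
      fix x assume "x \<in> e"
      then show "x \<in> arena" using inP[of x] PS(1) S'p unfolding arena_def by blast
    qed
    have eD: "e \<inter> D = {}" "e \<inter> X = {}" using inP PS S'p by blast+
    obtain y where y: "y \<in> e" "y \<notin> S'" using e(3)[of r] Pr by auto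
    then obtain l where l: "l < r" "y \<in> P l" using inP by blast
    \<comment> \<open>A red edge meeting two marks would itself be a connection avoiding
      \<open>D\<close>.\<close>
    have only: "e \<subseteq> P l \<union> S'"
    proof
      fix x assume x: "x \<in> e"
      show "x \<in> P l \<union> S'"
      proof (rule ccontr)
        assume "x \<notin> P l \<union> S'"
        then obtain j where j: "j < r" "x \<in> P j" "j \<noteq> l" using inP[OF x] by auto
        then have "x \<noteq> y" using l dPP[of j l] by auto
        then have "lpath e y x" using e(1) x y by (intro lpath.edge) auto
        then show False using nocon[of l j e y x] l j PS(1) eA eD ce by auto
      qed
    qed
    obtain x where x: "x \<in> e" "x \<notin> P l" using e(3)[of l] l by auto
    then have xS: "x \<in> S'" using only by auto
    show False
    \<comment> \<open>With two vertices in the mark, \<open>e\<close> is a one-edge detour; with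
      only one, that vertex is bad and was removed.\<close>
    proof (cases "\<exists>y'\<in>e. y' \<in> P l \<and> y' \<noteq> y")
      case True
      then obtain y' where y': "y' \<in> e" "y' \<in> P l" "y' \<noteq> y" by blast
      then have "lpath e y y'" using e(1) y by (intro lpath.edge) auto
      moreover have "e \<subseteq> core l \<union> Z" using only PS(1)[OF l(1)] S'p by blast
      moreover have "e \<inter> Z \<noteq> {}" using x xS S'p by blast
      ultimately show False using nogad[of l e y y'] l y' PS(1)[OF l(1)] eD ce by auto
    next
      case False
      then have "e = insert y (e - {y})" "e - {y} \<subseteq> S'" using y only by auto
      moreover have "card (e - {y}) = k - 1" using y ce by simp
      ultimately have "y \<in> bad l" using e(1) l PC[of l] unfolding bad_def by (auto intro!: exI[of _ "e - {y}"])
      then show False using l by (simp add: P_def)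
    qed
  qed
qed

text \<open>\<open>Z\<close> is covered by the hitting set \<open>D\<close>, the vertices absorbed
  by a maximum packing, and a rest of at most \<open>tau (k - 1) \<sigma>\<close> vertices. Each
  cycle with its absorbed vertices still has at most \<open>n - 1\<close> vertices, which
  contradicts the size of \<open>V0\<close>.\<close>

lemma impossible: False
proof -
  define Q where "Q = {(i, j). i < j \<and> j < r}"
  have "Q \<subseteq> {..<r} \<times> {..<r}" by (auto simp: Q_def)
  then have fQ: "finite Q" using finite_subset by blast
  have cQ: "card Q = r choose 2" unfolding Q_def by (rule card_index_pairs)
  obtain D where D: "finite D" "card D \<le> card Q * (2 * k)"
    "\<And>p e. p \<in> Q \<Longrightarrow> e \<in> {e. connection (fst p) (snd p) e} \<Longrightarrow> e \<inter> D \<noteq> {}"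
  proof (rule intersecting_hitting_set[OF fQ, of "\<lambda>p. {e. connection (fst p) (snd p) e}" "2 * k"])
    show "e \<inter> f \<noteq> {}" if "p \<in> Q" "e \<in> {e. connection (fst p) (snd p) e}" "f \<in> {e. connection (fst p) (snd p) e}" for p e f
      using that connections_intersect[of "fst p" "snd p" e f] by (auto simp: Q_def)
    show "finite e \<and> card e \<le> 2 * k" if "e \<in> {e. connection (fst p) (snd p) e}" for p e
      using that lpathD by (auto simp: connection_def)
  qed blast
  have Dc: "p \<inter> D \<noteq> {}" if "i < j" "j < r" "connection i j p" for i j p
    using D(3)[of "(i, j)" p] that by (auto simp: Q_def)
  have "\<exists>\<Gamma>. packing D \<Gamma> \<and> (\<forall>\<Gamma>'. packing D \<Gamma>' \<longrightarrow> card \<Gamma>' \<le> card \<Gamma>)"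
  proof (rule Lattices_Big.ex_has_greatest_nat[of "packing D" "{}" card "Suc (card Z)"])
    show "packing D {}" by (simp add: packing_def)
    show "\<forall>\<Gamma>. packing D \<Gamma> \<longrightarrow> card \<Gamma> < Suc (card Z)" using card_packing by (simp add: less_Suc_eq_le)
  qed
  then obtain \<Gamma> where \<Gamma>: "packing D \<Gamma>" "\<And>\<Gamma>'. packing D \<Gamma>' \<Longrightarrow> card \<Gamma>' \<le> card \<Gamma>" by blast
  have f\<Gamma>: "finite \<Gamma>" and g\<Gamma>: "\<And>g. g \<in> \<Gamma> \<Longrightarrow> gadget D g"
    and d\<Gamma>: "\<And>g h. g \<in> \<Gamma> \<Longrightarrow> h \<in> \<Gamma> \<Longrightarrow> g \<noteq> h \<Longrightarrow> fst (snd g) \<inter> fst (snd h) = {}"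
    using \<Gamma>(1) unfolding packing_def by blast+
  have gE: "l < r" "lpath G y y'" "y \<in> core l" "y' \<in> core l" "G \<subseteq> core l \<union> Z" "G \<inter> D = {}" "G \<inter> Z \<noteq> {}" "card G \<le> 2 * k"
    if "(l, G, y, y') \<in> \<Gamma>" for l G y y'
    using g\<Gamma>[OF that] by (auto simp: gadget_def)
  define X where "X = (\<Union>g\<in>\<Gamma>. fst (snd g))"
  have cX: "card (\<Union>g\<in>\<Gamma>'. fst (snd g)) \<le> 2 * (k * z)" if "\<Gamma>' \<subseteq> \<Gamma>" for \<Gamma>'
  proof -
    have "card (\<Union>g\<in>\<Gamma>'. fst (snd g)) \<le> (\<Sum>g\<in>\<Gamma>'. card (fst (snd g)))"
      using that f\<Gamma> finite_subset by (intro card_UN_le) blast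
    also have "\<dots> \<le> (\<Sum>g\<in>\<Gamma>'. 2 * k)" using that gE(8) by (intro sum_mono) fastforce
    also have "\<dots> = card \<Gamma>' * (2 * k)" by simp
    also have "\<dots> \<le> z * (2 * k)"
      using card_mono[OF f\<Gamma> that] card_packing[OF \<Gamma>(1)] Z(2) by (intro mult_le_mono1) linarith
    finally show ?thesis by (simp add: mult_ac)
  qed
  have fG: "finite G" if "(l, G, y, y') \<in> \<Gamma>" for l G y y' using gE(2)[OF that] lpathD by blast
  have fX: "finite X" unfolding X_def using f\<Gamma> fG by fastforce
  have none: "fst (snd g) \<inter> X \<noteq> {}" if g: "gadget D g" for g
  proof
    assume gX: "fst (snd g) \<inter> X = {}"
    have "fst (snd g) \<noteq> {}" using g by (cases g) (auto simp: gadget_def)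
    then have "g \<notin> \<Gamma>" using gX unfolding X_def by blast
    moreover have "packing D (insert g \<Gamma>)"
      unfolding packing_def
    proof (intro conjI ballI impI)
      show "finite (insert g \<Gamma>)" using f\<Gamma> by simp
      show "gadget D h" if "h \<in> insert g \<Gamma>" for h using that g g\<Gamma> by blast
      show "fst (snd h) \<inter> fst (snd h') = {}" if "h \<in> insert g \<Gamma>" "h' \<in> insert g \<Gamma>" "h \<noteq> h'" for h h'
        using that gX d\<Gamma>[of h h'] unfolding X_def by blast
    qed
    ultimately show False using \<Gamma>(2)[of "insert g \<Gamma>"] f\<Gamma> by simp
  qed
  have cS: "card (Z - D - X) \<le> tau (k - 1) \<sigma>"
  proof (rule saturated_leftover[OF D(1) Dc _ _ _ none])
    show "Z - D - X \<subseteq> Z" "(Z - D - X) \<inter> D = {}" "(Z - D - X) \<inter> X = {}" by auto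
    show "m + 2 ^ z \<le> card (core i - D - X)" if i: "i < r" for i
    proof -
      have "card (core i) \<le> card (core i - D) + card D" using diff_card_le_card_Diff[OF D(1), of "core i"] by linarith
      moreover have "card (core i - D) \<le> card (core i - D - X) + card X"
        using diff_card_le_card_Diff[OF fX, of "core i - D"] by linarith
      moreover have "card X \<le> 2 * (k * z)" unfolding X_def by (rule cX) simp
      ultimately show ?thesis
        using card_core[OF i] K(2)[OF i] q_bounds[of i] D(2) cQ k3 by simp
    qed
  qed
  define \<Delta> where "\<Delta> l = {g \<in> \<Gamma>. fst g = l}" for l
  define Y where "Y l = (\<Union>g\<in>\<Delta> l. fst (snd g))" for l
  have YA: "Y l \<subseteq> core l \<union> Z" for l unfolding Y_def \<Delta>_def using gE(5) by fastforce
  have fY: "finite (Y l)" for l using fX unfolding X_def Y_def \<Delta>_def by (rule rev_finite_subset) auto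
  have XY: "X \<subseteq> (\<Union>l<r. Y l)" unfolding X_def Y_def \<Delta>_def using gE(1) by fastforce
  \<comment> \<open>The detours of different cycles are disjoint, but each cycle is tested alone:
    only its own detours are threaded into its mark.\<close>
  have clump_bound: "card (W l \<union> K l) + card (Y l \<inter> Z) \<le> n - 1" if l: "l < r" for l
  proof -
    define \<Theta> where "\<Theta> = snd ` \<Delta> l"
    have U: "\<Union>(fst ` \<Theta>) = Y l" unfolding \<Theta>_def Y_def by auto
    have c\<Theta>: "card \<Theta> \<le> z"
    proof -
      have "finite (\<Delta> l)" "\<Delta> l \<subseteq> \<Gamma>" using f\<Gamma> unfolding \<Delta>_def by auto
      then show ?thesis unfolding \<Theta>_def
        using card_image_le[of "\<Delta> l" snd] card_mono[OF f\<Gamma>, of "\<Delta> l"] card_packing[OF \<Gamma>(1)] Z(2) by linarith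
    qed
    have cY: "card (Y l) \<le> 2 * (k * z)" unfolding Y_def by (rule cX) (auto simp: \<Delta>_def)
    have k2: "(k - 2) * (card \<Theta> + 1) \<le> k * z + k"
      using mult_le_mono[of "k - 2" k "card \<Theta> + 1" "z + 1"] c\<Theta> by simp
    have "card (W l) + card (K l \<union> \<Union>(fst ` \<Theta>)) < n"
    proof (rule no_gadgets[OF l])
      show "finite \<Theta>" unfolding \<Theta>_def \<Delta>_def using f\<Gamma> by simp
      show "lpath G y y' \<and> y \<in> core l \<and> y' \<in> core l \<and> G \<subseteq> arena" if "(G, y, y') \<in> \<Theta>" for G y y'
      proof -
        have "(l, G, y, y') \<in> \<Gamma>" using that unfolding \<Theta>_def \<Delta>_def by force
        from gE[OF this] show ?thesis unfolding arena_def by blast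
      qed
      show "fst g \<inter> fst h = {}" if gh: "g \<in> \<Theta>" "h \<in> \<Theta>" "g \<noteq> h" for g h
      proof -
        have "(l, g) \<in> \<Gamma>" "(l, h) \<in> \<Gamma>" using gh unfolding \<Theta>_def \<Delta>_def by force+
        then show ?thesis using d\<Gamma>[of "(l, g)" "(l, h)"] gh(3) by simp
      qed
      have "card (K l) \<le> card (K l - Y l) + card (Y l)" using diff_card_le_card_Diff[OF fY, of "K l" l] by linarith
      then show "(k - 2) * (card \<Theta> + 1) + 2 \<le> card (K l - \<Union>(fst ` \<Theta>))"
        unfolding U using k2 K(2)[OF l] q_bounds[of l] cY k3 by linarith
      show "card (\<Union>(fst ` \<Theta>)) + 2 + (k - 2) * (card \<Theta> + 1) \<le> (k - 1) * q l"
        unfolding U using k2 q_bounds[of l] cY k3 by linarith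
    qed
    moreover have "card (K l \<union> Y l) \<ge> card (K l) + card (Y l \<inter> Z)"
    proof -
      have "card (K l \<union> (Y l \<inter> Z)) = card (K l) + card (Y l \<inter> Z)"
        using fin_WK(2)[OF l] fY Z_V0(3)[OF l] by (intro card_Un_disjoint) auto
      moreover have "card (K l \<union> (Y l \<inter> Z)) \<le> card (K l \<union> Y l)"
        using fin_WK(2)[OF l] fY by (intro card_mono) auto
      ultimately show ?thesis by simp
    qed
    moreover have "card (W l \<union> K l) = card (W l) + card (K l)"
      using W(1)[OF l] fin_WK[OF l] by (simp add: card_Un_disjoint)
    ultimately show ?thesis unfolding U by linarith
  qed
  have "Z \<subseteq> D \<union> (Z - D - X) \<union> (\<Union>l<r. Y l \<inter> Z)" using XY by blast
  then have "card Z \<le> card (D \<union> (Z - D - X) \<union> (\<Union>l<r. Y l \<inter> Z))"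
    using D(1) Z_V0(2) by (intro card_mono) auto
  also have "\<dots> \<le> card D + card (Z - D - X) + card (\<Union>l<r. Y l \<inter> Z)"
    using card_Un_le[of "D \<union> (Z - D - X)" "\<Union>l<r. Y l \<inter> Z"] card_Un_le[of D "Z - D - X"] by linarith
  also have "card (\<Union>l<r. Y l \<inter> Z) \<le> (\<Sum>l<r. card (Y l \<inter> Z))" by (rule card_UN_le) simp
  finally have "card Z \<le> (r choose 2) * (2 * k) + tau (k - 1) \<sigma> + (\<Sum>l<r. card (Y l \<inter> Z))"
    using D(2) cQ cS by simp
  then have "card V0 \<le> (r choose 2) * (2 * k) + tau (k - 1) \<sigma> + (\<Sum>l<r. card (W l \<union> K l) + card (Y l \<inter> Z))"
    unfolding card_V0_eq sum.distrib by linarith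
  moreover have "(\<Sum>l<r. card (W l \<union> K l) + card (Y l \<inter> Z)) \<le> (\<Sum>l<r. n - 1)"
    using clump_bound by (intro sum_mono) auto
  ultimately show False using card_V0 by simp
qed

end

section \<open>Choice of the constants\<close>

context blue_free
begin

text \<open>The hypotheses display the order of choice: \<open>z\<close> involves only
  \<open>k\<close>, \<open>r\<close> and \<open>m\<close>; \<open>Q\<close> exceeds everything
  absorption requires for a leftover of size \<open>z\<close>; \<open>s\<close> exceeds the first
  leftover bound for marks of the sizes \<open>w\<close>, so one mark per cycle remains at the
  end.\<close>

lemma card_V0_bound:
  assumes z: "z = ES k m ((k - 1) * (2 * r + 2) + 1 + 2 * k + m + (r + 1)\<^sup>2 * k)"
    and Q: "Q = m + (r choose 2) * (2 * k) + 10 * (k * k) + 10 * (k * z) + 10 * k + 2 ^ z + (r + 1)\<^sup>2 * k + 2 * r + 20"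
    and w: "\<And>i. w i = (k - 1) * (Q + 4 * i) + 1"
    and s: "s = ES k m (w r + 2 * k) + 1"
    and large: "\<And>i. i < r \<Longrightarrow> ES k m ((s + 1) * (w i + k)) \<le> n \<and> (s + 1) * (w i + k) < n"
  shows "card V0 \<le> r * (n - 1) + (r choose 2) * (2 * k) + tau (k - 1) \<sigma>"
proof (rule ccontr)
  assume "\<not> ?thesis"
  then have V0: "r * (n - 1) + (r choose 2) * (2 * k) + tau (k - 1) \<sigma> + 1 \<le> card V0" by simp
  obtain W A where WA: "system w s W A" "card (leftover W A) < ES k m (w r + 2 * k)"
  proof (rule initial_system[OF w])
    show "8 \<le> Q" "m + (r + 1)\<^sup>2 * k + 2 \<le> Q" using Q by linarith+
    show "1 \<le> s" using s by simp
    show "ES k m ((s + 1) * (w i + k)) \<le> n \<and> (s + 1) * (w i + k) < n" if "i < r" for i using large[OF that] .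
    show "r * (n - 1) + 1 \<le> card V0" using V0 by linarith
  qed blast
  have q1: "m + (r + 1)\<^sup>2 * k + 2 \<le> Q + 4 * i" and q2: "2 * r + 20 \<le> Q + 4 * i" for i using Q by linarith+
  have "card (leftover W A) < s" using WA(2) s by simp
  from small_leftover_system[OF w q1 q2 WA(1) this] obtain s' W' A' where
    s': "1 \<le> s'" "system w s' W' A'" "card (leftover W' A') < z"
    unfolding z by blast
  note S = systemD[OF s'(2)]
  have "\<forall>l. \<exists>\<mu>. l < r \<longrightarrow> \<mu> \<in> A' l"
    using S(3) s'(1) by (metis card.empty ex_in_conv not_one_le_zero)
  then obtain \<mu> where \<mu>: "\<And>l. l < r \<Longrightarrow> \<mu> l \<in> A' l" by metis
  have mk: "mark (w l) (\<mu> l)" if "l < r" for l using clumpD(3)[OF S(1)[OF that] \<mu>[OF that]] .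
  have bdT: "bd (\<mu> l) \<subseteq> total (W' l) (A' l)" if "l < r" for l using \<mu>[OF that] by (auto simp: total_def)
  define X where "X l = total (W' l) (A' l) - bd (\<mu> l)" for l
  have XU: "X l \<union> bd (\<mu> l) = total (W' l) (A' l)" if "l < r" for l using bdT[OF that] by (auto simp: X_def)
  have q0: "1 \<le> Q + 4 * i" for i using Q by linarith
  interpret absorption k red V0 n r m \<sigma> X "\<lambda>l. bd (\<mu> l)" "\<lambda>l. st (\<mu> l)" "\<lambda>l. en (\<mu> l)"
    "\<lambda>l. Q + 4 * l" "leftover W' A'" z
  proof unfold_locales
    fix i assume i: "i < r"
    show "clq (bd (\<mu> i))" "card (bd (\<mu> i)) = (k - 1) * (Q + 4 * i) + 1"
      "st (\<mu> i) \<in> bd (\<mu> i)" "en (\<mu> i) \<in> bd (\<mu> i)" "st (\<mu> i) \<noteq> en (\<mu> i)"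
      using mk[OF i] w by (auto simp: mark_def)
    show "X i \<inter> bd (\<mu> i) = {}" by (auto simp: X_def)
    show "X i \<union> bd (\<mu> i) \<subseteq> V0" "card (X i \<union> bd (\<mu> i)) < n" using XU[OF i] S(2,4)[OF i] by auto
    show "(k - 1) dvd card (X i \<union> bd (\<mu> i))"
      unfolding XU[OF i] using cyc_card clump_cyc[OF S(1)[OF i] w q0] by blast
    show "(X i \<union> bd (\<mu> i)) \<inter> (X j \<union> bd (\<mu> j)) = {}" if "j < r" "i \<noteq> j" for j
      unfolding XU[OF i] XU[OF that(1)] using S(5)[OF i that] .
    fix Y assume Y: "lpath Y (st (\<mu> i)) (en (\<mu> i))" "Y \<inter> X i = {}" "Y \<subseteq> V0"
    then have "Y \<inter> total (W' i) (A' i) \<subseteq> bd (\<mu> i)" by (auto simp: X_def)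
    note F = clump_reroute[OF S(1)[OF i] \<mu>[OF i] Y(1) this]
    have "cyc (X i \<union> Y)" using clump_cyc[OF F(1) w q0] unfolding F(2) X_def .
    moreover have "X i \<union> Y \<subseteq> V0" using Y(3) S(2)[OF i] by (auto simp: X_def)
    ultimately have "card (X i \<union> Y) \<noteq> n" by (rule no_cycle)
    moreover have "finite (X i)" using finite_total[OF S(1)[OF i]] by (simp add: X_def)
    then have "card (X i \<union> Y) = card (X i) + card Y"
      using Y(2) lpathD[OF Y(1)] by (subst card_Un_disjoint) auto
    ultimately show "card (X i) + card Y \<noteq> n" by simp
  next
    show "leftover W' A' = V0 - (\<Union>i<r. X i \<union> bd (\<mu> i))" using XU by (simp add: leftover_def)
    show "card (leftover W' A') \<le> z" using s'(3) by simp
    show "m + (r choose 2) * (2 * k) + 10 * (k * k) + 10 * (k * z) + 10 * k + 2 ^ z \<le> Q + 4 * i" for i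
      using Q by linarith
    show "r * (n - 1) + (r choose 2) * (2 * k) + tau (k - 1) \<sigma> + 1 \<le> card V0" by (rule V0)
  qed
  show False by (rule impossible)
qed

end

section \<open>The upper bound\<close>

lemma blue_clique_copy:
  assumes "kgraph k V E" "H \<subseteq> {..<N}" "finite H" "card H = card V" "\<forall>e\<subseteq>H. card e = k \<longrightarrow> \<not> col e"
  shows "mono_copy N col False V E"
proof -
  have "finite V" using assms(1) by (simp add: kgraph_def)
  then obtain \<phi> where \<phi>: "bij_betw \<phi> V H" using finite_same_card_bij assms(3,4) by metis
  have "\<not> col (\<phi> ` e)" if "e \<in> E" for e
  proof -
    have "e \<subseteq> V" "card e = k" using that assms(1) by (auto simp: kgraph_def)
    then have "\<phi> ` e \<subseteq> H" "card (\<phi> ` e) = k"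
      using \<phi> by (auto simp: bij_betw_def card_image inj_on_subset)
    then show ?thesis using assms(5) by blast
  qed
  then show ?thesis unfolding mono_copy_def using \<phi> assms(2) by (intro exI[of _ \<phi>]) (auto simp: bij_betw_def)
qed

theorem theorem1p9:
  fixes k :: nat and V :: "'a set" and E :: "'a set set"
  assumes "k \<ge> 3" and "kgraph k V E"
  shows "\<exists>n0. \<forall>n\<ge>n0. (k - 1) dvd n \<longrightarrow>
    ramsey_number k {..<n} (loose_cycle_edges k n) V E
      \<le> (chromatic_number V E - 1) * (n - 1)
         + 4 * k * ((chromatic_number V E - 1) choose 2)
         + tau (k - 1) (sigma V E) + 1"
proof (cases "V = {}")
  \<comment> \<open>Here \<open>chromatic_number\<close> is 0 and there is no colour class to speak
    of; every colouring contains the empty blue copy.\<close>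
  case True
  then have "E = {}" using assms by (auto simp: kgraph_def)
  then have "mono_copy N c False V E" for N c using True by (simp add: mono_copy_def)
  then have "ramsey_number k {..<n} (loose_cycle_edges k n) V E \<le> N" for n N
    unfolding ramsey_number_def by (intro Least_le) auto
  then show ?thesis by blast
next
  case False
  obtain f where f: "proper_colouring V E (chromatic_number V E) f" "1 \<le> chromatic_number V E"
    "card {v \<in> V. f v = chromatic_number V E - 1} = sigma V E"
    using sigma_colouring[OF assms(2) _ False] assms(1) by auto
  define r where "r = chromatic_number V E - 1"
  define m where "m = card V"
  define \<sigma> where "\<sigma> = sigma V E"
  have fV: "finite V" using assms(2) by (simp add: kgraph_def)
  have c: "chromatic_number V E = Suc r" using f(2) by (simp add: r_def)
  define z where "z = ES k m ((k - 1) * (2 * r + 2) + 1 + 2 * k + m + (r + 1)\<^sup>2 * k)"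
  define Q where "Q = m + (r choose 2) * (2 * k) + 10 * (k * k) + 10 * (k * z) + 10 * k + 2 ^ z
    + (r + 1)\<^sup>2 * k + 2 * r + 20"
  define w where "w i = (k - 1) * (Q + 4 * i) + 1" for i
  define s where "s = ES k m (w r + 2 * k) + 1"
  \<comment> \<open>A sum dominates each of the finitely many lower bounds on \<open>n\<close>; the
    summand 1 makes the second one strict.\<close>
  define n0 where "n0 = (\<Sum>i<r. ES k m ((s + 1) * (w i + k)) + (s + 1) * (w i + k) + 1)"
  show ?thesis
    unfolding r_def[symmetric] \<sigma>_def[symmetric]
  proof (intro exI[of _ n0] allI impI)
    fix n assume n: "n0 \<le> n" "(k - 1) dvd n"
    define N where "N = r * (n - 1) + 4 * k * (r choose 2) + tau (k - 1) \<sigma> + 1"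
    have "mono_copy N col True {..<n} (loose_cycle_edges k n) \<or> mono_copy N col False V E" for col
    proof (rule ccontr)
      assume no: "\<not> ?thesis"
      interpret red_hypergraph k col by unfold_locales (rule assms(1))
      interpret blue_free k col "{..<N}" n r m \<sigma>
      proof unfold_locales
        show "finite {..<N}" by simp
        show "(k - 1) dvd n" by (rule n(2))
        show "card X \<noteq> n" if X: "cyc X" "X \<subseteq> {..<N}" for X
        proof
          assume "card X = n"
          then obtain \<phi> where "bij_betw \<phi> {..<n} X" "\<forall>e\<in>loose_cycle_edges k n. col (\<phi> ` e)"
            using cyc_enum[OF X(1)] by blast
          then have "mono_copy N col True {..<n} (loose_cycle_edges k n)"
            unfolding mono_copy_def using X(2) by (intro exI[of _ \<phi>]) (auto simp: bij_betw_def)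
          then show False using no by simp
        qed
        show "\<exists>K\<subseteq>U. clq K \<and> card K = q" if U: "U \<subseteq> {..<N}" "ES k m q \<le> card U" for U q
          using U(2)
        proof (rule ramsey_subset[where c = col])
          fix H assume "H \<subseteq> U" "finite H" "card H = m" "\<forall>e\<subseteq>H. card e = k \<longrightarrow> \<not> col e"
          then show ?thesis using blue_clique_copy[OF assms(2), of H N col] U(1) no by (auto simp: m_def)
        next
          fix H assume "H \<subseteq> U" "finite H" "card H = q" "\<forall>e\<subseteq>H. card e = k \<longrightarrow> col e"
          then show ?thesis by (auto simp: clq_def)
        qed
        show "\<sigma> \<le> m" unfolding \<sigma>_def m_def f(3)[symmetric] using fV by (intro card_mono) auto
        fix P :: "nat \<Rightarrow> nat set"
        assume P: "\<And>i. i \<le> r \<Longrightarrow> P i \<subseteq> {..<N}" "\<And>i. i < r \<Longrightarrow> m \<le> card (P i)" "\<sigma> \<le> card (P r)"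
          "\<And>i j. i \<le> r \<Longrightarrow> j \<le> r \<Longrightarrow> i \<noteq> j \<Longrightarrow> P i \<inter> P j = {}"
        show "\<exists>e. redge e \<and> e \<subseteq> (\<Union>i\<le>r. P i) \<and> (\<forall>i\<le>r. \<not> e \<subseteq> P i)"
        proof (rule ccontr)
          assume ne: "\<not> ?thesis"
          have "mono_copy N col False V E"
          proof (rule multipartite_copy[OF assms(2) f(1)[unfolded c]])
            fix i assume i: "i < Suc r"
            have "card {v \<in> V. f v = i} \<le> card (P i)"
            proof (cases "i = r")
              case True then show ?thesis using P(3) f(3) c by (simp add: \<sigma>_def)
            next
              case False
              have "card {v \<in> V. f v = i} \<le> m" unfolding m_def using fV by (intro card_mono) auto
              then show ?thesis using P(2)[of i] i False by simp
            qed
            then show "finite (P i) \<and> card {v \<in> V. f v = i} \<le> card (P i) \<and> P i \<subseteq> {..<N}"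
              using P(1)[of i] i finite_subset[of "P i" "{..<N}"] by auto
          next
            show "P i \<inter> P j = {}" if "i < Suc r" "j < Suc r" "i \<noteq> j" for i j using P(4) that by simp
            show "\<not> col e" if "e \<subseteq> (\<Union>i<Suc r. P i)" "card e = k" "\<And>i. i < Suc r \<Longrightarrow> \<not> e \<subseteq> P i" for e
              using ne that by (auto simp: redge_def lessThan_Suc_atMost less_Suc_eq_le)
          qed
          then show False using no by simp
        qed
      qed
      have "card {..<N} \<le> r * (n - 1) + (r choose 2) * (2 * k) + tau (k - 1) \<sigma>"
      proof (rule card_V0_bound[OF z_def Q_def w_def s_def])
        fix i assume "i < r"
        then have "ES k m ((s + 1) * (w i + k)) + (s + 1) * (w i + k) + 1 \<le> n0"
          unfolding n0_def by (intro member_le_sum[of i "{..<r}" "\<lambda>i. ES k m ((s + 1) * (w i + k)) + (s + 1) * (w i + k) + 1"]) auto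
        then show "ES k m ((s + 1) * (w i + k)) \<le> n \<and> (s + 1) * (w i + k) < n" using n(1) by linarith
      qed
      \<comment> \<open>Destroying connections costs \<open>2 * k\<close> vertices per pair of
        cycles, within the \<open>4 * k\<close> of the stated bound.\<close>
      moreover have "(r choose 2) * (2 * k) \<le> 4 * k * (r choose 2)" by (simp add: mult_ac)
      ultimately show False unfolding N_def by simp
    qed
    then show "ramsey_number k {..<n} (loose_cycle_edges k n) V E
        \<le> r * (n - 1) + 4 * k * (r choose 2) + tau (k - 1) \<sigma> + 1"
      unfolding ramsey_number_def N_def[symmetric] by (intro Least_le) auto
  qed
qed

end
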